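(* Fix $\beta_0\in(0,\tfrac\pi2)$ and consider the inner equation described in the context. There exist $\kappa_0,b_1>0$ such that for any $\kappa\ge\kappa_0$ the invariance equation $$\partial_U Z=\mathcal A Z+\mathcal R[Z]$$ has analytic solutions $Z^\diamond(U)=(W^\diamond(U),X^\diamond(U),Y^\diamond(U))^T$, $U\in D^\diamond_\kappa$, $\diamond=u,s$, satisfying $$|U^{8/3}W^\diamond(U)|\le b_1,\qquad |U^{4/3}X^\diamond(U)|\le b_1,\qquad |U^{4/3}Y^\diamond(U)|\le b_1.$$ In addition, there exist $\Theta\in\mathbb C$ and $b_2>0$ independent of $\kappa$, and a function $\chi=(\chi_1,\chi_2,\chi_3)^T$, such that $$\Delta Z(U)=Z^u(U)-Z^s(U)=\Theta e^{-iU}\big((0,0,1)^T+\chi(U)\big),$$ and, for $U\in E_\kappa$, $$|U^{7/3}\chi_1(U)|\le b_2,\qquad |U^2\chi_2(U)|\le b_2,\qquad |U\chi_3(U)|\le b_2.$$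
   Context: Let $\mathcal H(U,W,X,Y)=W+XY+\mathcal K(U,W,X,Y)$, where $$\mathcal K=-\tfrac34U^{2/3}W^2-\frac1{3U^{2/3}}\Big(\frac1{\sqrt{1+\mathcal J}}-1\Big),$$ $$\mathcal J=\frac{4W^2}{9U^{2/3}}-\frac{16W}{27U^{4/3}}+\frac{16}{81U^2}+\frac{4(X+Y)}{9U}\Big(W-\frac2{3U^{2/3}}\Big)-\frac{4i(X-Y)}{3U^{2/3}}-\frac{X^2+Y^2}{3U^{4/3}}+\frac{10XY}{9U^{4/3}}.$$ With $Z=(W,X,Y)$, $\mathcal A=\mathrm{diag}(0,i,-i)$, $f=(-\partial_U\mathcal K,\,i\partial_Y\mathcal K,\,-i\partial_X\mathcal K)^T$, $g=\partial_W\mathcal K$, the Hamiltonian equations are $\dot U=1+g(U,Z)$, $\dot Z=\mathcal AZ+f(U,Z)$, and graphs $Z(U)$ invariant for them satisfy $\partial_UZ=\mathcal AZ+\mathcal R[Z]$ with $\mathcal R[\varphi](U)=\frac{f(U,\varphi(U))-g(U,\varphi(U))\mathcal A\varphi(U)}{1+g(U,\varphi(U))}$. Domains: $D^u_\kappa=\{U\in\mathbb C:|\operatorname{Im}U|\ge\tan\beta_0\operatorname{Re}U+\kappa\}$, $D^s_\kappa=-D^u_\kappa$, $E_\kappa=D^u_\kappa\cap D^s_\kappa\cap\{\operatorname{Im}U<0\}$. Fractional powers of $U$ are taken with a continuous determination of $\arg U$ on each domain with $\arg U\in(-\pi,0)$ on $\{\operatorname{Im}U<0\}$ (the branch inherited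 from $\arg U\in(-\tfrac{3\pi}2,\tfrac\pi2)$). *)

theory Defs
  imports "HOL-Analysis.Analysis"
begin

definition Du :: "real \<Rightarrow> real \<Rightarrow> complex set" where
  "Du \<beta>0 \<kappa> = {U. \<bar>Im U\<bar> \<ge> tan \<beta>0 * Re U + \<kappa>}"

definition Ds :: "real \<Rightarrow> real \<Rightarrow> complex set" where
  "Ds \<beta>0 \<kappa> = uminus ` Du \<beta>0 \<kappa>"

definition Ek :: "real \<Rightarrow> real \<Rightarrow> complex set" where
  "Ek \<beta>0 \<kappa> = Du \<beta>0 \<kappa> \<inter> Ds \<beta>0 \<kappa> \<inter> {U. Im U < 0}"

text \<open>On D^s the continuous determination of arg with arg in (-pi,0) on the lower
half plane is the principal one (Ln).  On D^u (which contains the negative real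
axis but no positive reals) it is arg in (-2 pi, 0): principal on Im U < 0,
shifted by -2 pi i elsewhere.\<close>

definition ln_u :: "complex \<Rightarrow> complex" where
  "ln_u U = (if Im U < 0 then Ln U else Ln U - 2 * of_real pi * \<i>)"

definition cpw :: "(complex \<Rightarrow> complex) \<Rightarrow> real \<Rightarrow> complex \<Rightarrow> complex" where
  "cpw lg a U = exp (of_real a * lg U)"

definition inner_J :: "(complex \<Rightarrow> complex) \<Rightarrow> complex \<Rightarrow> complex \<Rightarrow> complex \<Rightarrow> complex \<Rightarrow> complex" where
  "inner_J lg U W X Y =
      4 * W^2 / (9 * cpw lg (2/3) U)
    - 16 * W / (27 * cpw lg (4/3) U)
    + 16 / (81 * U^2)
    + 4 * (X + Y) / (9 * U) * (W - 2 / (3 * cpw lg (2/3) U))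
    - 4 * \<i> * (X - Y) / (3 * cpw lg (2/3) U)
    - (X^2 + Y^2) / (3 * cpw lg (4/3) U)
    + 10 * X * Y / (9 * cpw lg (4/3) U)"

definition inner_K :: "(complex \<Rightarrow> complex) \<Rightarrow> complex \<Rightarrow> complex \<Rightarrow> complex \<Rightarrow> complex \<Rightarrow> complex" where
  "inner_K lg U W X Y =
      - (3/4) * cpw lg (2/3) U * W^2
      - 1 / (3 * cpw lg (2/3) U) * (1 / csqrt (1 + inner_J lg U W X Y) - 1)"

definition inner_H :: "(complex \<Rightarrow> complex) \<Rightarrow> complex \<Rightarrow> complex \<Rightarrow> complex \<Rightarrow> complex \<Rightarrow> complex" where
  "inner_H lg U W X Y = W + X * Y + inner_K lg U W X Y"

definition inner_g :: "(complex \<Rightarrow> complex) \<Rightarrow> complex \<Rightarrow> complex \<Rightarrow> complex \<Rightarrow> complex \<Rightarrow> complex" where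
  "inner_g lg U W X Y = deriv (\<lambda>w. inner_K lg U w X Y) W"

definition inner_f1 :: "(complex \<Rightarrow> complex) \<Rightarrow> complex \<Rightarrow> complex \<Rightarrow> complex \<Rightarrow> complex \<Rightarrow> complex" where
  "inner_f1 lg U W X Y = - deriv (\<lambda>u. inner_K lg u W X Y) U"

definition inner_f2 :: "(complex \<Rightarrow> complex) \<Rightarrow> complex \<Rightarrow> complex \<Rightarrow> complex \<Rightarrow> complex \<Rightarrow> complex" where
  "inner_f2 lg U W X Y = \<i> * deriv (\<lambda>y. inner_K lg U W X y) Y"

definition inner_f3 :: "(complex \<Rightarrow> complex) \<Rightarrow> complex \<Rightarrow> complex \<Rightarrow> complex \<Rightarrow> complex \<Rightarrow> complex" where
  "inner_f3 lg U W X Y = - \<i> * deriv (\<lambda>x. inner_K lg U W x Y) X"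

text \<open>Components of R[phi](U) = (f - g A phi)/(1+g), A = diag(0, i, -i).\<close>

definition inner_R1 :: "(complex \<Rightarrow> complex) \<Rightarrow> complex \<Rightarrow> complex \<Rightarrow> complex \<Rightarrow> complex \<Rightarrow> complex" where
  "inner_R1 lg U W X Y = (inner_f1 lg U W X Y - inner_g lg U W X Y * (0 * W)) / (1 + inner_g lg U W X Y)"

definition inner_R2 :: "(complex \<Rightarrow> complex) \<Rightarrow> complex \<Rightarrow> complex \<Rightarrow> complex \<Rightarrow> complex \<Rightarrow> complex" where
  "inner_R2 lg U W X Y = (inner_f2 lg U W X Y - inner_g lg U W X Y * (\<i> * X)) / (1 + inner_g lg U W X Y)"

definition inner_R3 :: "(complex \<Rightarrow> complex) \<Rightarrow> complex \<Rightarrow> complex \<Rightarrow> complex \<Rightarrow> complex \<Rightarrow> complex" where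
  "inner_R3 lg U W X Y = (inner_f3 lg U W X Y - inner_g lg U W X Y * (- \<i> * Y)) / (1 + inner_g lg U W X Y)"

definition invariant_solution ::
  "(complex \<Rightarrow> complex) \<Rightarrow> complex set \<Rightarrow> (complex \<Rightarrow> complex) \<Rightarrow> (complex \<Rightarrow> complex) \<Rightarrow> (complex \<Rightarrow> complex) \<Rightarrow> bool" where
  "invariant_solution lg D W X Y \<longleftrightarrow>
     W analytic_on D \<and> X analytic_on D \<and> Y analytic_on D \<and>
     (\<forall>U\<in>D. 1 + inner_g lg U (W U) (X U) (Y U) \<noteq> 0 \<and>
        (W has_field_derivative (0 * W U + inner_R1 lg U (W U) (X U) (Y U))) (at U) \<and>
        (X has_field_derivative (\<i> * X U + inner_R2 lg U (W U) (X U) (Y U))) (at U) \<and>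
        (Y has_field_derivative (- \<i> * Y U + inner_R3 lg U (W U) (X U) (Y U))) (at U))"

end

theory Submission
  imports Defs "HOL-Complex_Analysis.Complex_Analysis"
begin

text \<open>
Put $d = 1/U$ and rescale $w = U^{8/3} W$, $x = U^{4/3} X$, $y = U^{4/3} Y$. Because
$\mathcal J$ is $U^{-2}$ times a polynomial in $1/U$, $w/U$, $x$, $y$, all fractional powers
disappear and the invariance equation becomes
$U w' = \frac83 w + F_1$, $x' = i x + \frac43 x/U + F_2$, $y' = -i y + \frac43 y/U + F_3$
with $F_j$ analytic and bounded; $F_2$ and $F_3$ depend on the unknowns only at order $U^{-2}$, and $F_1$
depends on $w$ only through $w/U$. Each component is solved by integrating along a flow which keeps the
sector invariant and for which the linear part is damped: the radial flow for $w$, and the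
translations along the sides of the sector for $x$ and $y$. A contraction then gives bounded solutions.

On the common cone the difference of the two solutions, multiplied by $U^{-4/3}$, solves a linear system
$U V' = \frac43 V + A_1$, $X' = i X + A_2$, $Y' = -i Y + A_3$ with $A_2, A_3 = O(U^{-2})$. Integrating $V$ and
$X$ from infinity and $Y$ from the apex of the cone bounds everything by $e^{\mathrm{Im}\, U}$ times the
value of $Y$ at the apex. Hence $e^{iU} Y$ has derivative $O(U^{-2})$ and a limit $\Theta$ at infinity, which
vanishes only if the whole difference does.
\<close>

subsection \<open>Damped linear equations along affine flows\<close>

text \<open>Boundedness replaces data at infinity. Along each chosen flow the homogeneous solutions
  grow at least like \<open>exp (\<sigma> * s)\<close>, so a bounded solution must be the integral
  of its forcing over the whole forward orbit. One inequality then serves three purposes: it bounds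
  a solution by its forcing, it makes the nonlinear iteration contract, and it controls the
  difference of two solutions. The available rate is only \<sigma> = sin \<beta>0, because the sides
  of the sector are the steepest directions in which it can be translated into itself; all constants
  are measured against \<sigma>. In the difference problem the homogeneous solutions have size
  |U|^(4/3), exp(- Im U) and exp(Im U). On the cone only the last is bounded, so a bounded
  difference has a single free constant, which can be read at the apex or as the limit at infinity.
  Comparing the two readings shows that \<Theta> = 0 forces the whole difference to vanish; this is
  what allows \<Theta> to be factored out in the definition of \<chi>.\<close>

lemma exp_decay_curve_bound:
  fixes k :: "real \<Rightarrow> complex"
  assumes der: "\<And>t. 0 \<le> t \<Longrightarrow> (k has_vector_derivative k' t) (at t)"
    and bd: "\<And>t. 0 \<le> t \<Longrightarrow> cmod (k' t) \<le> H * exp (- \<sigma> * t)"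
    and \<sigma>: "0 < \<sigma>" and T: "0 \<le> T"
  shows "cmod (k T - k 0) \<le> H / \<sigma>"
proof (cases "T = 0")
  case True
  have "0 \<le> H" using order_trans[OF norm_ge_zero bd[of 0]] by simp
  then show ?thesis using True \<sigma> by simp
next
  case False
  have H: "0 \<le> H" using order_trans[OF norm_ge_zero bd[of 0]] by simp
  have "cmod (k T - k 0) \<le> - H / \<sigma> * exp (- \<sigma> * T) - (- H / \<sigma> * exp (- \<sigma> * 0))"
  proof (rule differentiable_bound_general[where f' = k' and \<phi>' = "\<lambda>t. H * exp (- \<sigma> * t)"])
    show "0 < T" using False T by simp
    show "continuous_on {0..T} k"
      by (rule continuous_at_imp_continuous_on) (use der has_vector_derivative_continuous in fastforce)
    show "continuous_on {0..T} (\<lambda>t. - H / \<sigma> * exp (- \<sigma> * t))"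
      by (intro continuous_intros)
    show "(k has_vector_derivative k' x) (at x)" if "0 < x" "x < T" for x
      using der that by simp
    show "((\<lambda>t. - H / \<sigma> * exp (- \<sigma> * t)) has_vector_derivative H * exp (- \<sigma> * x)) (at x)" for x
      unfolding has_real_derivative_iff_has_vector_derivative[symmetric]
      by (rule derivative_eq_intros refl | use \<sigma> in simp)+
    show "cmod (k' x) \<le> H * exp (- \<sigma> * x)" if "0 < x" "x < T" for x
      using bd that by simp
  qed
  also have "\<dots> \<le> H / \<sigma>" using H \<sigma> by (simp add: divide_nonneg_pos)
  finally show ?thesis .
qed

text \<open>One shape for both motions: \<open>a = 1\<close>, \<open>B = 0\<close> gives dilations
  in logarithmic time, \<open>a = 0\<close> and \<open>B t = t b\<close> gives translations.\<close>

definition aflow :: "real \<Rightarrow> (real \<Rightarrow> complex) \<Rightarrow> real \<Rightarrow> complex \<Rightarrow> complex" where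
  "aflow a B t U = of_real (exp (a * t)) * U + B t"

text \<open>\<open>B_exp\<close> is the integrated form of \<open>B_deriv\<close> with
  \<open>B 0 = 0\<close>. It says that the differential of the flow, multiplication by
  \<open>exp (a * t)\<close>, carries the generating vector field to itself.\<close>

locale affine_flow =
  fixes D :: "complex set" and a :: real and b :: complex and B :: "real \<Rightarrow> complex"
  assumes stays: "\<And>U t. U \<in> D \<Longrightarrow> 0 \<le> t \<Longrightarrow> aflow a B t U \<in> D"
    and B0: "B 0 = 0"
    and B_deriv: "\<And>t. (B has_vector_derivative of_real a * B t + b) (at t)"
    and B_exp: "\<And>t. of_real (exp (a * t)) * b = of_real a * B t + b"
begin

abbreviation \<phi> where "\<phi> \<equiv> aflow a B"

definition vf :: "complex \<Rightarrow> complex" where "vf U = of_real a * U + b"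

lemma flow_0: "\<phi> 0 U = U" by (simp add: aflow_def B0)

lemma flow_deriv: "((\<lambda>t. \<phi> t U) has_vector_derivative vf (\<phi> t U)) (at t)"
  unfolding aflow_def vf_def
  by (rule derivative_eq_intros B_deriv refl | simp add: algebra_simps scaleR_conv_of_real)+

lemma flow_vf: "of_real (exp (a * t)) * vf U = vf (\<phi> t U)"
  using B_exp[of t] by (simp add: aflow_def vf_def algebra_simps)

lemma continuous_B: "continuous_on A B"
  using B_deriv by (intro continuous_at_imp_continuous_on) (auto intro: has_vector_derivative_continuous)

text \<open>Along an orbit the equation reads dX/dt = \<mu> X - h, so
  \<open>exp (- \<mu> * t) * X\<close> has derivative \<open>- exp (- \<mu> * t) * h\<close>;
  integrate up to T and let T tend to infinity. The bound \<open>K\<close> only removes the end term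
  and leaves no trace in the conclusion, so a crude a priori bound is enough.\<close>

lemma solution_bound:
  assumes der: "\<And>t. 0 \<le> t \<Longrightarrow> (X has_field_derivative X' (\<phi> t U)) (at (\<phi> t U))"
    and eq: "\<And>t. 0 \<le> t \<Longrightarrow> vf (\<phi> t U) * X' (\<phi> t U) = \<mu> * X (\<phi> t U) - h (\<phi> t U)"
    and bdd: "\<And>t. 0 \<le> t \<Longrightarrow> cmod (X (\<phi> t U)) \<le> K"
    and hbd: "\<And>t. 0 \<le> t \<Longrightarrow> cmod (h (\<phi> t U)) \<le> H"
    and \<sigma>: "0 < \<sigma>" "\<sigma> \<le> Re \<mu>"
  shows "cmod (X U) \<le> H / \<sigma>"
proof -
  define k where "k = (\<lambda>t. exp (- \<mu> * of_real t) * X (\<phi> t U))"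
  define k' where "k' = (\<lambda>t. - (exp (- \<mu> * of_real t) * h (\<phi> t U)))"
  have H0: "0 \<le> H" using hbd[of 0] order_trans norm_ge_zero by blast
  have ex: "cmod (exp (- \<mu> * of_real t)) \<le> exp (- \<sigma> * t)" if "0 \<le> t" for t
    using that \<sigma> by (simp add: mult_right_mono)
  have dk: "(k has_vector_derivative k' t) (at t)" if "0 \<le> t" for t
  proof -
    have 1: "((\<lambda>t. X (\<phi> t U)) has_vector_derivative vf (\<phi> t U) * X' (\<phi> t U)) (at t)"
      using field_vector_diff_chain_at[OF flow_deriv der[OF that]] by (simp add: o_def)
    have 2: "((\<lambda>t. exp (- \<mu> * of_real t)) has_vector_derivative - \<mu> * exp (- \<mu> * of_real t)) (at t)"
      by (rule has_vector_derivative_real_field) (rule derivative_eq_intros refl | simp)+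
    have 3: "h (\<phi> t U) = \<mu> * X (\<phi> t U) - vf (\<phi> t U) * X' (\<phi> t U)" using eq[OF that] by simp
    show ?thesis
      unfolding k_def k'_def 3
      by (rule derivative_eq_intros 1 2)+ (simp add: algebra_simps)
  qed
  have le: "cmod (k T - k 0) \<le> H / \<sigma>" if "0 \<le> T" for T
  proof (rule exp_decay_curve_bound[OF dk _ \<sigma>(1) that])
    show "cmod (k' t) \<le> H * exp (- \<sigma> * t)" if "0 \<le> t" for t
      unfolding k'_def norm_minus_cancel norm_mult
      using mult_mono[OF ex[OF that] hbd[OF that]] by (simp add: mult.commute)
  qed
  have kT: "cmod (k T) \<le> exp (- \<sigma> * T) * K" if "0 \<le> T" for T
    unfolding k_def norm_mult by (intro mult_mono ex bdd that) auto
  have "cmod (X U) \<le> H / \<sigma> + exp (- \<sigma> * T) * K" if "0 \<le> T" for T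
  proof -
    have "cmod (k 0) \<le> cmod (k T - k 0) + cmod (k T)"
      by (metis norm_minus_commute norm_triangle_sub add.commute)
    then show ?thesis using le[OF that] kT[OF that] by (simp add: k_def flow_0)
  qed
  then have 1: "\<forall>\<^sub>F T in at_top. cmod (X U) \<le> H / \<sigma> + exp (- \<sigma> * T) * K"
    by (rule eventually_at_top_linorderI)
  have "filterlim (\<lambda>T. - \<sigma> * T) at_bot at_top"
    by (rule filterlim_tendsto_neg_mult_at_bot[OF tendsto_const _ filterlim_ident]) (use \<sigma> in simp)
  then have "((\<lambda>T. H / \<sigma> + exp (- \<sigma> * T) * K) \<longlongrightarrow> H / \<sigma> + 0 * K) at_top"
    by (intro tendsto_intros filterlim_compose[OF exp_at_bot])
  from tendsto_lowerbound[OF this 1] show ?thesis by simp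
qed

text \<open>The solution sought is the integral of \<open>exp (- \<mu> * t) * h (\<phi> t U)\<close>
  over all \<open>t \<ge> 0\<close>. It is cut at the integers, so that differentiation under the
  integral takes place on compact intervals and the infinite range becomes a series.\<close>

definition partial_sol :: "complex \<Rightarrow> (complex \<Rightarrow> complex) \<Rightarrow> nat \<Rightarrow> complex \<Rightarrow> complex" where
  "partial_sol \<mu> h n U = integral {real n..real (Suc n)} (\<lambda>t. exp (- \<mu> * of_real t) * h (\<phi> t U))"

lemma continuous_orbit:
  assumes "h holomorphic_on D" "U \<in> D" "0 \<le> c"
  shows "continuous_on {c..d} (\<lambda>t. exp (- \<mu> * of_real t) * h (\<phi> t U))"
proof -
  have "continuous_on {c..d} (\<lambda>t. h (\<phi> t U))"
    using assms stays
    by (intro continuous_on_compose2[OF holomorphic_on_imp_continuous_on[OF assms(1)]])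
      (auto simp: aflow_def intro!: continuous_intros continuous_B)
  then show ?thesis by (intro continuous_intros)
qed

text \<open>By \<open>flow_vf\<close>, \<open>vf U\<close> times the U-derivative of
  \<open>h (\<phi> t U)\<close> is its t-derivative. Integration by parts then returns
  \<open>\<mu>\<close> times the piece itself and two end terms.\<close>

lemma partial_sol_deriv:
  assumes D: "open D" and h: "h holomorphic_on D" and U: "U \<in> D" and v: "vf U \<noteq> 0"
  shows "(partial_sol \<mu> h n has_field_derivative
    (\<mu> * partial_sol \<mu> h n U
      + exp (- \<mu> * of_real (real (Suc n))) * h (\<phi> (Suc n) U) - exp (- \<mu> * of_real (real n)) * h (\<phi> n U)) / vf U) (at U)"
proof -
  obtain \<epsilon> where \<epsilon>: "0 < \<epsilon>" "ball U \<epsilon> \<subseteq> D"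
    using D U openE by blast
  let ?I = "cbox (real n) (real (Suc n))"
  let ?f = "\<lambda>u t. exp (- \<mu> * of_real t) * h (\<phi> t u)"
  let ?f' = "\<lambda>u t. exp (- \<mu> * of_real t) * (deriv h (\<phi> t u) * of_real (exp (a * t)))"
  have dh: "(h has_field_derivative deriv h u) (at u)" if "u \<in> D" for u
    using that D h holomorphic_derivI by blast
  have "((\<lambda>u. integral ?I (?f u)) has_field_derivative integral ?I (?f' U)) (at U within ball U \<epsilon>)"
  proof (rule leibniz_rule_field_derivative)
    fix u t assume u: "u \<in> ball U \<epsilon>" and t: "t \<in> ?I"
    then have "\<phi> t u \<in> D" using stays \<epsilon> by auto
    then have "((\<lambda>u. h (\<phi> t u)) has_field_derivative deriv h (\<phi> t u) * of_real (exp (a * t))) (at u)"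
      by (intro DERIV_chain2[OF dh]) (auto simp: aflow_def intro!: derivative_eq_intros)
    then show "((\<lambda>u. ?f u t) has_field_derivative ?f' u t) (at u within ball U \<epsilon>)"
      by (intro DERIV_cmult) (rule has_field_derivative_at_within)
  next
    fix u assume "u \<in> ball U \<epsilon>"
    then show "?f u integrable_on ?I"
      using continuous_orbit[OF h, of u] \<epsilon> by (intro integrable_continuous) auto
  next
    have c: "continuous_on D (deriv h)"
      using D h holomorphic_deriv holomorphic_on_imp_continuous_on by blast
    have "continuous_on (ball U \<epsilon> \<times> ?I) (\<lambda>p. \<phi> (snd p) (fst p))"
      unfolding aflow_def by (intro continuous_intros continuous_on_compose2[OF continuous_B]) auto
    then have "continuous_on (ball U \<epsilon> \<times> ?I) (\<lambda>p. deriv h (\<phi> (snd p) (fst p)))"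
      by (rule continuous_on_compose2[OF c]) (use \<epsilon> stays in auto)
    then show "continuous_on (ball U \<epsilon> \<times> ?I) (\<lambda>(u, t). ?f' u t)"
      unfolding case_prod_beta by (intro continuous_intros)
  qed (use \<epsilon> in auto)
  then have 1: "(partial_sol \<mu> h n has_field_derivative integral ?I (?f' U)) (at U)"
    using \<epsilon> unfolding partial_sol_def by (simp add: at_within_open[of U "ball U \<epsilon>"])
  have "(?f U has_vector_derivative vf U * ?f' U t - \<mu> * ?f U t) (at t within {real n..real (Suc n)})"
    if "t \<in> {real n..real (Suc n)}" for t
  proof -
    have "\<phi> t U \<in> D" using that stays U by auto
    from field_vector_diff_chain_at[OF flow_deriv dh[OF this]]
    have 1: "((\<lambda>t. h (\<phi> t U)) has_vector_derivative of_real (exp (a * t)) * vf U * deriv h (\<phi> t U)) (at t)"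
      by (simp add: o_def flow_vf)
    have 2: "((\<lambda>t. exp (- \<mu> * of_real t)) has_vector_derivative - \<mu> * exp (- \<mu> * of_real t)) (at t)"
      by (rule has_vector_derivative_real_field) (rule derivative_eq_intros refl | simp)+
    show ?thesis
      by (rule has_vector_derivative_at_within) ((rule derivative_eq_intros 1 2)+, simp add: algebra_simps)
  qed
  from fundamental_theorem_of_calculus[OF _ this]
  have "((\<lambda>t. vf U * ?f' U t - \<mu> * ?f U t) has_integral ?f U (real (Suc n)) - ?f U (real n)) {real n..real (Suc n)}"
    by simp
  from has_integral_add[OF this has_integral_mult_right[of "?f U" _ _ \<mu>, OF integrable_integral[OF integrable_continuous_real[OF continuous_orbit[OF h U]]]]]
  have "((\<lambda>t. vf U * ?f' U t) has_integral
      ?f U (real (Suc n)) - ?f U (real n) + \<mu> * partial_sol \<mu> h n U) {real n..real (Suc n)}"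
    by (simp add: partial_sol_def)
  from has_integral_mult_right[OF this, of "1 / vf U"] v
  have "(?f' U has_integral (?f U (real (Suc n)) - ?f U (real n) + \<mu> * partial_sol \<mu> h n U) / vf U) {real n..real (Suc n)}"
    by simp
  then have "integral ?I (?f' U) = (?f U (real (Suc n)) - ?f U (real n) + \<mu> * partial_sol \<mu> h n U) / vf U"
    by (simp add: integral_unique)
  with 1 show ?thesis by (simp add: algebra_simps)
qed

lemma partial_sol_bound:
  assumes h: "h holomorphic_on D" and U: "U \<in> D"
    and hbd: "\<And>U. U \<in> D \<Longrightarrow> cmod (h U) \<le> H"
    and \<sigma>: "0 < \<sigma>" "\<sigma> \<le> Re \<mu>"
  shows "cmod (partial_sol \<mu> h n U) \<le> H * exp (- \<sigma>) ^ n"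
proof -
  have "cmod (exp (- \<mu> * of_real t) * h (\<phi> t U)) \<le> exp (- \<sigma> * n) * H" if "t \<in> {real n..real (Suc n)}" for t
  proof -
    have "\<sigma> * n \<le> Re \<mu> * t" using that \<sigma> by (intro mult_mono) auto
    then show ?thesis
      unfolding norm_mult using that stays U by (intro mult_mono hbd) auto
  qed
  from integral_bound[of "real n" "real (Suc n)", OF _ continuous_orbit[OF h U] this] show ?thesis
    by (simp add: partial_sol_def exp_of_nat_mult[symmetric] mult_ac)
qed

lemma solution_exists:
  assumes D: "open D" and h: "h holomorphic_on D" and v: "\<And>U. U \<in> D \<Longrightarrow> vf U \<noteq> 0"
    and hbd: "\<And>U. U \<in> D \<Longrightarrow> cmod (h U) \<le> H"
    and \<sigma>: "0 < \<sigma>" "\<sigma> \<le> Re \<mu>"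
  obtains X where "\<And>U. U \<in> D \<Longrightarrow> (X has_field_derivative (\<mu> * X U - h U) / vf U) (at U)"
    and "\<And>U. U \<in> D \<Longrightarrow> cmod (X U) \<le> H / \<sigma>"
proof (cases "D = {}")
  case True
  then show ?thesis using that by auto
next
  case False
  then have H: "0 \<le> H" using hbd order_trans norm_ge_zero by blast
  let ?F = "\<lambda>n U. \<Sum>k<n. partial_sol \<mu> h k U"
  let ?X = "\<lambda>U. \<Sum>k. partial_sol \<mu> h k U"
  have q: "exp (- \<sigma>) < 1" using \<sigma> by simp
  have sm: "summable (\<lambda>n. H * exp (- \<sigma>) ^ n)"
    using q by (intro summable_mult summable_geometric) auto
  have ul: "uniform_limit D ?F ?X sequentially"
    by (rule Weierstrass_m_test[OF partial_sol_bound[OF h _ hbd \<sigma>] sm])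
  have dF: "(?F n has_field_derivative
      (\<mu> * ?F n U + exp (- \<mu> * of_real (real n)) * h (\<phi> n U) - h U) / vf U) (at U)" if U: "U \<in> D" for U n
  proof -
    have "(?F n has_field_derivative (\<Sum>k<n. (\<mu> * partial_sol \<mu> h k U
      + exp (- \<mu> * of_real (real (Suc k))) * h (\<phi> (Suc k) U) - exp (- \<mu> * of_real (real k)) * h (\<phi> k U)) / vf U)) (at U)"
      by (intro DERIV_sum partial_sol_deriv D h U v)
    \<comment> \<open>End terms of neighbouring pieces cancel. What survives is \<open>- h U\<close>
      and an upper end that tends to 0 with n.\<close>
    moreover have "(\<Sum>k<n. (\<mu> * partial_sol \<mu> h k U
      + exp (- \<mu> * of_real (real (Suc k))) * h (\<phi> (Suc k) U) - exp (- \<mu> * of_real (real k)) * h (\<phi> k U)) / vf U)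
      = (\<mu> * ?F n U + exp (- \<mu> * of_real (real n)) * h (\<phi> n U) - h U) / vf U"
      by (induction n) (simp_all add: flow_0 algebra_simps add_divide_distrib diff_divide_distrib)
    ultimately show ?thesis by simp
  qed
  have "\<exists>X'. \<forall>U\<in>D. (?X has_field_derivative X' U) (at U) \<and>
      (\<lambda>n. (\<mu> * ?F n U + exp (- \<mu> * of_real (real n)) * h (\<phi> n U) - h U) / vf U) \<longlonglongrightarrow> X' U"
  proof (rule has_complex_derivative_uniform_sequence[OF D dF])
    fix U assume "U \<in> D"
    then obtain e where "0 < e" "cball U e \<subseteq> D" using D open_contains_cball by blast
    then show "\<exists>d>0. cball U d \<subseteq> D \<and> uniform_limit (cball U d) ?F ?X sequentially"
      using uniform_limit_on_subset[OF ul] by blast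
  qed
  then obtain X' where X': "\<And>U. U \<in> D \<Longrightarrow> (?X has_field_derivative X' U) (at U)"
    and lim: "\<And>U. U \<in> D \<Longrightarrow>
      (\<lambda>n. (\<mu> * ?F n U + exp (- \<mu> * of_real (real n)) * h (\<phi> n U) - h U) / vf U) \<longlonglongrightarrow> X' U"
    by blast
  have eqX: "X' U = (\<mu> * ?X U - h U) / vf U" if U: "U \<in> D" for U
  proof -
    have 1: "(\<lambda>n. exp (- \<mu> * of_real (real n)) * h (\<phi> n U)) \<longlonglongrightarrow> 0"
    proof (rule Lim_null_comparison)
      show "\<forall>\<^sub>F n in sequentially. cmod (exp (- \<mu> * of_real (real n)) * h (\<phi> n U)) \<le> exp (- \<sigma>) ^ n * H"
        unfolding norm_mult using \<sigma> U stays
        by (intro always_eventually allI mult_mono hbd)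
          (auto simp: exp_of_nat_mult[symmetric] mult.commute mult_left_mono mult_right_mono)
      show "(\<lambda>n. exp (- \<sigma>) ^ n * H) \<longlonglongrightarrow> 0"
        using q by (intro tendsto_mult_left_zero LIMSEQ_power_zero) auto
    qed
    have "(\<lambda>n. (\<mu> * ?F n U + exp (- \<mu> * of_real (real n)) * h (\<phi> n U) - h U) / vf U)
      \<longlonglongrightarrow> (\<mu> * ?X U + 0 - h U) / vf U"
      by (intro tendsto_intros 1 v U tendsto_uniform_limitI[OF ul])
    with lim[OF U] show ?thesis using LIMSEQ_unique by fastforce
  qed
  \<comment> \<open>The geometric sum is weaker than the claimed \<open>H / \<sigma>\<close>; it
    only supplies the a priori bound for \<open>solution_bound\<close>.\<close>
  have bd: "cmod (?X U) \<le> (\<Sum>n. H * exp (- \<sigma>) ^ n)" if "U \<in> D" for U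
    by (rule norm_suminf_le[OF partial_sol_bound[OF h that hbd \<sigma>] sm])
  have "cmod (?X U) \<le> H / \<sigma>" if "U \<in> D" for U
  proof (rule solution_bound[where X = ?X and U = U and X' = X' and h = h and \<mu> = \<mu>])
    fix t :: real assume "0 \<le> t"
    then have "\<phi> t U \<in> D" using stays that by blast
    with X' bd hbd eqX v
    show "(?X has_field_derivative X' (\<phi> t U)) (at (\<phi> t U))"
      "cmod (?X (\<phi> t U)) \<le> (\<Sum>n. H * exp (- \<sigma>) ^ n)" "cmod (h (\<phi> t U)) \<le> H"
      "vf (\<phi> t U) * X' (\<phi> t U) = \<mu> * ?X (\<phi> t U) - h (\<phi> t U)"
      by auto
  qed (use \<sigma> in auto)
  then show ?thesis using that[of ?X] X' eqX by auto
qed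

end

subsection \<open>Nonlinear fixed points\<close>

lemma diff_of_linear_divide: "(\<mu> * (A - B) - (p - q)) / c = (\<mu> * A - p) / c - (\<mu> * B - q) / c" for A :: complex
  by (simp add: diff_divide_distrib right_diff_distrib)

text \<open>Each component may follow its own flow. Inverting the linear part costs a factor
  \<open>1 / \<sigma>\<close>, and \<open>N\<close> has Lipschitz constant
  \<open>\<sigma> / 2\<close> in the supremum norm, so the iteration contracts by 1/2; the bound
  \<open>\<sigma> * r\<close> keeps it in the ball of radius \<open>r\<close>.\<close>

theorem flow_fixed_point:
  fixes N :: "'j \<Rightarrow> complex \<Rightarrow> ('j \<Rightarrow> complex) \<Rightarrow> complex" and a :: "'j \<Rightarrow> real"
  assumes D: "open D"
    and flow: "\<And>j. affine_flow D (a j) (b j) (B j)"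
    and v: "\<And>j U. U \<in> D \<Longrightarrow> of_real (a j) * U + b j \<noteq> 0"
    and \<sigma>: "0 < \<sigma>" "\<And>j. \<sigma> \<le> Re (\<mu> j)" and r: "0 \<le> r"
    and hol: "\<And>z j. (\<And>i. z i holomorphic_on D) \<Longrightarrow> (\<And>i U. U \<in> D \<Longrightarrow> cmod (z i U) \<le> r) \<Longrightarrow>
      (\<lambda>U. N j U (\<lambda>i. z i U)) holomorphic_on D"
    and bd: "\<And>U c j. U \<in> D \<Longrightarrow> (\<And>i. cmod (c i) \<le> r) \<Longrightarrow> cmod (N j U c) \<le> \<sigma> * r"
    and lip: "\<And>U c c' e j. U \<in> D \<Longrightarrow> (\<And>i. cmod (c i) \<le> r) \<Longrightarrow> (\<And>i. cmod (c' i) \<le> r) \<Longrightarrow>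
      (\<And>i. cmod (c i - c' i) \<le> e) \<Longrightarrow> cmod (N j U c - N j U c') \<le> \<sigma> / 2 * e"
  obtains z where "\<And>j. z j holomorphic_on D" and "\<And>j U. U \<in> D \<Longrightarrow> cmod (z j U) \<le> r"
    and "\<And>j U. U \<in> D \<Longrightarrow> (z j has_field_derivative
      (\<mu> j * z j U - N j U (\<lambda>i. z i U)) / (of_real (a j) * U + b j)) (at U)"
proof -
  define dir where "dir = (\<lambda>j U. of_real (a j) * U + b j)"
  define adm where "adm z \<longleftrightarrow> (\<forall>i. z i holomorphic_on D) \<and> (\<forall>i. \<forall>U\<in>D. cmod (z i U) \<le> r)" for z :: "'j \<Rightarrow> complex \<Rightarrow> complex"
  define solves where "solves z z' \<longleftrightarrow> (\<forall>j. \<forall>U\<in>D. (z' j has_field_derivative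
      (\<mu> j * z' j U - N j U (\<lambda>i. z i U)) / dir j U) (at U))" for z z'
  have step: "\<exists>z'. adm z' \<and> solves z z'" if z: "adm z" for z
  proof -
    have "\<exists>X. (\<forall>U\<in>D. (X has_field_derivative (\<mu> j * X U - N j U (\<lambda>i. z i U)) / dir j U) (at U)) \<and>
        (\<forall>U\<in>D. cmod (X U) \<le> r)" for j
    proof -
      interpret affine_flow D "a j" "b j" "B j" by (rule flow)
      have h: "(\<lambda>U. N j U (\<lambda>i. z i U)) holomorphic_on D"
        using z by (intro hol) (auto simp: adm_def)
      obtain X where "\<And>U. U \<in> D \<Longrightarrow> (X has_field_derivative (\<mu> j * X U - N j U (\<lambda>i. z i U)) / (of_real (a j) * U + b j)) (at U)"
        "\<And>U. U \<in> D \<Longrightarrow> cmod (X U) \<le> \<sigma> * r / \<sigma>"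
      proof (rule solution_exists[OF D h, of "\<sigma> * r" \<sigma> "\<mu> j"], unfold vf_def)
        show "cmod (N j U (\<lambda>i. z i U)) \<le> \<sigma> * r" if "U \<in> D" for U
          using z that by (intro bd) (auto simp: adm_def)
      qed (use v \<sigma> in auto)
      then show ?thesis using \<sigma> unfolding dir_def by auto
    qed
    then obtain z' where z': "\<And>j U. U \<in> D \<Longrightarrow> (z' j has_field_derivative (\<mu> j * z' j U - N j U (\<lambda>i. z i U)) / dir j U) (at U)"
      "\<And>j U. U \<in> D \<Longrightarrow> cmod (z' j U) \<le> r"
      by metis
    then have "z' j holomorphic_on D" for j
      using D holomorphic_on_open by blast
    with z' show ?thesis unfolding adm_def solves_def by blast
  qed
  \<comment> \<open>\<open>T z\<close> is some bounded solution of the linear problem with the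
    nonlinearity frozen at \<open>z\<close>. Iterates are compared through
    \<open>solution_bound\<close>, which applies to any such choice.\<close>
  then obtain T where T: "\<And>z. adm z \<Longrightarrow> adm (T z) \<and> solves z (T z)" by metis
  define zs where "zs n = (T ^^ n) (\<lambda>_ _. 0)" for n
  have zs_Suc: "zs (Suc n) = T (zs n)" for n by (simp add: zs_def)
  have adm: "adm (zs n)" for n
    by (induction n) (auto simp: zs_Suc T, simp add: zs_def adm_def r)
  have sol: "solves (zs n) (zs (Suc n))" for n using T adm zs_Suc by metis
  \<comment> \<open>The first two iterates lie in the ball, whence \<open>2 * r\<close>. In the
    induction step the difference is a bounded solution whose forcing is a difference of values of
    \<open>N\<close>, so the factor gained is \<open>(\<sigma> / 2) / \<sigma>\<close>.\<close>
  have diff: "cmod (zs (Suc n) j U - zs n j U) \<le> 2 * r * (1/2) ^ n" if "U \<in> D" for n j U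
    using that
  proof (induction n arbitrary: j U)
    case 0
    have r1: "cmod (zs n j U) \<le> r" for n using adm 0 unfolding adm_def by blast
    show ?case
      using norm_triangle_ineq4[of "zs (Suc 0) j U" "zs 0 j U"] r1[of 0] r1[of "Suc 0"] by simp
  next
    case (Suc n)
    interpret affine_flow D "a j" "b j" "B j" by (rule flow)
    have vf: "vf U = of_real (a j) * U + b j" for U by (simp add: vf_def)
    let ?h = "\<lambda>U. N j U (\<lambda>i. zs (Suc n) i U) - N j U (\<lambda>i. zs n i U)"
    let ?X = "\<lambda>U. zs (Suc (Suc n)) j U - zs (Suc n) j U"
    have "cmod (?X U) \<le> (\<sigma> / 2 * (2 * r * (1/2) ^ n)) / \<sigma>"
    proof (rule solution_bound[where X = ?X and U = U and h = ?h and \<mu> = "\<mu> j" and K = "2 * r"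
          and X' = "\<lambda>U. (\<mu> j * ?X U - ?h U) / (of_real (a j) * U + b j)"])
      fix t :: real assume "0 \<le> t"
      then have t: "aflow (a j) (B j) t U \<in> D" (is "?u \<in> D") using stays Suc.prems by blast
      have "((\<lambda>U. ?X U) has_field_derivative (\<mu> j * zs (Suc (Suc n)) j ?u - N j ?u (\<lambda>i. zs (Suc n) i ?u)) / (of_real (a j) * ?u + b j)
        - (\<mu> j * zs (Suc n) j ?u - N j ?u (\<lambda>i. zs n i ?u)) / (of_real (a j) * ?u + b j)) (at ?u)"
        using sol[of n] sol[of "Suc n"] t unfolding solves_def dir_def by (intro DERIV_diff) auto
      then show "((\<lambda>U. ?X U) has_field_derivative (\<mu> j * ?X ?u - ?h ?u) / (of_real (a j) * ?u + b j)) (at ?u)"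
        by (simp only: diff_of_linear_divide)
      show "vf ?u * ((\<mu> j * ?X ?u - ?h ?u) / (of_real (a j) * ?u + b j)) = \<mu> j * ?X ?u - ?h ?u"
        using v[OF t, of j] by (simp add: vf)
      have 1: "\<And>m i. cmod (zs m i ?u) \<le> r" using adm t unfolding adm_def by blast
      show "cmod (?X ?u) \<le> 2 * r"
        using norm_triangle_ineq4[of "zs (Suc (Suc n)) j ?u" "zs (Suc n) j ?u"] 1[of "Suc (Suc n)" j] 1[of "Suc n" j] by linarith
      show "cmod (?h ?u) \<le> \<sigma> / 2 * (2 * r * (1/2) ^ n)"
        by (rule lip[OF t 1 1 Suc.IH[OF t]])
    qed (use \<sigma> in auto)
    also have "\<dots> = 2 * r * (1/2) ^ Suc n" using \<sigma> by simp
    finally show ?case .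
  qed
  let ?Z = "\<lambda>j U. \<Sum>n. zs (Suc n) j U - zs n j U"
  have zs_sum: "(\<Sum>k<n. zs (Suc k) j U - zs k j U) = zs n j U" for n j U
    by (subst sum_lessThan_telescope) (simp add: zs_def)
  have sm: "summable (\<lambda>n. 2 * r * (1/2) ^ n)"
    by (intro summable_mult summable_geometric) auto
  have ul: "uniform_limit D (\<lambda>n. zs n j) (?Z j) sequentially" for j
    using Weierstrass_m_test[of D "\<lambda>n U. zs (Suc n) j U - zs n j U", OF diff sm] by (simp only: zs_sum)
  have lim: "(\<lambda>n. zs n j U) \<longlonglongrightarrow> ?Z j U" if "U \<in> D" for j U
    using tendsto_uniform_limitI[OF ul that] .
  have Zr: "cmod (?Z j U) \<le> r" if "U \<in> D" for j U
    using lim[OF that] adm that unfolding adm_def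
    by (intro tendsto_upperbound[OF tendsto_norm[OF lim[OF that]]]) auto
  \<comment> \<open>Tail of the geometric series; \<open>lip\<close> turns this rate into
    convergence of the nonlinear terms.\<close>
  have zZ: "cmod (zs n j U - ?Z j U) \<le> 4 * r * (1/2)^n" if U: "U \<in> D" for n j U
  proof -
    have ss: "summable (\<lambda>n. zs (Suc n) j U - zs n j U)"
      by (rule summable_comparison_test[OF _ sm]) (use diff[OF U] in auto)
    have "?Z j U - zs n j U = (\<Sum>k. zs (Suc (k + n)) j U - zs (k + n) j U)"
      by (subst suminf_minus_initial_segment[OF ss, of n]) (simp add: zs_sum)
    also have "cmod \<dots> \<le> (\<Sum>k. 2 * r * (1/2) ^ (k + n))"
      by (rule norm_suminf_le[OF diff[OF U]]) (rule summable_ignore_initial_segment[OF sm])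
    also have "\<dots> = (\<Sum>k. (2 * r * (1/2) ^ n) * (1/2) ^ k)" by (simp add: power_add mult_ac)
    also have "\<dots> = (2 * r * (1/2) ^ n) * 2"
      by (subst suminf_mult) (auto simp: suminf_geometric intro: summable_geometric)
    finally show ?thesis by (simp add: norm_minus_commute)
  qed
  have der: "(?Z j has_field_derivative (\<mu> j * ?Z j U - N j U (\<lambda>i. ?Z i U)) / dir j U) (at U)"
    if U: "U \<in> D" for j U
  proof -
    let ?d = "\<lambda>n U. (\<mu> j * zs (Suc n) j U - N j U (\<lambda>i. zs n i U)) / dir j U"
    \<comment> \<open>Uniform convergence of holomorphic functions carries over to derivatives, so
      the right-hand sides converge to the derivative of \<open>?Z j\<close>. It remains to identify
      their limit.\<close>
    have "\<exists>X'. \<forall>U\<in>D. (?Z j has_field_derivative X' U) (at U) \<and> (\<lambda>n. ?d n U) \<longlonglongrightarrow> X' U"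
    proof (rule has_complex_derivative_uniform_sequence[OF D, where f = "\<lambda>n. zs (Suc n) j"])
      show "(zs (Suc n) j has_field_derivative ?d n U) (at U)" if "U \<in> D" for n U
        using sol that unfolding solves_def by blast
      fix U assume "U \<in> D"
      then obtain e where e: "0 < e" "cball U e \<subseteq> D" using D open_contains_cball by blast
      have "uniform_limit D (\<lambda>n. zs (Suc n) j) (?Z j) sequentially"
        using filterlim_compose[OF ul filterlim_Suc] .
      with e show "\<exists>d>0. cball U d \<subseteq> D \<and> uniform_limit (cball U d) (\<lambda>n. zs (Suc n) j) (?Z j) sequentially"
        using uniform_limit_on_subset by blast
    qed
    then obtain X' where X': "(?Z j has_field_derivative X') (at U)" "(\<lambda>n. ?d n U) \<longlonglongrightarrow> X'"
      using U by blast
    have "(\<lambda>n. N j U (\<lambda>i. zs n i U)) \<longlonglongrightarrow> N j U (\<lambda>i. ?Z i U)"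
    proof (rule LIM_zero_cancel, rule Lim_null_comparison)
      show "\<forall>\<^sub>F n in sequentially. cmod (N j U (\<lambda>i. zs n i U) - N j U (\<lambda>i. ?Z i U)) \<le> \<sigma> / 2 * (4 * r * (1/2)^n)"
        using adm U by (intro always_eventually allI lip zZ Zr U) (auto simp: adm_def)
      show "(\<lambda>n. \<sigma> / 2 * (4 * r * (1/2)^n)) \<longlonglongrightarrow> 0"
        by (intro tendsto_mult_right_zero LIMSEQ_power_zero) auto
    qed
    then have "(\<lambda>n. ?d n U) \<longlonglongrightarrow> (\<mu> j * ?Z j U - N j U (\<lambda>i. ?Z i U)) / dir j U"
      using v[OF U, of j] unfolding dir_def by (intro tendsto_intros LIMSEQ_Suc lim U) auto
    then show ?thesis using X' LIMSEQ_unique by blast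
  qed
  then have "?Z j holomorphic_on D" for j
    using D holomorphic_on_open by blast
  then show ?thesis using that[of ?Z] der Zr unfolding dir_def by blast
qed

subsection \<open>Estimates for the rescaled vector field\<close>

definition param_box :: "real \<Rightarrow> real \<Rightarrow> complex \<Rightarrow> complex \<Rightarrow> complex \<Rightarrow> complex \<Rightarrow> bool" where
  "param_box r \<delta> d b x y \<longleftrightarrow> cmod d \<le> \<delta> \<and> cmod b \<le> 1 \<and> cmod x \<le> r \<and> cmod y \<le> r"

text \<open>The parameters are $d = 1/U$, $b = w/U$, $x$, $y$. The modulus of continuity receives
$|d|$, $|b| + |b'|$, $|b - b'|$ and $|x - x'| + |y - y'|$.\<close>
definition lip_class :: "real \<Rightarrow> real \<Rightarrow> (real \<Rightarrow> real \<Rightarrow> real \<Rightarrow> real \<Rightarrow> real) \<Rightarrow>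
    (complex \<Rightarrow> complex \<Rightarrow> complex \<Rightarrow> complex \<Rightarrow> complex) \<Rightarrow> bool" where
  "lip_class r \<delta> E f \<longleftrightarrow> (\<exists>C. \<forall>d b x y b' x' y'. param_box r \<delta> d b x y \<longrightarrow> param_box r \<delta> d b' x' y' \<longrightarrow>
     cmod (f d b x y) \<le> C \<and>
     cmod (f d b x y - f d b' x' y') \<le> C * E (cmod d) (cmod b + cmod b') (cmod (b - b')) (cmod (x - x') + cmod (y - y')))"

text \<open>\<open>mod_affine\<close> is the plain Lipschitz modulus. In \<open>mod_quad\<close>,
  with \<open>d = 1/U\<close>, \<open>b = w/U\<close> and \<open>m = |b| + |b'|\<close>, every term
  is of order U^(-2) in the differences of w, x, y while w stays bounded. The term
  \<open>d * m * \<xi>\<close> is forced by products such as \<open>d * b * x\<close>.\<close>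

definition mod_affine :: "real \<Rightarrow> real \<Rightarrow> real \<Rightarrow> real \<Rightarrow> real" where "mod_affine d m \<beta> \<xi> = \<beta> + \<xi>"
definition mod_quad :: "real \<Rightarrow> real \<Rightarrow> real \<Rightarrow> real \<Rightarrow> real" where "mod_quad d m \<beta> \<xi> = d * \<beta> + (d^2 + d * m) * \<xi>"

definition nonneg_modulus :: "(real \<Rightarrow> real \<Rightarrow> real \<Rightarrow> real \<Rightarrow> real) \<Rightarrow> bool" where
  "nonneg_modulus E \<longleftrightarrow> (\<forall>d m \<beta> \<xi>. 0 \<le> d \<longrightarrow> 0 \<le> m \<longrightarrow> 0 \<le> \<beta> \<longrightarrow> 0 \<le> \<xi> \<longrightarrow> 0 \<le> E d m \<beta> \<xi>)"

lemma nonneg_mod_affine [simp]: "nonneg_modulus mod_affine" and nonneg_mod_quad [simp]: "nonneg_modulus mod_quad"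
  by (auto simp: nonneg_modulus_def mod_affine_def mod_quad_def)

section \<open>Closure properties of the Lipschitz classes\<close>

lemma lip_class_I:
  assumes "\<And>d b x y. param_box r \<delta> d b x y \<Longrightarrow> cmod (f d b x y) \<le> C"
    and "\<And>d b x y b' x' y'. param_box r \<delta> d b x y \<Longrightarrow> param_box r \<delta> d b' x' y' \<Longrightarrow>
     cmod (f d b x y - f d b' x' y') \<le> L * E (cmod d) (cmod b + cmod b') (cmod (b - b')) (cmod (x - x') + cmod (y - y'))"
    and "nonneg_modulus E"
  shows "lip_class r \<delta> E f"
  unfolding lip_class_def
proof (intro exI[of _ "max C L"] allI impI conjI)
  fix d b x y b' x' y' assume b: "param_box r \<delta> d b x y" "param_box r \<delta> d b' x' y'"
  show "cmod (f d b x y) \<le> max C L" using assms(1)[OF b(1)] by linarith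
  have "0 \<le> E (cmod d) (cmod b + cmod b') (cmod (b - b')) (cmod (x - x') + cmod (y - y'))"
    using \<open>nonneg_modulus E\<close> by (simp add: nonneg_modulus_def)
  then show "cmod (f d b x y - f d b' x' y') \<le> max C L * E (cmod d) (cmod b + cmod b') (cmod (b - b')) (cmod (x - x') + cmod (y - y'))"
    using assms(2)[OF b] by (meson max.cobounded2 mult_right_mono order_trans)
qed

lemma lip_class_E:
  assumes E: "nonneg_modulus E" and f: "lip_class r \<delta> E f"
  obtains C where "0 < C" "\<And>d b x y. param_box r \<delta> d b x y \<Longrightarrow> cmod (f d b x y) \<le> C"
    and "\<And>d b x y b' x' y'. param_box r \<delta> d b x y \<Longrightarrow> param_box r \<delta> d b' x' y' \<Longrightarrow>
     cmod (f d b x y - f d b' x' y') \<le> C * E (cmod d) (cmod b + cmod b') (cmod (b - b')) (cmod (x - x') + cmod (y - y'))"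
proof -
  obtain C where C: "\<And>d b x y b' x' y'. param_box r \<delta> d b x y \<Longrightarrow> param_box r \<delta> d b' x' y' \<Longrightarrow>
     cmod (f d b x y) \<le> C \<and>
     cmod (f d b x y - f d b' x' y') \<le> C * E (cmod d) (cmod b + cmod b') (cmod (b - b')) (cmod (x - x') + cmod (y - y'))"
    using f unfolding lip_class_def by blast
  show ?thesis
  proof (rule that[of "max C 1"])
    fix d b x y assume "param_box r \<delta> d b x y"
    then show "cmod (f d b x y) \<le> max C 1" using C by fastforce
  next
    fix d b x y b' x' y' assume b: "param_box r \<delta> d b x y" "param_box r \<delta> d b' x' y'"
    have "0 \<le> E (cmod d) (cmod b + cmod b') (cmod (b - b')) (cmod (x - x') + cmod (y - y'))"
      using E by (simp add: nonneg_modulus_def)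
    then show "cmod (f d b x y - f d b' x' y') \<le> max C 1 * E (cmod d) (cmod b + cmod b') (cmod (b - b')) (cmod (x - x') + cmod (y - y'))"
      using C[OF b] by (meson max.cobounded1 mult_right_mono order_trans)
  qed simp
qed

lemma lip_class_modulus_mono:
  assumes "lip_class r \<delta> E f" "nonneg_modulus E" "nonneg_modulus E'"
    and le: "\<And>d m \<beta> \<xi>. 0 \<le> d \<Longrightarrow> d \<le> \<delta> \<Longrightarrow> 0 \<le> m \<Longrightarrow> m \<le> 2 \<Longrightarrow> 0 \<le> \<beta> \<Longrightarrow> 0 \<le> \<xi> \<Longrightarrow> E d m \<beta> \<xi> \<le> K * E' d m \<beta> \<xi>"
  shows "lip_class r \<delta> E' f"
proof -
  obtain C where C: "0 < C" "\<And>d b x y. param_box r \<delta> d b x y \<Longrightarrow> cmod (f d b x y) \<le> C"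
    "\<And>d b x y b' x' y'. param_box r \<delta> d b x y \<Longrightarrow> param_box r \<delta> d b' x' y' \<Longrightarrow>
     cmod (f d b x y - f d b' x' y') \<le> C * E (cmod d) (cmod b + cmod b') (cmod (b - b')) (cmod (x - x') + cmod (y - y'))"
    by (rule lip_class_E[OF \<open>nonneg_modulus E\<close> assms(1)]) blast
  show ?thesis
  proof (rule lip_class_I)
    fix d b x y b' x' y' assume b: "param_box r \<delta> d b x y" "param_box r \<delta> d b' x' y'"
    have "C * E (cmod d) (cmod b + cmod b') (cmod (b - b')) (cmod (x - x') + cmod (y - y')) \<le>
       C * (K * E' (cmod d) (cmod b + cmod b') (cmod (b - b')) (cmod (x - x') + cmod (y - y')))"
      using b C(1) by (intro mult_left_mono le) (auto simp: param_box_def)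
    with C(3)[OF b] show "cmod (f d b x y - f d b' x' y') \<le> (C * K) * E' (cmod d) (cmod b + cmod b') (cmod (b - b')) (cmod (x - x') + cmod (y - y'))"
      by (simp add: mult.assoc)
  qed (use C assms in auto)
qed

text \<open>In the box \<open>d \<le> 1\<close> and \<open>m \<le> 2\<close>, so the coefficient
  \<open>d^2 + d * m\<close> is at most 3.\<close>

lemma lip_class_quad_imp_affine: "lip_class r \<delta> mod_quad f \<Longrightarrow> \<delta> \<le> 1 \<Longrightarrow> lip_class r \<delta> mod_affine f"
proof (rule lip_class_modulus_mono[of _ _ mod_quad _ _ 3])
  fix d m \<beta> \<xi> :: real assume *: "0 \<le> d" "d \<le> \<delta>" "\<delta> \<le> 1" "0 \<le> m" "m \<le> 2" "0 \<le> \<beta>" "0 \<le> \<xi>"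
  then have "d \<le> 1" by simp
  then have "d * \<beta> \<le> 1 * \<beta>" "d^2 \<le> 1" "d * m \<le> 1 * 2"
    using * by (intro mult_mono power_le_one; simp)+
  then have "d * \<beta> \<le> \<beta>" "(d^2 + d * m) * \<xi> \<le> 3 * \<xi>" using * by (auto intro!: mult_right_mono)
  then show "mod_quad d m \<beta> \<xi> \<le> 3 * mod_affine d m \<beta> \<xi>" using * by (simp add: mod_affine_def mod_quad_def)
qed auto

lemma lip_class_subset: "lip_class r \<delta> E f \<Longrightarrow> \<delta>' \<le> \<delta> \<Longrightarrow> lip_class r \<delta>' E f"
proof -
  assume f: "lip_class r \<delta> E f" and "\<delta>' \<le> \<delta>"
  then have sub: "param_box r \<delta>' d b x y \<Longrightarrow> param_box r \<delta> d b x y" for d b x y by (auto simp: param_box_def)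
  from f show "lip_class r \<delta>' E f"
    unfolding lip_class_def by (elim ex_forward) (use sub in blast)
qed

lemma lip_class_fst: "nonneg_modulus E \<Longrightarrow> (\<And>d. cmod d \<le> \<delta> \<Longrightarrow> cmod (c d) \<le> C) \<Longrightarrow> lip_class r \<delta> E (\<lambda>d b x y. c d)"
  by (rule lip_class_I[where C = C and L = 0]) (auto simp: param_box_def)

lemma lip_class_const: "nonneg_modulus E \<Longrightarrow> lip_class r \<delta> E (\<lambda>d b x y. c)"
  by (rule lip_class_fst[where C = "cmod c"]) auto

lemma lip_class_d: "nonneg_modulus E \<Longrightarrow> lip_class r \<delta> E (\<lambda>d b x y. d)"
  by (rule lip_class_fst[where C = \<delta>]) auto

lemma lip_class_b: "lip_class r \<delta> mod_affine (\<lambda>d b x y. b)"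
  by (rule lip_class_I[where C = 1 and L = 1]) (auto simp: param_box_def mod_affine_def)

lemma lip_class_x: "lip_class r \<delta> mod_affine (\<lambda>d b x y. x)"
  by (rule lip_class_I[where C = r and L = 1]) (auto simp: param_box_def mod_affine_def)

lemma lip_class_y: "lip_class r \<delta> mod_affine (\<lambda>d b x y. y)"
  by (rule lip_class_I[where C = r and L = 1]) (auto simp: param_box_def mod_affine_def)

lemma lip_class_add:
  assumes "nonneg_modulus E" "lip_class r \<delta> E f" "lip_class r \<delta> E g"
  shows "lip_class r \<delta> E (\<lambda>d b x y. f d b x y + g d b x y)"
proof -
  obtain C where C: "\<And>d b x y. param_box r \<delta> d b x y \<Longrightarrow> cmod (f d b x y) \<le> C"
    "\<And>d b x y b' x' y'. param_box r \<delta> d b x y \<Longrightarrow> param_box r \<delta> d b' x' y' \<Longrightarrow>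
     cmod (f d b x y - f d b' x' y') \<le> C * E (cmod d) (cmod b + cmod b') (cmod (b - b')) (cmod (x - x') + cmod (y - y'))"
    by (rule lip_class_E[OF \<open>nonneg_modulus E\<close> assms(2)]) blast
  obtain C' where C': "\<And>d b x y. param_box r \<delta> d b x y \<Longrightarrow> cmod (g d b x y) \<le> C'"
    "\<And>d b x y b' x' y'. param_box r \<delta> d b x y \<Longrightarrow> param_box r \<delta> d b' x' y' \<Longrightarrow>
     cmod (g d b x y - g d b' x' y') \<le> C' * E (cmod d) (cmod b + cmod b') (cmod (b - b')) (cmod (x - x') + cmod (y - y'))"
    by (rule lip_class_E[OF \<open>nonneg_modulus E\<close> assms(3)]) blast
  show ?thesis
  proof (rule lip_class_I)
    fix d b x y b' x' y' assume b: "param_box r \<delta> d b x y" "param_box r \<delta> d b' x' y'"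
    show "cmod (f d b x y + g d b x y) \<le> C + C'"
      using C(1)[OF b(1)] C'(1)[OF b(1)] norm_triangle_mono by blast
    show "cmod (f d b x y + g d b x y - (f d b' x' y' + g d b' x' y')) \<le>
       (C + C') * E (cmod d) (cmod b + cmod b') (cmod (b - b')) (cmod (x - x') + cmod (y - y'))"
      using norm_triangle_mono[OF C(2)[OF b] C'(2)[OF b]] by (simp add: distrib_right add_diff_add)
  qed fact
qed

lemma lip_class_mult:
  assumes "nonneg_modulus E" "lip_class r \<delta> E f" "lip_class r \<delta> E g"
  shows "lip_class r \<delta> E (\<lambda>d b x y. f d b x y * g d b x y)"
proof -
  obtain C where C: "0 < C" "\<And>d b x y. param_box r \<delta> d b x y \<Longrightarrow> cmod (f d b x y) \<le> C"
    "\<And>d b x y b' x' y'. param_box r \<delta> d b x y \<Longrightarrow> param_box r \<delta> d b' x' y' \<Longrightarrow>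
     cmod (f d b x y - f d b' x' y') \<le> C * E (cmod d) (cmod b + cmod b') (cmod (b - b')) (cmod (x - x') + cmod (y - y'))"
    by (rule lip_class_E[OF \<open>nonneg_modulus E\<close> assms(2)]) blast
  obtain C' where C': "0 < C'" "\<And>d b x y. param_box r \<delta> d b x y \<Longrightarrow> cmod (g d b x y) \<le> C'"
    "\<And>d b x y b' x' y'. param_box r \<delta> d b x y \<Longrightarrow> param_box r \<delta> d b' x' y' \<Longrightarrow>
     cmod (g d b x y - g d b' x' y') \<le> C' * E (cmod d) (cmod b + cmod b') (cmod (b - b')) (cmod (x - x') + cmod (y - y'))"
    by (rule lip_class_E[OF \<open>nonneg_modulus E\<close> assms(3)]) blast
  show ?thesis
  proof (rule lip_class_I)
    fix d b x y b' x' y' assume b: "param_box r \<delta> d b x y" "param_box r \<delta> d b' x' y'"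
    let ?E = "E (cmod d) (cmod b + cmod b') (cmod (b - b')) (cmod (x - x') + cmod (y - y'))"
    show "cmod (f d b x y * g d b x y) \<le> C * C'"
      unfolding norm_mult using C C' b by (intro mult_mono) auto
    have "f d b x y * g d b x y - f d b' x' y' * g d b' x' y' =
        f d b x y * (g d b x y - g d b' x' y') + g d b' x' y' * (f d b x y - f d b' x' y')"
      by (simp add: algebra_simps)
    also have "cmod \<dots> \<le> C * (C' * ?E) + C' * (C * ?E)"
      using C(1,2) C'(1,2) C(3)[OF b] C'(3)[OF b] b
      by (intro norm_triangle_mono) (auto simp: norm_mult intro!: mult_mono)
    finally show "cmod (f d b x y * g d b x y - f d b' x' y' * g d b' x' y') \<le> (2 * C * C') * ?E"
      by (simp add: algebra_simps)
  qed fact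
qed

lemma lip_class_uminus: "lip_class r \<delta> E f \<Longrightarrow> lip_class r \<delta> E (\<lambda>d b x y. - f d b x y)"
  unfolding lip_class_def by (simp add: norm_minus_commute)

lemma lip_class_diff:
  assumes "nonneg_modulus E" "lip_class r \<delta> E f" "lip_class r \<delta> E g"
  shows "lip_class r \<delta> E (\<lambda>d b x y. f d b x y - g d b x y)"
  using lip_class_add[OF assms(1,2) lip_class_uminus[OF assms(3)]] by simp

lemma lip_class_power:
  assumes "nonneg_modulus E" "lip_class r \<delta> E f"
  shows "lip_class r \<delta> E (\<lambda>d b x y. f d b x y ^ n)"
  by (induction n) (auto intro: lip_class_const lip_class_mult assms)

lemma lip_class_inverse:
  assumes "nonneg_modulus E" "lip_class r \<delta> E f" and c: "0 < c" "\<And>d b x y. param_box r \<delta> d b x y \<Longrightarrow> c \<le> cmod (f d b x y)"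
  shows "lip_class r \<delta> E (\<lambda>d b x y. inverse (f d b x y))"
proof -
  obtain C where C: "0 < C" "\<And>d b x y b' x' y'. param_box r \<delta> d b x y \<Longrightarrow> param_box r \<delta> d b' x' y' \<Longrightarrow>
     cmod (f d b x y - f d b' x' y') \<le> C * E (cmod d) (cmod b + cmod b') (cmod (b - b')) (cmod (x - x') + cmod (y - y'))"
    by (rule lip_class_E[OF \<open>nonneg_modulus E\<close> assms(2)]) blast
  have inv: "cmod (inverse (f d b x y)) \<le> inverse c" if "param_box r \<delta> d b x y" for d b x y
    unfolding norm_inverse using c(1) c(2)[OF that] by (intro le_imp_inverse_le) auto
  show ?thesis
  proof (rule lip_class_I)
    fix d b x y b' x' y' assume b: "param_box r \<delta> d b x y" "param_box r \<delta> d b' x' y'"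
    let ?E = "E (cmod d) (cmod b + cmod b') (cmod (b - b')) (cmod (x - x') + cmod (y - y'))"
    have "f d b x y \<noteq> 0" "f d b' x' y' \<noteq> 0" using c(1) c(2)[OF b(1)] c(2)[OF b(2)] by auto
    then have "inverse (f d b x y) - inverse (f d b' x' y') =
        - (inverse (f d b x y) * (f d b x y - f d b' x' y') * inverse (f d b' x' y'))"
      by (rule inverse_diff_inverse)
    also have "cmod \<dots> \<le> inverse c * (C * ?E) * inverse c"
      unfolding norm_minus_cancel norm_mult
      using inv[OF b(1)] inv[OF b(2)] C(2)[OF b] C(1) c(1) order_trans[OF norm_ge_zero C(2)[OF b]]
      by (intro mult_mono) auto
    finally show "cmod (inverse (f d b x y) - inverse (f d b' x' y')) \<le> (inverse c * C * inverse c) * ?E"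
      by (simp add: mult_ac)
  qed (use inv assms in auto)
qed

lemma Re_csqrt_ge: "1/2 \<le> Re (csqrt z)" if "1/2 \<le> Re z"
proof -
  have "(1/2)\<^sup>2 \<le> (cmod z + Re z) / 2"
    using that complex_Re_le_cmod[of z] by (simp add: power2_eq_square)
  then have "1/2 \<le> sqrt ((cmod z + Re z) / 2)" by (rule real_le_rsqrt)
  then show ?thesis by simp
qed

text \<open>The identity (s - t)(s + t) = s^2 - t^2 transfers the estimate to the roots: both have
  real part at least 1/2, so their sum has norm at least 1.\<close>

lemma lip_class_csqrt:
  assumes "nonneg_modulus E" "lip_class r \<delta> E f" and c: "\<And>d b x y. param_box r \<delta> d b x y \<Longrightarrow> 1/2 \<le> Re (f d b x y)"
  shows "lip_class r \<delta> E (\<lambda>d b x y. csqrt (f d b x y))"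
proof -
  obtain C where C: "0 < C" "\<And>d b x y. param_box r \<delta> d b x y \<Longrightarrow> cmod (f d b x y) \<le> C"
    "\<And>d b x y b' x' y'. param_box r \<delta> d b x y \<Longrightarrow> param_box r \<delta> d b' x' y' \<Longrightarrow>
     cmod (f d b x y - f d b' x' y') \<le> C * E (cmod d) (cmod b + cmod b') (cmod (b - b')) (cmod (x - x') + cmod (y - y'))"
    by (rule lip_class_E[OF \<open>nonneg_modulus E\<close> assms(2)]) blast
  show ?thesis
  proof (rule lip_class_I)
    fix d b x y b' x' y' assume b: "param_box r \<delta> d b x y" "param_box r \<delta> d b' x' y'"
    let ?E = "E (cmod d) (cmod b + cmod b') (cmod (b - b')) (cmod (x - x') + cmod (y - y'))"
    let ?s = "csqrt (f d b x y)" and ?t = "csqrt (f d b' x' y')"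
    show "cmod ?s \<le> sqrt C"
      unfolding norm_csqrt using C(2)[OF b(1)] by simp
    have "1 \<le> Re (?s + ?t)"
      using Re_csqrt_ge[OF c[OF b(1)]] Re_csqrt_ge[OF c[OF b(2)]] by simp
    then have "1 \<le> cmod (?s + ?t)" using complex_Re_le_cmod order_trans by blast
    then have "cmod (?s - ?t) \<le> cmod (?s - ?t) * cmod (?s + ?t)" by (simp add: mult_le_cancel_left1)
    also have "\<dots> = cmod (?s ^ 2 - ?t ^ 2)"
      unfolding norm_mult[symmetric] by (simp add: power2_eq_square algebra_simps)
    also have "\<dots> = cmod (f d b x y - f d b' x' y')" by (simp only: power2_csqrt)
    also have "\<dots> \<le> C * ?E" by (rule C(3)[OF b])
    finally show "cmod (?s - ?t) \<le> C * ?E" .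
  qed fact
qed

text \<open>The factor \<open>d^2\<close> is the smallness that \<open>mod_quad\<close> asks for in
  x and y; for the b-difference \<open>d^2 \<le> d\<close> is used.\<close>

lemma lip_class_d2_mult:
  assumes "lip_class r \<delta> mod_affine f" "\<delta> \<le> 1"
  shows "lip_class r \<delta> mod_quad (\<lambda>d b x y. d^2 * f d b x y)"
proof -
  obtain C where C: "0 < C" "\<And>d b x y. param_box r \<delta> d b x y \<Longrightarrow> cmod (f d b x y) \<le> C"
    "\<And>d b x y b' x' y'. param_box r \<delta> d b x y \<Longrightarrow> param_box r \<delta> d b' x' y' \<Longrightarrow>
     cmod (f d b x y - f d b' x' y') \<le> C * mod_affine (cmod d) (cmod b + cmod b') (cmod (b - b')) (cmod (x - x') + cmod (y - y'))"
    by (rule lip_class_E[OF nonneg_mod_affine assms(1)]) blast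
  show ?thesis
  proof (rule lip_class_I)
    fix d b x y b' x' y' assume b: "param_box r \<delta> d b x y" "param_box r \<delta> d b' x' y'"
    have d: "cmod d \<le> 1" using b assms(2) by (auto simp: param_box_def)
    then have d2: "(cmod d)^2 \<le> cmod d" by (simp add: power2_eq_square mult_left_le)
    then have "(cmod d)^2 \<le> 1" using d by linarith
    then show "cmod (d^2 * f d b x y) \<le> 1 * C"
      unfolding norm_mult norm_power using C(2)[OF b(1)] by (intro mult_mono) auto
    have "cmod (d^2 * f d b x y - d^2 * f d b' x' y') = (cmod d)^2 * cmod (f d b x y - f d b' x' y')"
      by (simp add: norm_mult norm_power flip: right_diff_distrib)
    also have "\<dots> \<le> (cmod d)^2 * (C * mod_affine (cmod d) (cmod b + cmod b') (cmod (b - b')) (cmod (x - x') + cmod (y - y')))"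
      by (intro mult_left_mono C(3)[OF b]) auto
    also have "\<dots> = C * ((cmod d)^2 * cmod (b - b') + (cmod d)^2 * (cmod (x - x') + cmod (y - y')))"
      by (simp add: mod_affine_def algebra_simps)
    also have "\<dots> \<le> C * mod_quad (cmod d) (cmod b + cmod b') (cmod (b - b')) (cmod (x - x') + cmod (y - y'))"
      unfolding mod_quad_def using C(1) d2 by (intro mult_left_mono add_mono mult_right_mono) (auto simp: add_increasing2)
    finally show "cmod (d^2 * f d b x y - d^2 * f d b' x' y') \<le> C * mod_quad (cmod d) (cmod b + cmod b') (cmod (b - b')) (cmod (x - x') + cmod (y - y'))" .
  qed simp
qed

lemma lip_class_db: "lip_class r \<delta> mod_quad (\<lambda>d b x y. d * b)"
proof (rule lip_class_I[where C = \<delta> and L = 1])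
  fix d b x y b' x' y' assume "param_box r \<delta> d b x y"
  then have "cmod d * cmod b \<le> \<delta> * 1" by (intro mult_mono) (auto simp: param_box_def intro: order_trans[OF norm_ge_zero])
  then show "cmod (d * b) \<le> \<delta>" by (simp add: norm_mult)
  show "cmod (d * b - d * b') \<le> 1 * mod_quad (cmod d) (cmod b + cmod b') (cmod (b - b')) (cmod (x - x') + cmod (y - y'))"
    by (simp add: mod_quad_def norm_mult flip: right_diff_distrib)
qed simp

text \<open>Needed for \<open>d * b * x\<close>, which the product rule misses because x alone does
  not have modulus \<open>mod_quad\<close>. The split
  \<open>d * (b - b') * f + d * b' * (f - f')\<close> produces the terms \<open>d * \<beta>\<close>
  and \<open>d * m * \<xi>\<close>; with \<open>f\<close> independent of b, its difference is
  governed by \<xi> alone.\<close>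

lemma lip_class_db_mult:
  assumes "lip_class r \<delta> mod_affine f" "\<And>d b x y. f d b x y = f d 0 x y"
  shows "lip_class r \<delta> mod_quad (\<lambda>d b x y. d * b * f d b x y)"
proof -
  obtain C where C: "0 < C" "\<And>d b x y. param_box r \<delta> d b x y \<Longrightarrow> cmod (f d b x y) \<le> C"
    "\<And>d b x y b' x' y'. param_box r \<delta> d b x y \<Longrightarrow> param_box r \<delta> d b' x' y' \<Longrightarrow>
     cmod (f d b x y - f d b' x' y') \<le> C * mod_affine (cmod d) (cmod b + cmod b') (cmod (b - b')) (cmod (x - x') + cmod (y - y'))"
    by (rule lip_class_E[OF nonneg_mod_affine assms(1)]) blast
  show ?thesis
  proof (rule lip_class_I)
    fix d b x y b' x' y' assume b: "param_box r \<delta> d b x y" "param_box r \<delta> d b' x' y'"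
    have "cmod d * cmod b \<le> \<delta> * 1"
      using b by (intro mult_mono) (auto simp: param_box_def intro: order_trans[OF norm_ge_zero])
    then show "cmod (d * b * f d b x y) \<le> \<delta> * C"
      unfolding norm_mult using C(2)[OF b(1)] C(1) by (intro mult_mono) (auto intro: order_trans[rotated])
    have b0: "param_box r \<delta> d 0 x y" "param_box r \<delta> d 0 x' y'" using b by (auto simp: param_box_def)
    have "d * b * f d b x y - d * b' * f d b' x' y' = d * (b - b') * f d b x y + d * b' * (f d 0 x y - f d 0 x' y')"
      using assms(2)[of d b x y] assms(2)[of d b' x' y'] by (simp add: algebra_simps)
    also have "cmod \<dots> \<le> cmod d * cmod (b - b') * C + cmod d * (cmod b + cmod b') * (C * (cmod (x - x') + cmod (y - y')))"
      using C(2)[OF b(1)] C(3)[OF b0] C(1)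
      by (intro norm_triangle_mono) (auto simp: norm_mult mod_affine_def intro!: mult_mono)
    also have "\<dots> \<le> C * mod_quad (cmod d) (cmod b + cmod b') (cmod (b - b')) (cmod (x - x') + cmod (y - y'))"
      using C(1) by (simp add: mod_quad_def algebra_simps)
    finally show "cmod (d * b * f d b x y - d * b' * f d b' x' y') \<le> C * mod_quad (cmod d) (cmod b + cmod b') (cmod (b - b')) (cmod (x - x') + cmod (y - y'))" .
  qed simp
qed

text \<open>With $d = 1/U$ and $b = w/U$: $\mathcal J = d^2$ innP, $\partial_U \mathcal J = -\frac13 d^3$ innQ,
innS is the square root of $1 + \mathcal J$, innG is $g$, and innF1, innF2, innF3 are the components of
$\mathcal R$ multiplied by $U^{11/3}$, $U^{4/3}$, $U^{4/3}$.\<close>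
definition innP :: "complex \<Rightarrow> complex \<Rightarrow> complex \<Rightarrow> complex \<Rightarrow> complex" where
  "innP d b x y = 16/81 - 4*\<i>/3 * (x - y) - 8/27 * (d * (x + y)) - 16/27 * (d * b)
     + d^2 * (- ((x^2 + y^2) / 3) + 10/9 * (x * y) + 4/9 * ((x + y) * b) + 4/9 * b^2)"

definition innQ :: "complex \<Rightarrow> complex \<Rightarrow> complex \<Rightarrow> complex \<Rightarrow> complex" where
  "innQ d b x y = 32/27 - 8*\<i>/3 * (x - y) - 40/27 * (d * (x + y)) - 64/27 * (d * b)
     + d^2 * (4 * (- ((x^2 + y^2) / 3) + 10/9 * (x * y)) + 4/3 * ((x + y) * b) + 8/9 * b^2)"

definition innS :: "complex \<Rightarrow> complex \<Rightarrow> complex \<Rightarrow> complex \<Rightarrow> complex" where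
  "innS d b x y = csqrt (1 + d^2 * innP d b x y)"

definition innG :: "complex \<Rightarrow> complex \<Rightarrow> complex \<Rightarrow> complex \<Rightarrow> complex" where
  "innG d b x y = - 3/2 * (d * b) + 1/6 * inverse (innS d b x y ^ 3) * (d^2 * (8/9 * (d * b) - 16/27 + 4/9 * (d * (x + y))))"

definition innF1 :: "complex \<Rightarrow> complex \<Rightarrow> complex \<Rightarrow> complex \<Rightarrow> complex" where
  "innF1 d b x y = (b^2 / 2 + 2/9 * innP d b x y * inverse (innS d b x y * (1 + innS d b x y))
      + 1/18 * innQ d b x y * inverse (innS d b x y ^ 3)) * inverse (1 + innG d b x y)"

definition innF2 :: "complex \<Rightarrow> complex \<Rightarrow> complex \<Rightarrow> complex \<Rightarrow> complex" where
  "innF2 d b x y = (\<i>/6 * inverse (innS d b x y ^ 3) * (4*\<i>/3 - 8/27 * d + d^2 * (10/9 * x - 2/3 * y + 4/9 * b))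
      - \<i> * (innG d b x y * x)) * inverse (1 + innG d b x y)"

definition innF3 :: "complex \<Rightarrow> complex \<Rightarrow> complex \<Rightarrow> complex \<Rightarrow> complex" where
  "innF3 d b x y = (- \<i>/6 * inverse (innS d b x y ^ 3) * (- 4*\<i>/3 - 8/27 * d + d^2 * (10/9 * y - 2/3 * x + 4/9 * b))
      + \<i> * (innG d b x y * y)) * inverse (1 + innG d b x y)"

lemmas lip_class_intros = nonneg_mod_affine nonneg_mod_quad lip_class_const lip_class_d lip_class_b lip_class_x lip_class_y lip_class_add lip_class_diff lip_class_mult lip_class_power lip_class_uminus

section \<open>Bounds for the concrete rescaled vector field\<close>

lemma norm_one_plus_ge_half: "1/2 \<le> cmod (1 + z)" "1/2 \<le> Re (1 + z)" if "cmod z \<le> 1/2"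
proof -
  show 1: "1/2 \<le> Re (1 + z)" using that abs_Re_le_cmod[of z] by simp
  then show "1/2 \<le> cmod (1 + z)" using complex_Re_le_cmod order_trans by blast
qed

lemma lip_class_small:
  assumes "lip_class r \<delta>' E f" "0 < \<epsilon>" "nonneg_modulus E" "0 < \<delta>'"
  obtains \<delta> where "0 < \<delta>" "\<delta> \<le> \<delta>'" "\<And>d b x y. param_box r \<delta> d b x y \<Longrightarrow> cmod (d * f d b x y) \<le> \<epsilon>"
proof -
  obtain C where C: "0 < C" "\<And>d b x y. param_box r \<delta>' d b x y \<Longrightarrow> cmod (f d b x y) \<le> C"
    by (rule lip_class_E[OF assms(3,1)]) blast
  show ?thesis
  proof (rule that[of "min \<delta>' (\<epsilon> / C)"])
    fix d b x y assume b: "param_box r (min \<delta>' (\<epsilon> / C)) d b x y"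
    then have "cmod d * cmod (f d b x y) \<le> \<epsilon> / C * C"
      using C assms by (intro mult_mono C(2)) (auto simp: param_box_def)
    then show "cmod (d * f d b x y) \<le> \<epsilon>" using C(1) by (simp add: norm_mult)
  qed (use C assms in auto)
qed

lemma innP_lip_class: "lip_class r \<delta> mod_affine innP"
  unfolding innP_def[abs_def] divide_inverse by (intro lip_class_intros)

lemma innQ_lip_class: "lip_class r \<delta> mod_affine innQ"
  unfolding innQ_def[abs_def] divide_inverse by (intro lip_class_intros)

text \<open>The bound on d is shrunk twice: until \<open>d^2 * innP\<close> is at most 1/2, which
  puts the radicand in a half-plane where the principal root is Lipschitz, and until
  \<open>innG\<close> is at most 1/2, which bounds the denominators away from 0.
  \<open>innF1\<close> gets only \<open>mod_affine\<close>, because \<open>x - y\<close> enters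
  \<open>innP\<close> and \<open>innQ\<close> without a factor d.\<close>

lemma innF_lip_class:
  obtains \<delta> where "0 < \<delta>" "\<delta> \<le> 1"
    and "lip_class r \<delta> mod_affine innF1" "lip_class r \<delta> mod_quad innF2" "lip_class r \<delta> mod_quad innF3"
    and "\<And>d b x y. param_box r \<delta> d b x y \<Longrightarrow> 1/2 \<le> Re (1 + d^2 * innP d b x y)"
    and "\<And>d b x y. param_box r \<delta> d b x y \<Longrightarrow> 1 + innG d b x y \<noteq> 0"
proof -
  have "lip_class r 1 mod_affine (\<lambda>d b x y. d * innP d b x y)" by (intro lip_class_intros innP_lip_class)
  then obtain \<delta>1 where \<delta>1: "0 < \<delta>1" "\<delta>1 \<le> 1"
    "\<And>d b x y. param_box r \<delta>1 d b x y \<Longrightarrow> cmod (d * (d * innP d b x y)) \<le> 1/2"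
    by (rule lip_class_small[of r 1 mod_affine _ "1/2"]) auto
  have half: "1/2 \<le> Re (1 + d^2 * innP d b x y)" if "param_box r \<delta>1 d b x y" for d b x y
    using \<delta>1(3)[OF that] by (intro norm_one_plus_ge_half) (simp add: power2_eq_square mult.assoc)
  have S: "lip_class r \<delta>1 mod_quad innS"
    unfolding innS_def[abs_def]
    by (intro lip_class_csqrt lip_class_d2_mult innP_lip_class lip_class_intros \<delta>1 half)
  have S_half: "1/2 \<le> Re (innS d b x y)" if "param_box r \<delta>1 d b x y" for d b x y
    unfolding innS_def by (rule Re_csqrt_ge[OF half[OF that]])
  have S3: "lip_class r \<delta>1 mod_quad (\<lambda>d b x y. inverse (innS d b x y ^ 3))"
  proof (rule lip_class_inverse)
    fix d b x y assume "param_box r \<delta>1 d b x y"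
    from S_half[OF this] have "1/2 \<le> cmod (innS d b x y)" using complex_Re_le_cmod order_trans by blast
    then have "(1/2)^3 \<le> cmod (innS d b x y) ^ 3" by (intro power_mono) auto
    then show "(1/2)^3 \<le> cmod (innS d b x y ^ 3)" by (simp add: norm_power)
  qed (intro lip_class_intros S | simp)+
  have S1: "lip_class r \<delta>1 mod_quad (\<lambda>d b x y. inverse (innS d b x y * (1 + innS d b x y)))"
  proof (rule lip_class_inverse)
    fix d b x y assume "param_box r \<delta>1 d b x y"
    from S_half[OF this] have "1/2 \<le> cmod (innS d b x y)" "1 \<le> cmod (1 + innS d b x y)"
      using complex_Re_le_cmod[of "innS d b x y"] complex_Re_le_cmod[of "1 + innS d b x y"] by auto
    then have "1/2 * 1 \<le> cmod (innS d b x y) * cmod (1 + innS d b x y)" by (intro mult_mono) auto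
    then show "1/2 \<le> cmod (innS d b x y * (1 + innS d b x y))" by (simp add: norm_mult)
  qed (intro lip_class_intros S | simp)+
  have S3': "lip_class r \<delta>1 mod_affine (\<lambda>d b x y. inverse (innS d b x y ^ 3))"
    by (rule lip_class_quad_imp_affine[OF S3 \<delta>1(2)])
  \<comment> \<open>The function here is \<open>innG\<close> with one factor d removed, the form to
    which \<open>lip_class_small\<close> applies.\<close>
  have "lip_class r \<delta>1 mod_affine (\<lambda>d b x y. - (3/2) * b + 1/6 * inverse (innS d b x y ^ 3) * (d * (8/9 * (d * b) - 16/27 + 4/9 * (d * (x + y)))))"
    by (intro lip_class_intros S3')
  then obtain \<delta> where \<delta>: "0 < \<delta>" "\<delta> \<le> \<delta>1" and
    "\<And>d b x y. param_box r \<delta> d b x y \<Longrightarrow> cmod (d * (- (3/2) * b + 1/6 * inverse (innS d b x y ^ 3) * (d * (8/9 * (d * b) - 16/27 + 4/9 * (d * (x + y)))))) \<le> 1/2"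
    by (rule lip_class_small[of r \<delta>1 mod_affine _ "1/2"]) (use \<delta>1 in auto)
  moreover have "d * (- (3/2) * b + 1/6 * inverse (innS d b x y ^ 3) * (d * (8/9 * (d * b) - 16/27 + 4/9 * (d * (x + y))))) = innG d b x y" for d b x y
    unfolding innG_def power2_eq_square by (simp add: ring_distribs mult_ac)
  ultimately have "cmod (innG d b x y) \<le> 1/2" if "param_box r \<delta> d b x y" for d b x y
    using that by simp
  then have G_half: "1/2 \<le> cmod (1 + innG d b x y)" if "param_box r \<delta> d b x y" for d b x y
    using norm_one_plus_ge_half(1) that by blast
  have \<delta>_le: "\<delta> \<le> 1" using \<delta> \<delta>1 by simp
  note sub = lip_class_subset[OF _ \<delta>(2)]
  have G: "lip_class r \<delta> mod_quad innG"
    unfolding innG_def[abs_def] by (intro lip_class_intros lip_class_db lip_class_d2_mult sub[OF S3] \<delta>_le)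
  have Gi: "lip_class r \<delta> mod_quad (\<lambda>d b x y. inverse (1 + innG d b x y))"
    by (rule lip_class_inverse[of _ _ _ _ "1/2"]) (intro lip_class_intros G G_half | simp)+
  show ?thesis
  proof (rule that[OF \<delta>(1) \<delta>_le])
    show "lip_class r \<delta> mod_affine innF1"
      unfolding innF1_def[abs_def] divide_inverse
      by (intro lip_class_intros innP_lip_class innQ_lip_class lip_class_quad_imp_affine[OF _ \<delta>_le] Gi sub[OF S3] sub[OF S1])
    have lin: "lip_class r \<delta> mod_quad (\<lambda>d b x y. d^2 * (10/9 * x - 2/3 * y + 4/9 * b))"
      "lip_class r \<delta> mod_quad (\<lambda>d b x y. d^2 * (10/9 * y - 2/3 * x + 4/9 * b))"
      by (intro lip_class_d2_mult lip_class_intros \<delta>_le)+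
    \<comment> \<open>Multiplied out, one term carries \<open>d * b\<close> and the other
      \<open>d^2\<close>, and each has its own rule.\<close>
    have G_mult: "innG d b x y * z = - (3/2) * (d * b * z) + 1/6 * inverse (innS d b x y ^ 3) * (d^2 * ((8/9 * (d * b) - 16/27 + 4/9 * (d * (x + y))) * z))"
      for d b x y z unfolding innG_def by (simp add: ring_distribs mult_ac)
    have Gx: "lip_class r \<delta> mod_quad (\<lambda>d b x y. innG d b x y * x)" "lip_class r \<delta> mod_quad (\<lambda>d b x y. innG d b x y * y)"
      unfolding G_mult by (intro lip_class_intros lip_class_db_mult lip_class_d2_mult sub[OF S3] \<delta>_le refl)+
    show "lip_class r \<delta> mod_quad innF2" "lip_class r \<delta> mod_quad innF3"
      unfolding innF2_def[abs_def] innF3_def[abs_def]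
      by (intro lip_class_intros lin Gx Gi sub[OF S3])+
    show "1/2 \<le> Re (1 + d^2 * innP d b x y)" if "param_box r \<delta> d b x y" for d b x y
      using that \<delta> by (intro half) (auto simp: param_box_def)
    show "1 + innG d b x y \<noteq> 0" if "param_box r \<delta> d b x y" for d b x y
      using G_half[OF that] by auto
  qed
qed

subsection \<open>Rescaling the inner equation\<close>

text \<open>In each of its four variables the function K has the shape
  \<open>A - c * (1 / csqrt (1 + j) - 1)\<close>, so this one formula yields g and all three
  components of f.\<close>

lemma deriv_inner_form:
  assumes "(j has_field_derivative j') (at z)" "(A has_field_derivative A') (at z)"
    "(c has_field_derivative c') (at z)" "1 + j z \<notin> \<real>\<^sub>\<le>\<^sub>0"
  shows "deriv (\<lambda>z. A z - c z * (1 / csqrt (1 + j z) - 1)) z =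
    A' - c' * (inverse (csqrt (1 + j z)) - 1) + c z * (j' / 2) * inverse (csqrt (1 + j z) ^ 3)"
proof (rule DERIV_imp_deriv)
  have s: "csqrt (1 + j z) \<noteq> 0" using assms(4) by auto
  have "((\<lambda>z. csqrt (1 + j z)) has_field_derivative inverse (2 * csqrt (1 + j z)) * (0 + j')) (at z)"
    by (intro DERIV_chain2[OF has_field_derivative_csqrt] assms DERIV_add DERIV_const)
  from DERIV_diff[OF assms(2) DERIV_mult[OF assms(3) DERIV_diff[OF DERIV_inverse'[OF this s] DERIV_const[of 1]]]]
  show "((\<lambda>z. A z - c z * (1 / csqrt (1 + j z) - 1)) has_field_derivative
    A' - c' * (inverse (csqrt (1 + j z)) - 1) + c z * (j' / 2) * inverse (csqrt (1 + j z) ^ 3)) (at z)"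
    unfolding inverse_eq_divide[symmetric]
    by (rule DERIV_cong) (use s in \<open>simp add: field_simps power3_eq_cube\<close>)
qed

lemma cpw_has_field_derivative:
  assumes "(lg has_field_derivative 1 / U) (at U)"
  shows "(cpw lg a has_field_derivative of_real a * cpw lg a U / U) (at U)"
  unfolding cpw_def[abs_def]
  by (rule derivative_eq_intros assms refl | simp)+

text \<open>\<open>p\<close>, \<open>k\<close>, \<open>r\<close> stand for U^(-2/3), U^(-4/3) and
  U^(-1). Keeping them abstract separates the algebra of J from the differentiation of fractional
  powers.\<close>

lemma J_form_derivative:
  fixes W X Y :: complex
  assumes [derivative_intros]: "(p has_field_derivative p') (at U)" "(k has_field_derivative k') (at U)"
    "(r has_field_derivative r') (at U)"
  shows "((\<lambda>u. 4/9 * W^2 * p u - 16/27 * W * k u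
    + 16/81 * r u ^ 2 + 4/9 * (X + Y) * r u * (W - 2/3 * p u)
    - 4/3 * \<i> * (X - Y) * p u - (X^2 + Y^2) / 3 * k u + 10/9 * X * Y * k u) has_field_derivative
    4/9 * W^2 * p' - 16/27 * W * k' + 32/81 * r U * r' + 4/9 * (X + Y) * (r' * (W - 2/3 * p U) - r U * (2/3 * p'))
    - 4/3 * \<i> * (X - Y) * p' - (X^2 + Y^2) / 3 * k' + 10/9 * X * Y * k') (at U)"
  by (auto intro!: derivative_eq_intros simp: field_simps)

lemma cpw_power: "cpw lg a U ^ n = cpw lg (a * n) U"
  by (simp add: cpw_def exp_of_nat_mult[symmetric] mult_ac)

lemma cpw_nonzero [simp]: "cpw lg a U \<noteq> 0" by (simp add: cpw_def)

text \<open>\<open>e\<close> is U^(-1/3) in the branch at hand and \<open>q\<close> its inverse.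
  Fractional powers become natural powers of \<open>e\<close>, so the identities below are
  polynomial; \<open>q\<close> enters through the growing factor U^(2/3) of K. Only a logarithm near
  the single point \<open>U\<close> is involved, which serves both branches.\<close>

locale rescaled_point =
  fixes lg :: "complex \<Rightarrow> complex" and U w x y q e :: complex
  assumes expln: "exp (lg U) = U" and lg_deriv: "(lg has_field_derivative 1 / U) (at U)"
    and regular: "1 + (1/U)^2 * innP (1/U) (w/U) x y \<notin> \<real>\<^sub>\<le>\<^sub>0"
    and q: "q = cpw lg (1/3) U" and e: "e = inverse (cpw lg (1/3) U)"
begin

abbreviation "W \<equiv> w / cpw lg (8/3) U"
abbreviation "X \<equiv> x / cpw lg (4/3) U"
abbreviation "Y \<equiv> y / cpw lg (4/3) U"
abbreviation "s \<equiv> innS (1/U) (w/U) x y"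

lemma qe: "q * e = 1" by (simp add: q e)

lemma inv_U: "inverse U = e^3"
proof -
  have "U = cpw lg (1/3) U ^ 3" using expln by (simp add: cpw_power) (simp add: cpw_def)
  then show ?thesis by (metis e power_inverse)
qed

lemma inv_cpw: "inverse (cpw lg (2/3) U) = e^2" "inverse (cpw lg (4/3) U) = e^4"
    "inverse (cpw lg (8/3) U) = e^8" "inverse (cpw lg (11/3) U) = e^11"
  by (simp_all add: e power_inverse cpw_power)

lemma cpw_q: "cpw lg (2/3) U = q^2"
  by (simp add: q cpw_power)

lemma WXY_e: "W = w * e^8" "X = x * e^4" "Y = y * e^4"
  by (simp_all only: divide_inverse[where 'a = complex] inv_cpw)

lemma c_e: "1 / (3 * cpw lg (2/3) U) = e^2 / 3"
  by (simp only: divide_inverse[where 'a = complex] inverse_mult_distrib inv_cpw mult_1_left mult.commute)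

lemmas to_e = divide_inverse[where 'a = complex] inverse_mult_distrib power_inverse[symmetric] inv_U inv_cpw

lemma inner_J_eq: "inner_J lg U W X Y = (1/U)^2 * innP (1/U) (w/U) x y"
  unfolding inner_J_def innP_def to_e by (simp add: field_simps)

lemma s_eq: "csqrt (1 + inner_J lg U W X Y) = s"
  unfolding inner_J_eq innS_def ..

lemma J_regular: "1 + inner_J lg U W X Y \<notin> \<real>\<^sub>\<le>\<^sub>0"
  unfolding inner_J_eq by (rule regular)

lemma inner_J_poly: "inner_J lg U W X Y = 4/9 * W^2 * e^2 - 16/27 * W * e^4 + 16/81 * e^6
    + 4/9 * (X + Y) * e^3 * (W - 2/3 * e^2) - 4/3 * \<i> * (X - Y) * e^2
    - 1/3 * (X^2 + Y^2) * e^4 + 10/9 * X * Y * e^4" for W X Y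
  unfolding inner_J_def to_e by (simp add: field_simps)

lemma inner_g_eq: "inner_g lg U W X Y = innG (1/U) (w/U) x y"
proof -
  have dJ: "((\<lambda>w. inner_J lg U w X Y) has_field_derivative
      8/9 * W * e^2 - 16/27 * e^4 + 4/9 * (X + Y) * e^3) (at W)"
    unfolding inner_J_poly
    by (rule derivative_eq_intros refl)+ (simp add: field_simps)
  have dA: "((\<lambda>w. - (3/4) * cpw lg (2/3) U * w^2) has_field_derivative - (3/2) * q^2 * W) (at W)"
    unfolding cpw_q by (rule derivative_eq_intros refl)+ simp
  have "inner_g lg U W X Y = - (3/2) * (q^2 * W) + 1/6 * e^2 * (8/9 * W * e^2 - 16/27 * e^4 + 4/9 * (X + Y) * e^3) * inverse (s ^ 3)"
    unfolding inner_g_def inner_K_def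
      deriv_inner_form[OF dJ dA DERIV_const J_regular] s_eq
    unfolding to_e by (simp add: field_simps)
  \<comment> \<open>The weight \<open>e^8\<close> of W outruns the growing \<open>q^2\<close>; the
    remainder \<open>w * e^6\<close> is \<open>d * b\<close> in the variables of
    \<open>innG\<close>.\<close>
  also have "q^2 * W = w * e^6 * (q * e)^2" unfolding to_e power_mult_distrib by (simp flip: power_add)
  finally have "inner_g lg U W X Y = - (3/2) * (w * e^6) + 1/6 * e^2 * (8/9 * W * e^2 - 16/27 * e^4 + 4/9 * (X + Y) * e^3) * inverse (s ^ 3)"
    by (simp add: qe mult.assoc)
  then show ?thesis unfolding innG_def unfolding to_e by (simp add: field_simps)
qed

lemma inner_f2_eq: "inner_f2 lg U W X Y = 
    \<i>/6 * inverse (s ^ 3) * (4*\<i>/3 - 8/27 * (1/U) + (1/U)^2 * (10/9 * x - 2/3 * y + 4/9 * (w/U))) * e^4"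
proof -
  have dJ: "((\<lambda>y. inner_J lg U W X y) has_field_derivative
      4/9 * e^3 * (W - 2/3 * e^2) + 4/3 * \<i> * e^2 - 2/3 * Y * e^4 + 10/9 * X * e^4) (at Y)"
    unfolding inner_J_poly
    by (rule derivative_eq_intros refl)+ (simp add: field_simps)
  have 1: "1/U = e^3" "w/U = w * e^3" by (simp_all only: divide_inverse[where 'a = complex] inv_U mult_1_left)
  \<comment> \<open>Stated for arbitrary \<open>S\<close> and \<open>z\<close>, so that the powers
    of the root stay atoms while powers of \<open>e\<close> are collected.\<close>
  have "\<i> * (0 - 0 * z + e^2 / 3 * ((4/9 * e^3 * (w * e^8 - 2/3 * e^2) + 4/3 * \<i> * e^2 - 2/3 * (y * e^4) * e^4 + 10/9 * (x * e^4) * e^4) / 2) * S)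
      = \<i>/6 * S * (4*\<i>/3 - 8/27 * e^3 + (e^3)^2 * (10/9 * x - 2/3 * y + 4/9 * (w * e^3))) * e^4" for S z
    by (simp add: field_simps flip: power_add)
  then show ?thesis
    unfolding inner_f2_def inner_K_def deriv_inner_form[OF dJ DERIV_const DERIV_const J_regular] s_eq
    unfolding c_e WXY_e 1 .
qed

lemma inner_f3_eq: "inner_f3 lg U W X Y = 
    - \<i>/6 * inverse (s ^ 3) * (- 4*\<i>/3 - 8/27 * (1/U) + (1/U)^2 * (10/9 * y - 2/3 * x + 4/9 * (w/U))) * e^4"
proof -
  have dJ: "((\<lambda>x. inner_J lg U W x Y) has_field_derivative
      4/9 * e^3 * (W - 2/3 * e^2) - 4/3 * \<i> * e^2 - 2/3 * X * e^4 + 10/9 * Y * e^4) (at X)"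
    unfolding inner_J_poly
    by (rule derivative_eq_intros refl)+ (simp add: field_simps)
  have 1: "1/U = e^3" "w/U = w * e^3" by (simp_all only: divide_inverse[where 'a = complex] inv_U mult_1_left)
  have "- \<i> * (0 - 0 * z + e^2 / 3 * ((4/9 * e^3 * (w * e^8 - 2/3 * e^2) - 4/3 * \<i> * e^2 - 2/3 * (x * e^4) * e^4 + 10/9 * (y * e^4) * e^4) / 2) * S)
      = - \<i>/6 * S * (- 4*\<i>/3 - 8/27 * e^3 + (e^3)^2 * (10/9 * y - 2/3 * x + 4/9 * (w * e^3))) * e^4" for S z
    by (simp add: field_simps flip: power_add)
  then show ?thesis
    unfolding inner_f3_def inner_K_def deriv_inner_form[OF dJ DERIV_const DERIV_const J_regular] s_eq
    unfolding c_e WXY_e 1 .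
qed

text \<open>Negative exponents in place of divisions put J into the form of
  \<open>J_form_derivative\<close>, for the derivative in U.\<close>

lemma inner_J_cpw: "inner_J lg u W X Y = 4/9 * W^2 * cpw lg (- 2/3) u - 16/27 * W * cpw lg (- 4/3) u
    + 16/81 * inverse u ^ 2 + 4/9 * (X + Y) * inverse u * (W - 2/3 * cpw lg (- 2/3) u)
    - 4/3 * \<i> * (X - Y) * cpw lg (- 2/3) u - (X^2 + Y^2) / 3 * cpw lg (- 4/3) u + 10/9 * X * Y * cpw lg (- 4/3) u"
  for u W X Y
proof -
  have c: "cpw lg (- 2/3) u = inverse (cpw lg (2/3) u)" "cpw lg (- 4/3) u = inverse (cpw lg (4/3) u)"
    by (simp_all add: cpw_def exp_minus[symmetric])
  show ?thesis unfolding inner_J_def c divide_inverse[where 'a = complex] inverse_mult_distrib power_inverse[symmetric]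
    by (simp add: field_simps)
qed

text \<open>The U-derivative falls on the growing prefactor, on the decaying prefactor and on J;
  these give the three summands, each of order \<open>e^11\<close>.\<close>

lemma inner_f1_eq: "inner_f1 lg U W X Y =
    ((w/U)^2 / 2 + 2/9 * innP (1/U) (w/U) x y * inverse (s * (1 + s)) + 1/18 * innQ (1/U) (w/U) x y * inverse (s ^ 3)) * e^11"
proof -
  note dc = cpw_has_field_derivative[OF lg_deriv]
  have U0: "U \<noteq> 0" using expln exp_not_eq_zero by metis
  have c: "cpw lg (- 2/3) U = e^2" "cpw lg (- 4/3) U = e^4"
    by (simp_all add: inv_cpw[symmetric]) (simp_all add: cpw_def exp_minus[symmetric])
  let ?J' = "- (8/27) * W^2 * e^5 + 64/81 * W * e^7 - 32/81 * e^9 - 4/9 * (X + Y) * W * e^6 + 40/81 * (X + Y) * e^8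
    + 8/9 * \<i> * (X - Y) * e^5 + 4/9 * (X^2 + Y^2) * e^7 - 40/27 * X * Y * e^7"
  have dJ: "((\<lambda>u. inner_J lg u W X Y) has_field_derivative ?J') (at U)"
    unfolding inner_J_cpw
  proof (rule DERIV_cong[OF J_form_derivative])
    show "(cpw lg (- 2/3) has_field_derivative - (2/3) * e^5) (at U)"
      "(cpw lg (- 4/3) has_field_derivative - (4/3) * e^7) (at U)"
      using dc[of "- 2/3"] dc[of "- 4/3"] unfolding c to_e by (simp_all add: mult.assoc flip: power_add)
    show "(inverse has_field_derivative - (e^6)) (at U)"
      using DERIV_inverse[OF U0] unfolding to_e by (simp flip: power_mult)
  qed (unfold c to_e, simp add: field_simps)
  have dA: "((\<lambda>u. - (3/4) * cpw lg (2/3) u * W^2) has_field_derivative - (1/2) * q^2 * e^3 * W^2) (at U)"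
    by (rule derivative_eq_intros dc refl)+ (unfold to_e cpw_q, simp)
  have dc': "((\<lambda>u. 1 / (3 * cpw lg (2/3) u)) has_field_derivative - (2/9) * e^5) (at U)"
  proof -
    have "((\<lambda>u. 1/3 * cpw lg (- 2/3) u) has_field_derivative - (2/9) * e^5) (at U)"
      by (rule derivative_eq_intros dc refl)+ (unfold c to_e, simp)
    moreover have "1 / (3 * cpw lg (2/3) u) = 1/3 * cpw lg (- 2/3) u" for u
      by (simp add: cpw_def exp_minus field_simps)
    ultimately show ?thesis by (simp only:)
  qed
  have s2: "s^2 = 1 + e^6 * innP (1/U) (w/U) x y"
    unfolding innS_def power2_csqrt to_e by simp
  have "s \<noteq> 0" using regular unfolding innS_def by auto
  moreover have "0 \<le> Re s" unfolding innS_def by (rule Re_csqrt)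
  then have "1 + s \<noteq> 0" by (metis add.commute add_nonneg_eq_0_iff one_complex.sel(1) plus_complex.sel(1) zero_complex.sel(1) zero_le_one zero_neq_one)
  \<comment> \<open>Rationalising with \<open>1 + s\<close> exposes the factor \<open>e^6\<close> of
    J inside \<open>1/s - 1\<close>. Together with the \<open>e^5\<close> of the differentiated
    prefactor it makes up \<open>e^11\<close>.\<close>
  ultimately have "inverse s - 1 = (1 - s) * inverse s * ((1 + s) * inverse (1 + s))"
    by (simp add: left_diff_distrib)
  also have "\<dots> = (1 - s^2) * inverse (s * (1 + s))"
    by (simp only: inverse_mult_distrib power2_eq_square) (simp add: algebra_simps)
  also have "\<dots> = - (e^6 * innP (1/U) (w/U) x y * inverse (s * (1 + s)))" unfolding s2 by simp
  finally have s1: "inverse s - 1 = - (e^6 * innP (1/U) (w/U) x y * inverse (s * (1 + s)))" .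
  have "q^2 * e^3 * W^2 = (q * e)^2 * e^17 * w^2" unfolding to_e power_mult_distrib by (simp flip: power_add power_mult)
  then have A: "- (1/2) * q^2 * e^3 * W^2 = - (1/2) * e^17 * w^2" by (simp add: qe)
  \<comment> \<open>Differentiating a power of 1/U multiplies it by minus its exponent and adds one
    more 1/U: the coefficients of \<open>innQ\<close> are those of \<open>innP\<close> times three
    times the explicit exponent of 1/U in J.\<close>
  have Q: "?J' = - (1/3) * innQ (1/U) (w/U) x y * e^9"
    unfolding innQ_def unfolding to_e by (simp add: field_simps)
  have "inner_f1 lg U W X Y = - (- (1/2) * e^17 * w^2 - - (2/9) * e^5 * - (e^6 * innP (1/U) (w/U) x y * inverse (s * (1 + s)))
      + 1 / (3 * cpw lg (2/3) U) * (- (1/3) * innQ (1/U) (w/U) x y * e^9 / 2) * inverse (s ^ 3))"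
    unfolding inner_f1_def inner_K_def deriv_inner_form[OF dJ dA dc' J_regular] s_eq s1 A Q ..
  also have "1 / (3 * cpw lg (2/3) U) = e^2 / 3" by (rule c_e)
  also have "- (- (1/2) * e^17 * w^2 - - (2/9) * e^5 * - (e^6 * P * S) + e^2 / 3 * (- (1/3) * Q * e^9 / 2) * T)
      = ((w * e^3)^2 / 2 + 2/9 * P * S + 1/18 * Q * T) * e^11" for P Q S T
    by (simp add: field_simps flip: power_add)
  finally show ?thesis by (simp only: divide_inverse[of w] inv_U)
qed

lemma inner_R1_eq: "inner_R1 lg U W X Y = innF1 (1/U) (w/U) x y / cpw lg (11/3) U"
proof -
  have "(A * E - G * (0 * W)) / I = A * inverse I * E" for A E G I :: complex
    by (simp only: divide_inverse mult_zero_left mult_zero_right diff_zero mult_ac)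
  then show ?thesis
    unfolding inner_R1_def inner_f1_eq inner_g_eq innF1_def
      divide_inverse[of _ "cpw lg (11/3) U"] inv_cpw .
qed

lemma inner_R2_eq: "inner_R2 lg U W X Y = innF2 (1/U) (w/U) x y / cpw lg (4/3) U"
proof -
  have "(A * E - G * (c * (x * E))) / I = (A - c * (G * x)) * inverse I * E" for A E G I c :: complex
    unfolding divide_inverse[where 'a = complex] by algebra
  then show ?thesis
    unfolding inner_R2_def inner_f2_eq inner_g_eq innF2_def
    unfolding divide_inverse[of _ "cpw lg (4/3) U"] inv_cpw .
qed

lemma inner_R3_eq: "inner_R3 lg U W X Y = innF3 (1/U) (w/U) x y / cpw lg (4/3) U"
proof -
  have "(A * E - G * (- c * (y * E))) / I = (A + c * (G * y)) * inverse I * E" for A E G I c :: complex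
    unfolding divide_inverse[where 'a = complex] by algebra
  then show ?thesis
    unfolding inner_R3_def inner_f3_eq inner_g_eq innF3_def
    unfolding divide_inverse[of _ "cpw lg (4/3) U"] inv_cpw .
qed

end

subsection \<open>Bounded solutions of the rescaled system\<close>

lemma innF_holomorphic:
  assumes hol: "d holomorphic_on D" "b holomorphic_on D" "x holomorphic_on D" "y holomorphic_on D"
    and P: "\<And>U. U \<in> D \<Longrightarrow> 1/2 \<le> Re (1 + d U ^ 2 * innP (d U) (b U) (x U) (y U))"
    and G: "\<And>U. U \<in> D \<Longrightarrow> 1 + innG (d U) (b U) (x U) (y U) \<noteq> 0"
  shows "(\<lambda>U. innF1 (d U) (b U) (x U) (y U)) holomorphic_on D"
    "(\<lambda>U. innF2 (d U) (b U) (x U) (y U)) holomorphic_on D"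
    "(\<lambda>U. innF3 (d U) (b U) (x U) (y U)) holomorphic_on D"
proof -
  have hP: "(\<lambda>U. innP (d U) (b U) (x U) (y U)) holomorphic_on D"
    unfolding innP_def by (intro holomorphic_intros hol) auto
  have hQ: "(\<lambda>U. innQ (d U) (b U) (x U) (y U)) holomorphic_on D"
    unfolding innQ_def by (intro holomorphic_intros hol) auto
  have hS: "(\<lambda>U. innS (d U) (b U) (x U) (y U)) holomorphic_on D"
    unfolding innS_def
    by (intro holomorphic_intros hol hP) (use P in \<open>force simp: complex_nonpos_Reals_iff\<close>)
  have Sre: "1/2 \<le> Re (innS (d U) (b U) (x U) (y U))" if "U \<in> D" for U
    unfolding innS_def by (rule Re_csqrt_ge[OF P[OF that]])
  have S0: "innS (d U) (b U) (x U) (y U) \<noteq> 0" if "U \<in> D" for U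
    using Sre[OF that] by auto
  have S1: "innS (d U) (b U) (x U) (y U) * (1 + innS (d U) (b U) (x U) (y U)) \<noteq> 0" if "U \<in> D" for U
  proof -
    have "0 < Re (1 + innS (d U) (b U) (x U) (y U))" using Sre[OF that] by simp
    then have "1 + innS (d U) (b U) (x U) (y U) \<noteq> 0" by force
    then show ?thesis using S0[OF that] by simp
  qed
  have hG: "(\<lambda>U. innG (d U) (b U) (x U) (y U)) holomorphic_on D"
    unfolding innG_def by (intro holomorphic_intros hol hS) (auto simp: S0)
  show "(\<lambda>U. innF1 (d U) (b U) (x U) (y U)) holomorphic_on D"
    unfolding innF1_def by (intro holomorphic_intros hol hS hP hQ hG) (use S0 S1 G in auto)
  show "(\<lambda>U. innF2 (d U) (b U) (x U) (y U)) holomorphic_on D"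
    unfolding innF2_def by (intro holomorphic_intros hol hS hG) (use S0 G in auto)
  show "(\<lambda>U. innF3 (d U) (b U) (x U) (y U)) holomorphic_on D"
    unfolding innF3_def by (intro holomorphic_intros hol hS hG) (use S0 G in auto)
qed

datatype component = CW | CX | CY

text \<open>The component $w$ is divided by a large constant $M$: $F_1$ is not a contraction in $(x, y)$,
but $F_1 / M$ is.\<close>
fun rhs :: "real \<Rightarrow> component \<Rightarrow> complex \<Rightarrow> (component \<Rightarrow> complex) \<Rightarrow> complex" where
  "rhs M CW U c = innF1 (1/U) (of_real M * c CW / U) (c CX) (c CY) / of_real M"
| "rhs M CX U c = innF2 (1/U) (of_real M * c CW / U) (c CX) (c CY)"
| "rhs M CY U c = innF3 (1/U) (of_real M * c CW / U) (c CX) (c CY)"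

definition regular_at :: "real \<Rightarrow> complex \<Rightarrow> (component \<Rightarrow> complex) \<Rightarrow> bool" where
  "regular_at M U c \<longleftrightarrow> 1/2 \<le> Re (1 + (1/U)^2 * innP (1/U) (of_real M * c CW / U) (c CX) (c CY)) \<and>
     1 + innG (1/U) (of_real M * c CW / U) (c CX) (c CY) \<noteq> 0"

lemma rhs_holomorphic:
  assumes "\<And>i. z i holomorphic_on D" "0 \<notin> D" "0 < M" "\<And>U. U \<in> D \<Longrightarrow> regular_at M U (\<lambda>i. z i U)"
  shows "(\<lambda>U. rhs M j U (\<lambda>i. z i U)) holomorphic_on D"
proof -
  have h: "(\<lambda>U. 1 / U) holomorphic_on D" "(\<lambda>U. of_real M * z CW U / U) holomorphic_on D"
    using assms(2) by (intro holomorphic_intros assms(1); auto)+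
  note F = innF_holomorphic[OF h assms(1)[of CX] assms(1)[of CY]]
  show ?thesis
    using assms(3,4) by (cases j) (auto intro!: holomorphic_intros F simp: regular_at_def)
qed

text \<open>Estimates outside a disc, measured against the growth rate \<sigma>. For x and y the
  term \<open>4/3 * c j / U\<close> is counted with the nonlinearity, since it is small far out.
  \<open>rhs_XY_decay\<close> leaves it out, because division by U^(4/3) removes it from the
  difference problem.\<close>

locale rhs_estimates =
  fixes \<sigma> R M r L :: real
  assumes \<sigma>_pos: "0 < \<sigma>" and R_ge_1: "1 \<le> R" and M_pos: "0 < M" and r_pos: "0 < r" and L_pos: "0 < L"
    and regular: "\<And>U c. R \<le> cmod U \<Longrightarrow> (\<And>i. cmod (c i) \<le> r) \<Longrightarrow> regular_at M U c"
    and rhs_W_bound: "\<And>U c. R \<le> cmod U \<Longrightarrow> (\<And>i. cmod (c i) \<le> r) \<Longrightarrow> cmod (rhs M CW U c) \<le> \<sigma> * r"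
    and rhs_XY_bound: "\<And>U c j. R \<le> cmod U \<Longrightarrow> (\<And>i. cmod (c i) \<le> r) \<Longrightarrow> j \<noteq> CW \<Longrightarrow>
        cmod (4/3 * c j / U + rhs M j U c) \<le> \<sigma> * r"
    and rhs_W_lipschitz: "\<And>U c c' e. R \<le> cmod U \<Longrightarrow> (\<And>i. cmod (c i) \<le> r) \<Longrightarrow> (\<And>i. cmod (c' i) \<le> r) \<Longrightarrow>
        (\<And>i. cmod (c i - c' i) \<le> e) \<Longrightarrow> cmod (rhs M CW U c - rhs M CW U c') \<le> \<sigma> / 2 * e"
    and rhs_XY_decay: "\<And>U c c' e j. R \<le> cmod U \<Longrightarrow> (\<And>i. cmod (c i) \<le> r) \<Longrightarrow> (\<And>i. cmod (c' i) \<le> r) \<Longrightarrow>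
        (\<And>i. cmod (c i - c' i) \<le> e) \<Longrightarrow> j \<noteq> CW \<Longrightarrow> cmod (rhs M j U c - rhs M j U c') \<le> L / cmod U ^ 2 * e"
    and rhs_XY_lipschitz: "\<And>U c c' e j. R \<le> cmod U \<Longrightarrow> (\<And>i. cmod (c i) \<le> r) \<Longrightarrow> (\<And>i. cmod (c' i) \<le> r) \<Longrightarrow>
        (\<And>i. cmod (c i - c' i) \<le> e) \<Longrightarrow> j \<noteq> CW \<Longrightarrow>
        cmod ((4/3 * c j / U + rhs M j U c) - (4/3 * c' j / U + rhs M j U c')) \<le> \<sigma> / 2 * e"

text \<open>The constants are fixed in the order r, \<delta>, M, L, R, each from earlier ones. The
  radius r can come before \<delta>, because the values of \<open>innF2\<close> and
  \<open>innF3\<close> at \<open>b = x = y = 0\<close> do not involve the box, and the deviation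
  from these values is made small by R.\<close>

lemma rhs_estimates_exist:
  assumes \<sigma>: "0 < \<sigma>"
  obtains R M r L where "rhs_estimates \<sigma> R M r L"
proof -
  \<comment> \<open>The radius 1 is a placeholder; only the values at the origin are taken from this
    box.\<close>
  obtain \<delta>1 where \<delta>1: "0 < \<delta>1" and B1: "lip_class 1 \<delta>1 mod_quad innF2" "lip_class 1 \<delta>1 mod_quad innF3"
    by (rule innF_lip_class[of 1]) blast
  obtain K2 where K2: "0 < K2" "\<And>d. cmod d \<le> \<delta>1 \<Longrightarrow> cmod (innF2 d 0 0 0) \<le> K2"
    by (rule lip_class_E[OF nonneg_mod_quad B1(1)]) (auto simp: param_box_def)
  obtain K3 where K3: "0 < K3" "\<And>d. cmod d \<le> \<delta>1 \<Longrightarrow> cmod (innF3 d 0 0 0) \<le> K3"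
    by (rule lip_class_E[OF nonneg_mod_quad B1(2)]) (auto simp: param_box_def)
  \<comment> \<open>Beyond \<open>K2 + K3\<close>, the 2 pays for \<open>4/3 * c j / U\<close> and
    for the deviation of \<open>rhs\<close> from its value at zero, each at most 1.\<close>
  define r where "r = (K2 + K3 + 2) / \<sigma>"
  have r: "0 < r" "\<sigma> * r = K2 + K3 + 2" using \<sigma> K2(1) K3(1) by (auto simp: r_def)
  obtain \<delta> where \<delta>: "0 < \<delta>" "\<delta> \<le> 1" and B: "lip_class r \<delta> mod_affine innF1" "lip_class r \<delta> mod_quad innF2" "lip_class r \<delta> mod_quad innF3"
    and reg: "\<And>d b x y. param_box r \<delta> d b x y \<Longrightarrow> 1/2 \<le> Re (1 + d^2 * innP d b x y)"
      "\<And>d b x y. param_box r \<delta> d b x y \<Longrightarrow> 1 + innG d b x y \<noteq> 0"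
    by (rule innF_lip_class[of r]) blast
  obtain C1 where C1: "0 < C1" "\<And>d b x y. param_box r \<delta> d b x y \<Longrightarrow> cmod (innF1 d b x y) \<le> C1"
    "\<And>d b x y b' x' y'. param_box r \<delta> d b x y \<Longrightarrow> param_box r \<delta> d b' x' y' \<Longrightarrow>
     cmod (innF1 d b x y - innF1 d b' x' y') \<le> C1 * mod_affine (cmod d) (cmod b + cmod b') (cmod (b - b')) (cmod (x - x') + cmod (y - y'))"
    by (rule lip_class_E[OF nonneg_mod_affine B(1)]) blast
  obtain C2 where C2: "0 < C2"
    "\<And>d b x y b' x' y'. param_box r \<delta> d b x y \<Longrightarrow> param_box r \<delta> d b' x' y' \<Longrightarrow>
     cmod (innF2 d b x y - innF2 d b' x' y') \<le> C2 * mod_quad (cmod d) (cmod b + cmod b') (cmod (b - b')) (cmod (x - x') + cmod (y - y'))"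
    by (rule lip_class_E[OF nonneg_mod_quad B(2)]) blast
  obtain C3 where C3: "0 < C3"
    "\<And>d b x y b' x' y'. param_box r \<delta> d b x y \<Longrightarrow> param_box r \<delta> d b' x' y' \<Longrightarrow>
     cmod (innF3 d b x y - innF3 d b' x' y') \<le> C3 * mod_quad (cmod d) (cmod b + cmod b') (cmod (b - b')) (cmod (x - x') + cmod (y - y'))"
    by (rule lip_class_E[OF nonneg_mod_quad B(3)]) blast
  \<comment> \<open>The first entry brings \<open>innF1 / M\<close> below
    \<open>\<sigma> * r\<close>; the second makes \<open>2 * C1 / M\<close>, its Lipschitz constant
    in x and y together, at most \<open>\<sigma> / 4\<close>.\<close>
  define M where "M = max (C1 / (\<sigma> * r)) (8 * C1 / \<sigma>)"
  have Mge: "C1 / (\<sigma> * r) \<le> M" "8 * C1 / \<sigma> \<le> M" by (auto simp: M_def)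
  have "0 < 8 * C1 / \<sigma>" using C1(1) \<sigma> by simp
  then have M: "0 < M" "C1 \<le> M * (\<sigma> * r)" "8 * C1 \<le> M * \<sigma>"
    using Mge mult_pos_pos[OF \<sigma> r(1)] \<sigma> by (linarith, simp_all only: pos_divide_le_eq)
  \<comment> \<open>\<open>M\<close> stems from the difference of b = M c/U. The rest is twice
    \<open>1 + 2 * M * r\<close>, as x and y may both differ by e.\<close>
  define L where "L = (C2 + C3) * (M + 2 + 4 * M * r)"
  have L: "0 < L" using C2(1) C3(1) M(1) r(1) by (auto simp: L_def intro!: mult_pos_pos add_pos_pos)
  \<comment> \<open>Each summand secures one estimate for |U| \<ge> R: \<open>M * r\<close> gives
    |b| \<le> 1, and \<open>6 / \<sigma>\<close> rounds up the 16/(3 \<sigma>) that makes 4/(3|U|)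
    at most \<sigma>/4.\<close>
  define R where "R = 1 + 1/\<delta>1 + 1/\<delta> + 4 * r / 3 + M * r + 4 * C1 / \<sigma> + 6 / \<sigma> + 4 * L / \<sigma> + L * r"
  have Rpos: "0 < 1/\<delta>1" "0 < 1/\<delta>" "0 < 4 * r / 3" "0 < M * r" "0 < 4 * C1 / \<sigma>" "0 < 6 / \<sigma>" "0 < 4 * L / \<sigma>" "0 < L * r"
    using \<delta> \<delta>1 r M L \<sigma> C1 by auto
  have R: "1 \<le> R" "1/\<delta>1 \<le> R" "1/\<delta> \<le> R" "4 * r / 3 \<le> R" "M * r \<le> R" "4 * C1 / \<sigma> \<le> R" "6 / \<sigma> \<le> R" "4 * L / \<sigma> \<le> R" "L * r \<le> R"
    unfolding R_def using Rpos by linarith+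
  have U0: "0 < cmod U" if "R \<le> cmod U" for U using that R(1) by linarith
  have dle: "cmod (1/U) \<le> \<epsilon>" if "R \<le> cmod U" "1/\<epsilon> \<le> R" "0 < \<epsilon>" for U \<epsilon>
  proof -
    have "1 / \<epsilon> \<le> cmod U" using that by linarith
    then show ?thesis using that(3) U0[OF that(1)] by (simp add: norm_divide field_simps)
  qed
  have box: "param_box r \<delta> (1/U) (of_real M * c CW / U) (c CX) (c CY)" if "R \<le> cmod U" "\<And>i. cmod (c i) \<le> r" for U c
  proof -
    have "M * cmod (c CW) \<le> M * r" using that(2)[of CW] M(1) by simp
    then have "M * cmod (c CW) \<le> cmod U" using R(5) that(1) by linarith
    then show ?thesis
      using dle[OF that(1) R(3) \<delta>(1)] that U0[OF that(1)] M(1)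
      by (auto simp: param_box_def norm_divide norm_mult)
  qed
  have bdiff: "cmod (of_real M * c CW / U - of_real M * c' CW / U) \<le> M * e / cmod U"
    if "cmod (c CW - c' CW) \<le> e" "R \<le> cmod U" for c c' :: "component \<Rightarrow> complex" and e U
  proof -
    have "of_real M * c CW / U - of_real M * c' CW / U = of_real M * (c CW - c' CW) / U"
      by (simp add: right_diff_distrib diff_divide_distrib)
    then show ?thesis using that M(1) U0[OF that(2)]
      by (simp add: norm_divide norm_mult divide_right_mono)
  qed
  have lip1: "cmod (rhs M CW U c - rhs M CW U c') \<le> \<sigma> / 2 * e"
    if U: "R \<le> cmod U" and c: "\<And>i. cmod (c i) \<le> r" "\<And>i. cmod (c' i) \<le> r" "\<And>i. cmod (c i - c' i) \<le> e" for U c c' e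
  proof -
    have e: "0 \<le> e" using c(3) order_trans norm_ge_zero by blast
    have "cmod (innF1 (1/U) (of_real M * c CW / U) (c CX) (c CY) - innF1 (1/U) (of_real M * c' CW / U) (c' CX) (c' CY))
      \<le> C1 * (M * e / cmod U + (e + e))"
      using C1(3)[OF box[of U c, OF U c(1)] box[of U c', OF U c(2)]] bdiff[of c c' e U, OF c(3) U] c(3)[of CX] c(3)[of CY] C1(1) unfolding mod_affine_def
      by (elim order_trans) (auto intro!: mult_left_mono add_mono)
    then have "cmod (rhs M CW U c - rhs M CW U c') \<le> C1 * (M * e / cmod U + (e + e)) / M"
      using M(1) by (simp add: norm_divide divide_right_mono flip: diff_divide_distrib)
    also have "\<dots> = C1 / cmod U * e + 2 * C1 / M * e" using M(1) by (simp add: field_simps)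
    also have "C1 / cmod U \<le> \<sigma> / 4"
    proof -
      have "4 * C1 / \<sigma> \<le> cmod U" using R U by linarith
      then show ?thesis using \<sigma> U0[OF U] by (simp add: field_simps)
    qed
    also have "2 * C1 / M \<le> \<sigma> / 4" using M by (simp add: field_simps)
    finally show ?thesis using e by (simp add: mult_right_mono)
  qed
  have E2le: "mod_quad (cmod (1/U)) (cmod (of_real M * c CW / U) + cmod (of_real M * c' CW / U))
      (cmod (of_real M * c CW / U - of_real M * c' CW / U)) (cmod (c CX - c' CX) + cmod (c CY - c' CY))
      \<le> (M + 2 + 4 * M * r) / cmod U ^ 2 * e"
    if U: "R \<le> cmod U" and c: "\<And>i. cmod (c i) \<le> r" "\<And>i. cmod (c' i) \<le> r" "\<And>i. cmod (c i - c' i) \<le> e" for U c c' e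
  proof -
    have e: "0 \<le> e" using c(3) order_trans norm_ge_zero by blast
    have b: "cmod (of_real M * c CW / U) \<le> M * r / cmod U" if "\<And>i. cmod (c i) \<le> r" for c :: "component \<Rightarrow> complex"
      using that M(1) U0[OF U] by (simp add: norm_divide norm_mult divide_right_mono)
    have "mod_quad (cmod (1/U)) (cmod (of_real M * c CW / U) + cmod (of_real M * c' CW / U))
      (cmod (of_real M * c CW / U - of_real M * c' CW / U)) (cmod (c CX - c' CX) + cmod (c CY - c' CY))
      \<le> 1 / cmod U * (M * e / cmod U) + ((1 / cmod U)^2 + 1 / cmod U * (M * r / cmod U + M * r / cmod U)) * (e + e)"
      unfolding mod_quad_def norm_divide norm_one
      using bdiff[of c c' e U, OF c(3) U] b[of c, OF c(1)] b[of c', OF c(2)] c(3)[of CX] c(3)[of CY] U0[OF U] M(1) r(1) e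
      by (intro add_mono mult_mono) (auto simp: norm_divide norm_mult)
    also have "\<dots> = (M + 2 + 4 * M * r) / cmod U ^ 2 * e"
      using U0[OF U] by (simp add: field_simps power2_eq_square)
    finally show ?thesis .
  qed
  have lip2: "cmod (rhs M j U c - rhs M j U c') \<le> L / cmod U ^ 2 * e"
    if U: "R \<le> cmod U" and c: "\<And>i. cmod (c i) \<le> r" "\<And>i. cmod (c' i) \<le> r" "\<And>i. cmod (c i - c' i) \<le> e"
      and j: "j \<noteq> CW" for U c c' e j
  proof -
    have e: "0 \<le> e" using c(3) order_trans norm_ge_zero by blast
    let ?E = "(M + 2 + 4 * M * r) / cmod U ^ 2 * e"
    have E0: "0 \<le> ?E" using e M(1) r(1) by simp
    have "cmod (rhs M j U c - rhs M j U c') \<le> C2 * ?E \<or> cmod (rhs M j U c - rhs M j U c') \<le> C3 * ?E"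
      using C2(2)[OF box[of U c, OF U c(1)] box[of U c', OF U c(2)]] C3(2)[OF box[of U c, OF U c(1)] box[of U c', OF U c(2)]] j
        mult_left_mono[OF E2le[of U c c' e, OF U c] less_imp_le[OF C2(1)]] mult_left_mono[OF E2le[of U c c' e, OF U c] less_imp_le[OF C3(1)]]
      by (cases j) auto
    moreover have "C2 * ?E \<le> (C2 + C3) * ?E" "C3 * ?E \<le> (C2 + C3) * ?E"
      using C2(1) C3(1) by (intro mult_right_mono[OF _ E0]; simp)+
    ultimately have "cmod (rhs M j U c - rhs M j U c') \<le> (C2 + C3) * ?E" by linarith
    then show ?thesis by (simp add: L_def mult_ac)
  qed
  have Lsq: "L / cmod U ^ 2 \<le> L / cmod U" if "R \<le> cmod U" for U
  proof -
    have "1 \<le> cmod U" using that R(1) by linarith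
    then show ?thesis using L by (intro divide_left_mono self_le_power mult_pos_pos zero_less_power) auto
  qed
  show ?thesis
  proof (rule that[of R M r L], unfold_locales)
    fix U and c :: "component \<Rightarrow> complex" assume U: "R \<le> cmod U" and c: "\<And>i. cmod (c i) \<le> r"
    show "regular_at M U c" using reg[OF box[of U c, OF U c]] by (simp add: regular_at_def)
    show "cmod (rhs M CW U c) \<le> \<sigma> * r"
      using C1(2)[OF box[of U c, OF U c]] M by (simp add: norm_divide field_simps)
    fix j assume j: "j \<noteq> CW"
    have "cmod (rhs M j U (\<lambda>_. 0)) \<le> K2 + K3"
      using K2(2)[OF dle[OF U R(2) \<delta>1]] K3(2)[OF dle[OF U R(2) \<delta>1]] K2(1) K3(1) j
      by (cases j) auto
    moreover have "L / cmod U * r \<le> 1"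
    proof -
      have "L * r \<le> cmod U" using R U by linarith
      then show ?thesis using U0[OF U] by (simp add: field_simps)
    qed
    then have "L / cmod U ^ 2 * r \<le> 1"
      using mult_right_mono[OF Lsq[OF U], of r] r(1) by linarith
    then have "cmod (rhs M j U c - rhs M j U (\<lambda>_. 0)) \<le> 1"
      using lip2[of U c "\<lambda>_. 0" r j, OF U c] c j r(1) by fastforce
    moreover have "cmod (4/3 * c j / U) \<le> 1"
    proof -
      have "4/3 * cmod (c j) \<le> cmod U" using c[of j] R(4) U by linarith
      then show ?thesis using U0[OF U] by (simp add: norm_divide norm_mult)
    qed
    moreover have "cmod (4/3 * c j / U + rhs M j U c) \<le>
      cmod (4/3 * c j / U) + (cmod (rhs M j U c - rhs M j U (\<lambda>_. 0)) + cmod (rhs M j U (\<lambda>_. 0)))"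
      by (rule order_trans[OF norm_triangle_ineq add_left_mono]) (metis norm_triangle_sub add.commute)
    ultimately show "cmod (4/3 * c j / U + rhs M j U c) \<le> \<sigma> * r" unfolding r(2) by linarith
  next
    fix U e j and c c' :: "component \<Rightarrow> complex"
    assume U: "R \<le> cmod U" and c: "\<And>i. cmod (c i) \<le> r" "\<And>i. cmod (c' i) \<le> r" "\<And>i. cmod (c i - c' i) \<le> e"
      and j: "j \<noteq> CW"
    have e: "0 \<le> e" using c(3) order_trans norm_ge_zero by blast
    have "(4/3 * c j / U + rhs M j U c) - (4/3 * c' j / U + rhs M j U c') =
      4/3 * (c j - c' j) / U + (rhs M j U c - rhs M j U c')"
      by (simp add: right_diff_distrib diff_divide_distrib)
    also have "cmod \<dots> \<le> 4/3 * e / cmod U + L / cmod U * e"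
    proof (intro norm_triangle_mono)
      show "cmod (4/3 * (c j - c' j) / U) \<le> 4/3 * e / cmod U"
        using c(3)[of j] unfolding norm_divide norm_mult by (intro divide_right_mono mult_mono) auto
      show "cmod (rhs M j U c - rhs M j U c') \<le> L / cmod U * e"
        using lip2[of U c c' e j, OF U c j] mult_right_mono[OF Lsq[OF U] e] by linarith
    qed
    also have "\<dots> = 4/3 / cmod U * e + L / cmod U * e" by simp
    also have "4/3 / cmod U \<le> \<sigma> / 4"
    proof -
      have "6 / \<sigma> \<le> cmod U" using R U by linarith
      then show ?thesis using \<sigma> U0[OF U] by (simp add: field_simps)
    qed
    also have "L / cmod U \<le> \<sigma> / 4"
    proof -
      have "4 * L / \<sigma> \<le> cmod U" using R U by linarith
      then show ?thesis using \<sigma> U0[OF U] by (simp add: field_simps)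
    qed
    finally show "cmod ((4/3 * c j / U + rhs M j U c) - (4/3 * c' j / U + rhs M j U c')) \<le> \<sigma> / 2 * e"
      using e by (simp add: mult_right_mono)
  qed (use \<sigma> R(1) M(1) r(1) L lip1 lip2 in auto)
qed

fun rescaled_field :: "real \<Rightarrow> component \<Rightarrow> complex \<Rightarrow> (component \<Rightarrow> complex) \<Rightarrow> complex" where
  "rescaled_field M CW U c = (8/3 * c CW + rhs M CW U c) / U"
| "rescaled_field M CX U c = \<i> * c CX + (4/3 * c CX / U + rhs M CX U c)"
| "rescaled_field M CY U c = - \<i> * c CY + (4/3 * c CY / U + rhs M CY U c)"

context rhs_estimates
begin

text \<open>Multiplying the x-equation by the direction \<open>vX\<close> turns its coefficient i
  into \<open>\<i> * vX\<close>, whose real part is the rate; likewise for y. For w the dilation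
  gives the rate 8/3, above \<sigma> because \<open>\<sigma> \<le> 1\<close>.\<close>

lemma rescaled_solution_exists:
  assumes D: "open D" and far: "\<And>U. U \<in> D \<Longrightarrow> R \<le> cmod U" and \<sigma>1: "\<sigma> \<le> 1"
    and radial: "\<And>U s. U \<in> D \<Longrightarrow> 1 \<le> s \<Longrightarrow> of_real s * U \<in> D"
    and shift: "\<And>U t. U \<in> D \<Longrightarrow> 0 \<le> t \<Longrightarrow> U + of_real t * vX \<in> D" "\<And>U t. U \<in> D \<Longrightarrow> 0 \<le> t \<Longrightarrow> U + of_real t * vY \<in> D"
    and v: "cmod vX = 1" "cmod vY = 1" "\<sigma> \<le> Re (\<i> * vX)" "\<sigma> \<le> Re (- \<i> * vY)"
  obtains z where "\<And>j. z j holomorphic_on D" and "\<And>j U. U \<in> D \<Longrightarrow> cmod (z j U) \<le> r"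
    and "\<And>j U. U \<in> D \<Longrightarrow> (z j has_field_derivative rescaled_field M j U (\<lambda>i. z i U)) (at U)"
proof -
  define a :: "component \<Rightarrow> real" where "a = (\<lambda>j. case j of CW \<Rightarrow> 1 | _ \<Rightarrow> 0)"
  define b where "b = (\<lambda>j. case j of CW \<Rightarrow> 0 | CX \<Rightarrow> vX | CY \<Rightarrow> vY)"
  define \<mu> where "\<mu> = (\<lambda>j. case j of CW \<Rightarrow> 8/3 | CX \<Rightarrow> \<i> * vX | CY \<Rightarrow> - \<i> * vY)"
  \<comment> \<open>The sign and the factor \<open>b j\<close> match the form
    \<open>(\<mu> * z - N) / (a * U + b)\<close> of the fixed point theorem. As \<open>b j\<close>
    has modulus 1 for x and y, the estimates are unaffected.\<close>
  define N where "N = (\<lambda>j U c. case j of CW \<Rightarrow> - rhs M CW U c | _ \<Rightarrow> - b j * (4/3 * c j / U + rhs M j U c))"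
  note defs = a_def b_def \<mu>_def N_def
  have flow: "affine_flow D (a j) (b j) (\<lambda>t. of_real t * b j)" for j
  proof
    fix U t assume "U \<in> D" "0 \<le> (t::real)"
    then show "aflow (a j) (\<lambda>t. of_real t * b j) t U \<in> D"
      using radial[of U "exp t"] shift[of U t] by (cases j) (auto simp: defs aflow_def)
  next
    fix t
    show "((\<lambda>t. of_real t * b j) has_vector_derivative of_real (a j) * (of_real t * b j) + b j) (at t)"
      by (cases j) (auto simp: defs intro!: derivative_eq_intros)
    show "of_real (exp (a j * t)) * b j = of_real (a j) * (of_real t * b j) + b j"
      by (cases j) (auto simp: defs)
  qed simp
  have U0: "U \<noteq> 0" if "U \<in> D" for U using far[OF that] R_ge_1 by auto
  have b0: "b CX \<noteq> 0" "b CY \<noteq> 0" using v by (auto simp: defs)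
  obtain z where z: "\<And>j. z j holomorphic_on D" "\<And>j U. U \<in> D \<Longrightarrow> cmod (z j U) \<le> r"
    "\<And>j U. U \<in> D \<Longrightarrow> (z j has_field_derivative
      (\<mu> j * z j U - N j U (\<lambda>i. z i U)) / (of_real (a j) * U + b j)) (at U)"
  proof (rule flow_fixed_point[where N = N and r = r and \<mu> = \<mu> and a = a and b = b, OF D flow _ \<sigma>_pos])
    show "of_real (a j) * U + b j \<noteq> 0" if "U \<in> D" for j U
      using U0[OF that] b0 by (cases j) (auto simp: defs)
    show "\<sigma> \<le> Re (\<mu> j)" for j using \<sigma>1 v by (cases j) (auto simp: defs)
    show "0 \<le> r" using r_pos by simp
  next
    fix z :: "component \<Rightarrow> complex \<Rightarrow> complex" and j
    assume h: "\<And>i. z i holomorphic_on D" and zr: "\<And>i U. U \<in> D \<Longrightarrow> cmod (z i U) \<le> r"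
    have hr: "(\<lambda>U. rhs M j U (\<lambda>i. z i U)) holomorphic_on D" for j
      using U0 regular[OF far zr] by (intro rhs_holomorphic h M_pos) auto
    then show "(\<lambda>U. N j U (\<lambda>i. z i U)) holomorphic_on D"
      using U0 by (cases j) (auto simp: N_def simp del: rhs.simps intro!: holomorphic_intros h hr)
  next
    fix U j and c :: "component \<Rightarrow> complex" assume U: "U \<in> D" and c: "\<And>i. cmod (c i) \<le> r"
    show "cmod (N j U c) \<le> \<sigma> * r"
      using rhs_W_bound[OF far[OF U], of c] rhs_XY_bound[OF far[OF U], of c j] c v
      by (cases j) (auto simp: defs norm_mult norm_minus_commute)
  next
    fix U e j and c c' :: "component \<Rightarrow> complex"
    assume U: "U \<in> D" and c: "\<And>i. cmod (c i) \<le> r" "\<And>i. cmod (c' i) \<le> r" "\<And>i. cmod (c i - c' i) \<le> e"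
    show "cmod (N j U c - N j U c') \<le> \<sigma> / 2 * e"
    proof (cases "j = CW")
      case True
      then show ?thesis using rhs_W_lipschitz[OF far[OF U], of c c' e] c
        by (simp add: defs norm_minus_commute)
    next
      case False
      then have "N j U c - N j U c' = - b j * ((4/3 * c j / U + rhs M j U c) - (4/3 * c' j / U + rhs M j U c'))"
        by (cases j) (auto simp: N_def algebra_simps)
      moreover have "cmod (b j) = 1" using v False by (cases j) (auto simp: defs)
      ultimately show ?thesis using rhs_XY_lipschitz[OF far[OF U], of c c' e j] c False
        by (simp add: norm_mult)
    qed
  qed blast
  have "rescaled_field M j U (\<lambda>i. z i U) = (\<mu> j * z j U - N j U (\<lambda>i. z i U)) / (of_real (a j) * U + b j)"
    if "U \<in> D" for j U
    using b0 by (cases j) (auto simp: defs field_simps)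
  then show ?thesis using that[of z] z by simp
qed

end

subsection \<open>Exponentially small differences\<close>

definition down_cone :: "real \<Rightarrow> real \<Rightarrow> complex set" where
  "down_cone t k = {U. t * \<bar>Re U\<bar> + k \<le> - Im U}"

locale lower_cone =
  fixes t k :: real
  assumes t: "0 < t" and k: "0 < k"
begin

abbreviation "C \<equiv> down_cone t k"
definition "apex = - \<i> * of_real k"
definition "c0 = t / (1 + t)"

lemma c0: "0 < c0" using t by (simp add: c0_def)

lemma cone_Im: "k \<le> - Im U" if "U \<in> C"
proof -
  have "0 \<le> t * \<bar>Re U\<bar>" using t by simp
  then show ?thesis using that unfolding down_cone_def by simp
qed

lemma Im_le_norm: "- Im U \<le> cmod U" using abs_Im_le_cmod[of U] by linarith

lemma cone_norm: "k \<le> cmod U" if "U \<in> C"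
  using cone_Im[OF that] Im_le_norm[of U] by linarith

text \<open>On the cone \<open>t * |Re U|\<close> is at most the depth \<open>- Im U\<close>, so
  depth and modulus are comparable.\<close>

lemma cone_c0: "c0 * cmod U \<le> - Im U" if "U \<in> C"
proof -
  have "t * \<bar>Re U\<bar> \<le> - Im U" using that k by (simp add: down_cone_def)
  moreover have "t * cmod U \<le> t * (\<bar>Re U\<bar> + \<bar>Im U\<bar>)" using t cmod_le[of U] by simp
  ultimately have "t * cmod U \<le> (1 + t) * (- Im U)"
    using cone_Im[OF that] k by (simp add: algebra_simps)
  then show ?thesis using t by (simp add: c0_def field_simps)
qed

lemma apex_in: "apex \<in> C" by (simp add: down_cone_def apex_def)

lemma convex_cone: "convex C"
proof (rule convexI)
  fix x y :: complex and u v :: real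
  assume xy: "x \<in> C" "y \<in> C" "0 \<le> u" "0 \<le> v" "u + v = 1"
  have "t * \<bar>u * Re x + v * Re y\<bar> \<le> t * (u * \<bar>Re x\<bar> + v * \<bar>Re y\<bar>)"
    using xy t by (intro mult_left_mono order_trans[OF abs_triangle_ineq]) (auto simp: abs_mult)
  moreover have "u * (t * \<bar>Re x\<bar> + k) \<le> u * (- Im x)" "v * (t * \<bar>Re y\<bar> + k) \<le> v * (- Im y)"
    using xy by (intro mult_left_mono; simp add: down_cone_def)+
  moreover have "u * k + v * k = k" using xy by (simp flip: distrib_right)
  ultimately show "u *\<^sub>R x + v *\<^sub>R y \<in> C"
    by (simp add: down_cone_def algebra_simps)
qed

lemma scale_in: "of_real s * U \<in> C" if "U \<in> C" "1 \<le> s"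
proof -
  have "s * (t * \<bar>Re U\<bar> + k) \<le> s * (- Im U)"
    using that by (intro mult_left_mono) (auto simp: down_cone_def)
  moreover have "k \<le> s * k" using that k by simp
  ultimately show ?thesis using that by (simp add: down_cone_def abs_mult algebra_simps)
qed

text \<open>The cone, unlike the sectors, may be translated straight down, where the coefficient i
  has rate 1.\<close>

sublocale down: affine_flow C 0 "- \<i>" "\<lambda>s. - \<i> * of_real s"
  by unfold_locales (auto simp: aflow_def down_cone_def intro!: derivative_eq_intros)

sublocale out: affine_flow C 1 0 "\<lambda>s. 0"
proof
  fix U s assume "U \<in> C" "0 \<le> (s::real)"
  then show "aflow 1 (\<lambda>s. 0) s U \<in> C" using scale_in[of U "exp s"] by (simp add: aflow_def)
qed auto

lemma down_simps: "aflow 0 (\<lambda>s. - \<i> * of_real s) s U = U - \<i> * of_real s" "down.vf U = - \<i>"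
  by (simp_all add: aflow_def down.vf_def)

lemma out_simps: "aflow 1 (\<lambda>s. 0) s U = of_real (exp s) * U" "out.vf U = U"
  by (simp_all add: aflow_def out.vf_def)

lemma down_in: "U - \<i> * of_real s \<in> C" if "U \<in> C" "0 \<le> s"
  using that by (simp add: down_cone_def)

section \<open>Integration from the apex and limits at infinity\<close>

text \<open>On the segment from the apex, arc length per unit of depth is at most
  \<open>1 + 1/t\<close> and the modulus is at least the depth, so the integral of 1/s^2 from depth
  k on contributes 1/k. The derivative is controlled only at points no deeper than U, which is how
  the exponential weights will be available.\<close>

lemma apex_segment_bound:
  assumes U: "U \<in> C" and B: "0 \<le> B"
    and f: "\<And>z. z \<in> C \<Longrightarrow> (f has_field_derivative f' z) (at z)"
    and bd: "\<And>z. z \<in> C \<Longrightarrow> Im U \<le> Im z \<Longrightarrow> cmod (f' z) \<le> B / cmod z ^ 2"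
  shows "cmod (f U - f apex) \<le> B * (1 + 1/t) / k"
proof (cases "U = apex")
  case True
  then show ?thesis using B t k by simp
next
  case False
  define s where "s = - Im U"
  have tre: "t * \<bar>Re U\<bar> \<le> s - k" using U by (simp add: down_cone_def s_def)
  have sk: "k < s"
  proof (rule ccontr)
    assume "\<not> k < s"
    then have "t * \<bar>Re U\<bar> \<le> 0" "s = k" using tre cone_Im[OF U] by (auto simp: s_def)
    then have "Re U = 0" using t by (simp add: mult_le_0_iff)
    then show False using False \<open>s = k\<close> by (simp add: apex_def s_def complex_eq_iff)
  qed
  have dist: "cmod (U - apex) \<le> (1 + 1/t) * (s - k)"
  proof -
    have "cmod (U - apex) \<le> \<bar>Re U\<bar> + (s - k)"
      using cmod_le[of "U - apex"] sk by (simp add: apex_def s_def)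
    also have "\<bar>Re U\<bar> \<le> (s - k) / t" using tre t by (simp add: field_simps)
    finally show ?thesis by (simp add: algebra_simps)
  qed
  define g where "g = (\<lambda>\<tau>. apex + of_real \<tau> * (U - apex))"
  have g_in: "g \<tau> \<in> C" if "0 \<le> \<tau>" "\<tau> \<le> 1" for \<tau>
  proof -
    have "g \<tau> = (1 - \<tau>) *\<^sub>R apex + \<tau> *\<^sub>R U" by (simp add: g_def scaleR_conv_of_real algebra_simps)
    then show ?thesis using convexD[OF convex_cone apex_in U, of "1 - \<tau>" \<tau>] that by simp
  qed
  have g_Im: "- Im (g \<tau>) = k + \<tau> * (s - k)" for \<tau>
    by (simp add: g_def apex_def s_def algebra_simps)
  have der: "((\<lambda>\<tau>. f (g \<tau>)) has_vector_derivative (U - apex) * f' (g \<tau>)) (at \<tau>)" if "0 \<le> \<tau>" "\<tau> \<le> 1" for \<tau>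
  proof -
    have "(g has_vector_derivative (U - apex)) (at \<tau>)"
      unfolding g_def by (auto intro!: derivative_eq_intros)
    from field_vector_diff_chain_at[OF this f[OF g_in[OF that]]] show ?thesis by (simp add: o_def)
  qed
  have pos: "0 < k + \<tau> * (s - k)" if "0 \<le> \<tau>" for \<tau>
    using that sk k by (simp add: add_pos_nonneg)
  let ?\<phi> = "\<lambda>\<tau>. - (B * (1 + 1/t) / (k + \<tau> * (s - k)))"
  have "cmod (f (g 1) - f (g 0)) \<le> ?\<phi> 1 - ?\<phi> 0"
  proof (rule differentiable_bound_general[where f' = "\<lambda>\<tau>. (U - apex) * f' (g \<tau>)"
        and \<phi>' = "\<lambda>\<tau>. B * (1 + 1/t) * (s - k) / (k + \<tau> * (s - k))^2"])
    show "continuous_on {0..1} (\<lambda>\<tau>. f (g \<tau>))"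
      by (rule continuous_at_imp_continuous_on) (use der has_vector_derivative_continuous in fastforce)
    show "continuous_on {0..1} ?\<phi>"
      using pos by (intro continuous_intros) (force dest: less_imp_neq)+
    show "(?\<phi> has_vector_derivative B * (1 + 1/t) * (s - k) / (k + \<tau> * (s - k))^2) (at \<tau>)" if "0 < \<tau>" "\<tau> < 1" for \<tau>
      unfolding has_real_derivative_iff_has_vector_derivative[symmetric]
      using pos[of \<tau>] that by (auto intro!: derivative_eq_intros simp: power2_eq_square)
    show "cmod ((U - apex) * f' (g \<tau>)) \<le> B * (1 + 1/t) * (s - k) / (k + \<tau> * (s - k))^2" if \<tau>: "0 < \<tau>" "\<tau> < 1" for \<tau>
    proof -
      have "\<tau> * (s - k) \<le> 1 * (s - k)" using \<tau> sk by (intro mult_right_mono) auto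
      then have "Im U \<le> Im (g \<tau>)" using g_Im[of \<tau>] by (simp add: s_def)
      then have "cmod (f' (g \<tau>)) \<le> B / cmod (g \<tau>) ^ 2" using bd g_in \<tau> by simp
      also have "\<dots> \<le> B / (k + \<tau> * (s - k)) ^ 2"
        using Im_le_norm[of "g \<tau>"] pos[of \<tau>] \<tau> B unfolding g_Im
        by (intro divide_left_mono power_mono mult_pos_pos) auto
      finally have "cmod ((U - apex) * f' (g \<tau>)) \<le> ((1 + 1/t) * (s - k)) * (B / (k + \<tau> * (s - k)) ^ 2)"
        unfolding norm_mult using dist sk t by (intro mult_mono) auto
      then show ?thesis by (simp add: mult_ac)
    qed
  qed (use der in auto)
  also have "\<dots> \<le> B * (1 + 1/t) / k"
    using B t k sk by simp
  finally show ?thesis by (simp add: g_def)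
qed

text \<open>From U to 2U the function changes by at most B/|U|, so along U, 2U, 4U, ... it converges
  within 2B/|U|. Different starting points share the limit: their distance grows like 2^n, while the
  derivative between them shrinks like 4^(-n).\<close>

lemma limit_at_infinity:
  assumes f: "\<And>z. z \<in> C \<Longrightarrow> (f has_field_derivative f' z) (at z)"
    and bd: "\<And>z. z \<in> C \<Longrightarrow> cmod (f' z) \<le> B / cmod z ^ 2" and B: "0 \<le> B"
  obtains \<Theta> where "\<And>U. U \<in> C \<Longrightarrow> cmod (f U - \<Theta>) \<le> 2 * B / cmod U"
proof -
  have seg: "cmod (f x - f y) \<le> B / \<rho>^2 * cmod (x - y)"
    if "x \<in> C" "y \<in> C" "0 < \<rho>" "\<And>z. z \<in> closed_segment x y \<Longrightarrow> \<rho> \<le> cmod z" for x y \<rho>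
  proof (rule field_differentiable_bound[of "closed_segment x y" f f'])
    fix z assume z: "z \<in> closed_segment x y"
    then have zC: "z \<in> C" using closed_segment_subset[OF that(1,2) convex_cone] by blast
    show "(f has_field_derivative f' z) (at z within closed_segment x y)"
      using f[OF zC] by (rule has_field_derivative_at_within)
    have "cmod (f' z) \<le> B / cmod z ^ 2" by (rule bd[OF zC])
    also have "\<dots> \<le> B / \<rho>^2"
      using that(4)[OF z] that(3) B by (intro divide_left_mono power_mono mult_pos_pos) auto
    finally show "cmod (f' z) \<le> B / \<rho>^2" .
  qed auto
  have pw: "2 ^ n * U \<in> C" if "U \<in> C" for U n
    using scale_in[OF that, of "2^n"] by simp
  have norm0: "0 < cmod U" if "U \<in> C" for U using cone_norm[OF that] k by linarith
  have dbl: "cmod (f (2 * U) - f U) \<le> B / cmod U" if U: "U \<in> C" for U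
  proof -
    have "cmod (f (2 * U) - f U) \<le> B / cmod U ^ 2 * cmod (2 * U - U)"
    proof (rule seg)
      show "2 * U \<in> C" using pw[OF U, of 1] by simp
      fix z assume "z \<in> closed_segment (2 * U) U"
      then obtain u where u: "0 \<le> u" "u \<le> 1" "z = (1 - u) *\<^sub>R (2 * U) + u *\<^sub>R U" by (auto simp: closed_segment_def)
      then have "z = of_real (2 - u) * U" by (simp add: scaleR_conv_of_real algebra_simps)
      then have "cmod z = (2 - u) * cmod U" using u by (simp only: norm_mult norm_of_real)
      then show "cmod U \<le> cmod z" using u by (simp add: mult_le_cancel_right1)
    qed (use U norm0 in auto)
    also have "\<dots> = B / cmod U" using norm0[OF U] by (simp add: power2_eq_square)
    finally show ?thesis .
  qed
  have tel: "cmod (f (2 ^ n * U) - f U) \<le> 2 * B / cmod U" if U: "U \<in> C" for n U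
  proof -
    \<comment> \<open>The factor is the exact partial sum of 1 + 1/2 + 1/4 + ..., which lets the
      induction close.\<close>
    have "cmod (f (2 ^ n * U) - f U) \<le> (2 - 2 / 2 ^ n) * (B / cmod U)"
    proof (induction n)
      case (Suc n)
      have "cmod (f (2 ^ Suc n * U) - f (2 ^ n * U)) \<le> B / cmod (2 ^ n * U)"
        using dbl[OF pw[OF U, of n]] by (simp add: mult.assoc)
      also have "\<dots> = (1 / 2^n) * (B / cmod U)" by (simp add: norm_mult norm_power)
      finally have "cmod (f (2 ^ Suc n * U) - f U) \<le> (1 / 2^n) * (B / cmod U) + (2 - 2 / 2 ^ n) * (B / cmod U)"
        using Suc norm_triangle_mono[of "f (2 ^ Suc n * U) - f (2 ^ n * U)" _ "f (2 ^ n * U) - f U"] by fastforce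
      also have "\<dots> = (1 / 2^n + (2 - 2 / 2 ^ n)) * (B / cmod U)" by (rule distrib_right[symmetric])
      also have "1 / 2^n + (2 - 2 / 2 ^ n) = 2 - 2 / (2::real) ^ Suc n" by (simp add: field_simps)
      finally show ?case .
    qed simp
    also have "\<dots> \<le> 2 * (B / cmod U)" using B by (intro mult_right_mono) auto
    finally show ?thesis by simp
  qed
  have vanish: "(\<lambda>n. f (2 ^ n * x) - f (2 ^ n * y)) \<longlonglongrightarrow> 0" if xy: "x \<in> C" "y \<in> C" for x y
  proof (rule Lim_null_comparison)
    have "cmod (f (2 ^ n * x) - f (2 ^ n * y)) \<le> B * cmod (x - y) / k^2 * (1/2)^n" for n
    proof -
      have "cmod (f (2 ^ n * x) - f (2 ^ n * y)) \<le> B / (2^n * k)^2 * cmod (2 ^ n * x - 2 ^ n * y)"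
      proof (rule seg[OF pw[OF xy(1)] pw[OF xy(2)]])
        fix z assume z: "z \<in> closed_segment (2 ^ n * x) (2 ^ n * y)"
        have Im2: "Im (2 ^ n * w) = 2 ^ n * Im w" for w
        proof -
          have "2 ^ n * w = of_real (2 ^ n) * w" by simp
          then show ?thesis by (simp only: times_complex.sel Re_complex_of_real Im_complex_of_real mult_zero_left add_0_right)
        qed
        have "closed_segment (2 ^ n * x) (2 ^ n * y) \<subseteq> {z. 2 ^ n * k \<le> - Im z}"
        proof (rule closed_segment_subset)
          show "2 ^ n * x \<in> {z. 2 ^ n * k \<le> - Im z}" "2 ^ n * y \<in> {z. 2 ^ n * k \<le> - Im z}"
            using cone_Im[OF xy(1)] cone_Im[OF xy(2)]
              mult_left_mono[of k "- Im x" "2^n"] mult_left_mono[of k "- Im y" "2^n"]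
            by (auto simp: Im2)
          have "{z. 2 ^ n * k \<le> - Im z} = {z. Im z \<le> - (2 ^ n * k)}" by auto
          then show "convex {z. 2 ^ n * k \<le> - Im z}" by (simp add: convex_halfspace_Im_le)
        qed
        then show "2 ^ n * k \<le> cmod z" using z Im_le_norm[of z] by force
      qed (use k in simp)
      also have "2 ^ n * x - 2 ^ n * y = 2 ^ n * (x - y)" by (simp add: right_diff_distrib)
      also have "B / (2^n * k)^2 * cmod (2 ^ n * (x - y)) = B * cmod (x - y) / k^2 * (1/2)^n"
        by (simp add: norm_mult norm_power power2_eq_square power_one_over)
      finally show ?thesis .
    qed
    then show "\<forall>\<^sub>F n in sequentially. cmod (f (2 ^ n * x) - f (2 ^ n * y)) \<le> B * cmod (x - y) / k^2 * (1/2)^n"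
      by (intro always_eventually allI)
    show "(\<lambda>n. B * cmod (x - y) / k^2 * (1/2)^n) \<longlonglongrightarrow> 0"
      by (intro tendsto_mult_right_zero LIMSEQ_power_zero) auto
  qed
  have "Cauchy (\<lambda>n. f (2 ^ n * apex))"
  proof (rule CauchyI')
    fix e :: real assume e: "0 < e"
    have "(\<lambda>n. 2 * B / k * (1/2)^n) \<longlonglongrightarrow> 0"
      by (intro tendsto_mult_right_zero LIMSEQ_power_zero) auto
    then obtain n0 where n0: "\<And>n. n0 \<le> n \<Longrightarrow> 2 * B / k * (1/2)^n < e"
      using e by (force dest!: order_tendstoD(2)[of _ _ _ e] simp: eventually_sequentially)
    show "\<exists>M. \<forall>m\<ge>M. \<forall>n>m. dist (f (2 ^ m * apex)) (f (2 ^ n * apex)) < e"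
    proof (intro exI[of _ n0] allI impI)
      fix m n :: nat assume mn: "n0 \<le> m" "m < n"
      have "2 ^ n * apex = 2 ^ (n - m) * (2 ^ m * apex)" using mn by (simp flip: power_add mult.assoc)
      then have "cmod (f (2 ^ n * apex) - f (2 ^ m * apex)) \<le> 2 * B / cmod (2 ^ m * apex)"
        using tel[OF pw[OF apex_in], of "n - m" m] by (simp only:)
      also have "\<dots> = 2 * B / k * (1/2)^m" using k by (simp add: apex_def norm_mult norm_power field_simps)
      also have "\<dots> < e" using n0 mn by simp
      finally show "dist (f (2 ^ m * apex)) (f (2 ^ n * apex)) < e" by (simp add: dist_norm norm_minus_commute)
    qed
  qed
  then obtain \<Theta> where \<Theta>: "(\<lambda>n. f (2 ^ n * apex)) \<longlonglongrightarrow> \<Theta>" using Cauchy_convergent convergent_def by blast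
  show ?thesis
  proof (rule that[of \<Theta>])
    fix U assume U: "U \<in> C"
    have lim: "(\<lambda>n. f (2 ^ n * U)) \<longlonglongrightarrow> \<Theta>"
      using tendsto_add[OF vanish[OF U apex_in] \<Theta>] by simp
    have "cmod (\<Theta> - f U) \<le> 2 * B / cmod U"
      using tel[OF U] by (intro tendsto_upperbound[OF tendsto_norm[OF tendsto_diff[OF lim tendsto_const]]]) auto
    then show "cmod (f U - \<Theta>) \<le> 2 * B / cmod U" by (simp add: norm_minus_commute)
  qed
qed

section \<open>Difference of two bounded solutions on the cone\<close>

lemma norm_exp_iU: "cmod (exp (\<i> * U)) = exp (- Im U)"
  by simp

text \<open>Linearity of A1, A2, A3 is encoded through the common bound \<open>n\<close> of the
  three unknowns. For \<open>m\<close>, the supremum of the weighted difference, the equations for X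
  and V return at most m/2 and the one for Y at most \<open>|f apex| + m/8\<close>; hence m is at
  most twice \<open>|f apex|\<close>. Feeding the resulting exponential bound back into the
  equations gives the algebraic rates.\<close>

lemma exponentially_small_difference:
  assumes V: "\<And>U. U \<in> C \<Longrightarrow> (V has_field_derivative (4/3 * V U + A1 U) / U) (at U)"
    and X: "\<And>U. U \<in> C \<Longrightarrow> (X has_field_derivative \<i> * X U + A2 U) (at U)"
    and Y: "\<And>U. U \<in> C \<Longrightarrow> (Y has_field_derivative - \<i> * Y U + A3 U) (at U)"
    and bounded: "\<And>U. U \<in> C \<Longrightarrow> cmod (V U) \<le> K \<and> cmod (X U) \<le> K \<and> cmod (Y U) \<le> K"
    and A1: "\<And>U n. U \<in> C \<Longrightarrow> cmod (V U) \<le> n \<Longrightarrow> cmod (X U) \<le> n \<Longrightarrow> cmod (Y U) \<le> n \<Longrightarrow> cmod (A1 U) \<le> n / 2"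
    and A2: "\<And>U n. U \<in> C \<Longrightarrow> cmod (V U) \<le> n \<Longrightarrow> cmod (X U) \<le> n \<Longrightarrow> cmod (Y U) \<le> n \<Longrightarrow> cmod (A2 U) \<le> L / cmod U ^ 2 * n"
    and A3: "\<And>U n. U \<in> C \<Longrightarrow> cmod (V U) \<le> n \<Longrightarrow> cmod (X U) \<le> n \<Longrightarrow> cmod (Y U) \<le> n \<Longrightarrow> cmod (A3 U) \<le> L / cmod U ^ 2 * n"
    and L: "0 < L" "L / k^2 \<le> 1/2" "L * (1 + 1/t) / k \<le> 1/8"
  obtains \<Theta> B where "0 < B"
    and "\<And>U. U \<in> C \<Longrightarrow> \<Theta> = 0 \<Longrightarrow> V U = 0 \<and> X U = 0 \<and> Y U = 0"
    and "\<And>U. U \<in> C \<Longrightarrow> cmod (exp (\<i> * U) * V U) \<le> B / cmod U"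
    and "\<And>U. U \<in> C \<Longrightarrow> cmod (exp (\<i> * U) * X U) \<le> B / cmod U ^ 2"
    and "\<And>U. U \<in> C \<Longrightarrow> cmod (exp (\<i> * U) * Y U - \<Theta>) \<le> B / cmod U"
proof -
  define n where "n = (\<lambda>U. max (cmod (V U)) (max (cmod (X U)) (cmod (Y U))))"
  have n_ge: "cmod (V U) \<le> n U" "cmod (X U) \<le> n U" "cmod (Y U) \<le> n U" "0 \<le> n U" for U
    by (auto simp: n_def le_max_iff_disj)
  have n_le: "n U \<le> m" if "cmod (V U) \<le> m" "cmod (X U) \<le> m" "cmod (Y U) \<le> m" for U m
    using that by (simp add: n_def)
  have nK: "n U \<le> K" if "U \<in> C" for U using bounded[OF that] by (intro n_le) auto
  have A1n: "cmod (A1 U) \<le> n U / 2" and A2n: "cmod (A2 U) \<le> L / cmod U ^ 2 * n U"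
    and A3n: "cmod (A3 U) \<le> L / cmod U ^ 2 * n U" if "U \<in> C" for U
    using A1[OF that n_ge(1-3)] A2[OF that n_ge(1-3)] A3[OF that n_ge(1-3)] by auto
  have U0: "0 < cmod U" if "U \<in> C" for U using cone_norm[OF that] k by linarith
  have Lk: "L / cmod U ^ 2 \<le> 1/2" if "U \<in> C" for U
  proof -
    have "L / cmod U ^ 2 \<le> L / k^2"
      using cone_norm[OF that] k L(1) U0[OF that] by (intro divide_left_mono power_mono mult_pos_pos) auto
    then show ?thesis using L(2) by linarith
  qed
  define f where "f = (\<lambda>U. exp (\<i> * U) * Y U)"
  have df: "(f has_field_derivative exp (\<i> * U) * A3 U) (at U)" if "U \<in> C" for U
    unfolding f_def by (rule derivative_eq_intros Y[OF that] refl)+ (simp add: algebra_simps)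
  \<comment> \<open>The weight is truncated at level T so that the supremum is finite; the estimate is uniform in T.\<close>
  have key: "exp (min (- Im U) T) * n U \<le> 2 * cmod (f apex)" if U: "U \<in> C" for U T
  proof -
    define \<psi> where "\<psi> = (\<lambda>U. exp (min (- Im U) T))"
    have \<psi>: "0 < \<psi> U" "\<psi> U \<le> exp T" "\<psi> U \<le> exp (- Im U)" for U by (auto simp: \<psi>_def)
    define S where "S = (\<lambda>U. \<psi> U * n U) ` C"
    define m where "m = Sup S"
    have "\<psi> U * n U \<le> exp T * K" if "U \<in> C" for U
      using \<psi> nK[OF that] n_ge(4)[of U] by (intro mult_mono) auto
    then have "bdd_above S" unfolding S_def by (intro bdd_aboveI2)
    then have S_le: "\<psi> U * n U \<le> m" if "U \<in> C" for U
      unfolding m_def S_def using that by (intro cSUP_upper) auto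
    have m0: "0 \<le> m" using S_le[OF apex_in] \<psi>(1)[of apex] n_ge(4)[of apex]
      by (smt (verit, best) mult_nonneg_nonneg)
    \<comment> \<open>The weight does not decrease with depth, so all points below U obey the bound
      with \<open>\<psi> U\<close>; the two flows used next only descend.\<close>
    have n_m: "n z \<le> m / \<psi> U" if "z \<in> C" "Im z \<le> Im U" for z U
    proof -
      have "\<psi> U * n z \<le> \<psi> z * n z" using that n_ge(4)[of z] by (intro mult_right_mono) (auto simp: \<psi>_def)
      then have "\<psi> U * n z \<le> m" using S_le[OF that(1)] by linarith
      then show ?thesis using \<psi>(1)[of U] by (simp add: field_simps)
    qed
    have Xb: "cmod (X U) \<le> (m / \<psi> U / 2) / 1" if U: "U \<in> C" for U
    proof (rule down.solution_bound[where X = X and U = U and h = "\<lambda>U. \<i> * A2 U" and \<mu> = 1 and K = K and X' = "\<lambda>U. \<i> * X U + A2 U"], unfold down_simps)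
      fix s :: real assume s: "0 \<le> s"
      then have z: "U - \<i> * of_real s \<in> C" (is "?z \<in> C") using down_in[OF U] by simp
      show "(X has_field_derivative \<i> * X ?z + A2 ?z) (at ?z)" by (rule X[OF z])
      show "- \<i> * (\<i> * X ?z + A2 ?z) = 1 * X ?z - \<i> * A2 ?z" by (simp add: algebra_simps)
      show "cmod (X ?z) \<le> K" using bounded[OF z] by simp
      have "cmod (A2 ?z) \<le> 1/2 * (m / \<psi> U)"
        using s by (intro order_trans[OF A2n[OF z]] mult_mono Lk z n_m) (auto simp: n_ge)
      then show "cmod (\<i> * A2 ?z) \<le> m / \<psi> U / 2" by (simp add: norm_mult)
    qed auto
    have Vb: "cmod (V U) \<le> (m / \<psi> U / 2) / 1" if U: "U \<in> C" for U
    proof (rule out.solution_bound[where X = V and U = U and h = "\<lambda>U. - A1 U" and \<mu> = "4/3" and K = K and X' = "\<lambda>U. (4/3 * V U + A1 U) / U"], unfold out_simps)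
      fix s :: real assume s: "0 \<le> s"
      then have z: "of_real (exp s) * U \<in> C" (is "?z \<in> C") using scale_in[OF U, of "exp s"] by simp
      show "(V has_field_derivative (4/3 * V ?z + A1 ?z) / ?z) (at ?z)" by (rule V[OF z])
      show "?z * ((4/3 * V ?z + A1 ?z) / ?z) = 4/3 * V ?z - - A1 ?z" using U0[OF z] by auto
      show "cmod (V ?z) \<le> K" using bounded[OF z] by simp
      have "1 * (- Im U) \<le> exp s * (- Im U)" using s cone_Im[OF U] k by (intro mult_right_mono) auto
      then have "n ?z \<le> m / \<psi> U" by (intro n_m z) simp
      then show "cmod (- A1 ?z) \<le> m / \<psi> U / 2" using A1n[OF z] by simp
    qed auto
    have Yb: "cmod (Y U) \<le> (cmod (f apex) + m / 8) / \<psi> U" if U: "U \<in> C" for U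
    proof -
      have "cmod (f U - f apex) \<le> (L * (exp (- Im U) * (m / \<psi> U))) * (1 + 1/t) / k"
      proof (rule apex_segment_bound[OF U _ df])
        show "0 \<le> L * (exp (- Im U) * (m / \<psi> U))" using L(1) m0 \<psi>(1)[of U] by simp
        fix z assume z: "z \<in> C" "Im U \<le> Im z"
        \<comment> \<open>The full weight divided by the truncated one is also nondecreasing in
          depth, being 1 down to depth T. The whole segment from the apex is thus estimated by its
          value at U.\<close>
        have "exp (- Im z) * \<psi> U \<le> exp (- Im U) * \<psi> z"
          using z(2) by (auto simp: \<psi>_def min_def simp flip: exp_add)
        then have "exp (- Im z) / \<psi> z \<le> exp (- Im U) / \<psi> U" using \<psi>(1) by (simp add: field_simps)
        then have *: "exp (- Im z) * (m / \<psi> z) \<le> exp (- Im U) * (m / \<psi> U)"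
          using mult_left_mono[OF _ m0] by (fastforce simp: mult_ac)
        have "cmod (exp (\<i> * z) * A3 z) \<le> exp (- Im z) * (L / cmod z ^ 2 * (m / \<psi> z))"
          unfolding norm_mult norm_exp_iU using L(1) n_m[OF z(1), of z]
          by (intro mult_left_mono order_trans[OF A3n[OF z(1)]]) auto
        also have "\<dots> = L / cmod z ^ 2 * (exp (- Im z) * (m / \<psi> z))" by simp
        also have "\<dots> \<le> L / cmod z ^ 2 * (exp (- Im U) * (m / \<psi> U))"
          using * L(1) by (intro mult_left_mono) auto
        finally show "cmod (exp (\<i> * z) * A3 z) \<le> L * (exp (- Im U) * (m / \<psi> U)) / cmod z ^ 2" by (simp add: mult.commute)
      qed
      also have "\<dots> = (L * (1 + 1/t) / k) * (exp (- Im U) * (m / \<psi> U))" by (simp add: mult_ac)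
      also have "\<dots> \<le> 1/8 * (exp (- Im U) * (m / \<psi> U))"
        using L(3) m0 \<psi>(1)[of U] by (intro mult_right_mono) auto
      finally have "cmod (f U) \<le> cmod (f apex) + 1/8 * (exp (- Im U) * (m / \<psi> U))"
        using norm_triangle_sub[of "f U" "f apex"] by linarith
      then have "cmod (Y U) \<le> (cmod (f apex) + 1/8 * (exp (- Im U) * (m / \<psi> U))) / exp (- Im U)"
        by (simp only: f_def norm_mult norm_exp_iU pos_le_divide_eq exp_gt_zero mult.commute)
      also have "\<dots> = cmod (f apex) / exp (- Im U) + m / 8 / \<psi> U" by (simp add: field_simps)
      also have "cmod (f apex) / exp (- Im U) \<le> cmod (f apex) / \<psi> U"
        using \<psi>[of U] by (intro divide_left_mono mult_pos_pos) auto
      finally show ?thesis by (simp add: add_divide_distrib)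
    qed
    have "\<psi> U * n U \<le> cmod (f apex) + m / 2" if U: "U \<in> C" for U
    proof -
      have "n U \<le> (cmod (f apex) + m / 2) / \<psi> U"
      proof (rule n_le)
        have "(m / \<psi> U / 2) / 1 \<le> (cmod (f apex) + m / 2) / \<psi> U"
          using \<psi>(1)[of U] by (simp add: add_divide_distrib mult.commute)
        then show "cmod (X U) \<le> (cmod (f apex) + m / 2) / \<psi> U" "cmod (V U) \<le> (cmod (f apex) + m / 2) / \<psi> U"
          using Xb[OF U] Vb[OF U] by linarith+
        have "(cmod (f apex) + m / 8) / \<psi> U \<le> (cmod (f apex) + m / 2) / \<psi> U"
          using \<psi>(1)[of U] m0 by (intro divide_right_mono) auto
        then show "cmod (Y U) \<le> (cmod (f apex) + m / 2) / \<psi> U" using Yb[OF U] by linarith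
      qed
      then show ?thesis using \<psi>(1)[of U] by (simp add: field_simps)
    qed
    \<comment> \<open>The supremum is finite thanks to the truncation, so m/2 can be
      absorbed.\<close>
    then have "m \<le> cmod (f apex) + m / 2"
      unfolding m_def S_def using apex_in by (intro cSUP_least) auto
    then have "m \<le> 2 * cmod (f apex)" by simp
    then show ?thesis using S_le[OF U] by (simp add: \<psi>_def)
  qed
  define m where "m = 2 * cmod (f apex)"
  have m0: "0 \<le> m" by (simp add: m_def)
  \<comment> \<open>Choosing \<open>T = - Im U\<close> makes the truncation invisible at U
    itself.\<close>
  have n_m: "exp (- Im U) * n U \<le> m" if "U \<in> C" for U
    using key[OF that, of "- Im U"] by (simp add: m_def)
  obtain \<Theta> where \<Theta>: "\<And>U. U \<in> C \<Longrightarrow> cmod (f U - \<Theta>) \<le> 2 * (L * m) / cmod U"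
  proof (rule limit_at_infinity[OF df])
    show "cmod (exp (\<i> * z) * A3 z) \<le> L * m / cmod z ^ 2" if z: "z \<in> C" for z
    proof -
      have "cmod (exp (\<i> * z) * A3 z) \<le> exp (- Im z) * (L / cmod z ^ 2 * n z)"
        unfolding norm_mult norm_exp_iU by (intro mult_left_mono A3n z) auto
      also have "\<dots> = L / cmod z ^ 2 * (exp (- Im z) * n z)" by simp
      also have "\<dots> \<le> L / cmod z ^ 2 * m" using L(1) by (intro mult_left_mono n_m z) auto
      finally show ?thesis by simp
    qed
  qed (use L(1) m0 in auto)
  \<comment> \<open>With \<Theta> = 0 the estimate at the apex reads |f apex| \<le> 4 (L/k) |f apex|
    \<le> |f apex| / 2, so \<open>f apex\<close> and with it \<open>m\<close> vanish. The bound 1/8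
    in the hypotheses absorbs the factor 4.\<close>
  have zero: "n U = 0" if "\<Theta> = 0" "U \<in> C" for U
  proof -
    have Lk: "L / k \<le> 1/8"
    proof -
      have "L / k * 1 \<le> L / k * (1 + 1/t)" using L(1) k t by (intro mult_left_mono) auto
      moreover have "L / k * (1 + 1/t) = L * (1 + 1/t) / k" by simp
      ultimately have "L / k * 1 \<le> 1/8" using L(3) by linarith
      then show ?thesis by simp
    qed
    have "cmod (f apex) \<le> 2 * (L * m) / cmod apex" using \<Theta>[OF apex_in] that(1) by simp
    also have "\<dots> = 4 * (L / k) * cmod (f apex)" using k by (simp add: apex_def m_def norm_mult)
    also have "\<dots> \<le> 4 * (1/8) * cmod (f apex)" using Lk by (intro mult_right_mono mult_left_mono) auto
    finally have "m = 0" by (simp add: m_def)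
    then have "exp (- Im U) * n U \<le> exp (- Im U) * 0" using n_m[OF that(2)] by simp
    then have "n U \<le> 0" by (simp only: mult_le_cancel_left_pos exp_gt_zero)
    then show "n U = 0" using n_ge(4)[of U] by linarith
  qed
  \<comment> \<open>Along the descent the modulus stays above \<open>c0 * cmod U\<close>, so the
    decay of A2 at U holds on the whole orbit up to \<open>1 / c0^2\<close>.\<close>
  have Xd: "cmod (exp (\<i> * U) * X U) \<le> L * m / c0^2 / cmod U ^ 2" if U: "U \<in> C" for U
  proof -
    have "cmod (X U) \<le> (L / (c0 * cmod U)^2 * (m * exp (Im U))) / 1"
    proof (rule down.solution_bound[where X = X and U = U and h = "\<lambda>U. \<i> * A2 U" and \<mu> = 1 and K = K and X' = "\<lambda>U. \<i> * X U + A2 U"], unfold down_simps)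
      fix s :: real assume s: "0 \<le> s"
      then have z: "U - \<i> * of_real s \<in> C" (is "?z \<in> C") using down_in[OF U] by simp
      show "(X has_field_derivative \<i> * X ?z + A2 ?z) (at ?z)" by (rule X[OF z])
      show "- \<i> * (\<i> * X ?z + A2 ?z) = 1 * X ?z - \<i> * A2 ?z" by (simp add: algebra_simps)
      show "cmod (X ?z) \<le> K" using bounded[OF z] by simp
      have "n ?z \<le> m / exp (- Im ?z)" using n_m[OF z] by (simp add: field_simps)
      also have "\<dots> = m * exp (Im ?z)" by (simp only: exp_minus divide_inverse inverse_inverse_eq)
      also have "\<dots> \<le> m * exp (Im U)" using s m0 by (intro mult_left_mono) auto
      finally have nz: "n ?z \<le> m * exp (Im U)" .
      have "c0 * cmod U \<le> cmod ?z" using cone_c0[OF U] Im_le_norm[of ?z] s by simp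
      then have "L / cmod ?z ^ 2 \<le> L / (c0 * cmod U)^2"
        using mult_pos_pos[OF c0 U0[OF U]] L(1) by (intro frac_le power_mono zero_less_power) auto
      then have "cmod (A2 ?z) \<le> L / (c0 * cmod U)^2 * (m * exp (Im U))"
        using L(1) nz by (intro order_trans[OF A2n[OF z]] mult_mono) (auto simp: n_ge)
      then show "cmod (\<i> * A2 ?z) \<le> L / (c0 * cmod U)^2 * (m * exp (Im U))" by (simp add: norm_mult)
    qed auto
    then have "exp (- Im U) * cmod (X U) \<le> exp (- Im U) * (L / (c0 * cmod U)^2 * (m * exp (Im U)))"
      by (intro mult_left_mono) auto
    also have "\<dots> = L * m / c0^2 / cmod U ^ 2 * (exp (- Im U) * exp (Im U))"
      by (simp add: power_mult_distrib)
    also have "exp (- Im U) * exp (Im U) = 1" by (simp flip: exp_add)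
    finally show ?thesis unfolding norm_mult norm_exp_iU by simp
  qed
  \<comment> \<open>Multiplication by exp(iU) gives V the coefficient i, hence rate 1 under descent.
    The derivative of V, of order n/|U|, becomes the forcing, and this is where the factor 1/|U|
    comes from.\<close>
  have Vd: "cmod (exp (\<i> * U) * V U) \<le> (2 * m / c0 / cmod U) / 1" if U: "U \<in> C" for U
  proof (rule down.solution_bound[where U = U and h = "\<lambda>U. \<i> * (exp (\<i> * U) * ((4/3 * V U + A1 U) / U))" and \<mu> = 1 and K = m
        and X' = "\<lambda>U. \<i> * (exp (\<i> * U) * V U) + exp (\<i> * U) * ((4/3 * V U + A1 U) / U)" and X = "\<lambda>U. exp (\<i> * U) * V U"], unfold down_simps)
    fix s :: real assume s: "0 \<le> s"
    then have z: "U - \<i> * of_real s \<in> C" (is "?z \<in> C") using down_in[OF U] by simp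
    show "((\<lambda>U. exp (\<i> * U) * V U) has_field_derivative \<i> * (exp (\<i> * ?z) * V ?z) + exp (\<i> * ?z) * ((4/3 * V ?z + A1 ?z) / ?z)) (at ?z)"
      by (rule derivative_eq_intros V[OF z] refl)+ (simp add: algebra_simps)
    show "- \<i> * (\<i> * (exp (\<i> * ?z) * V ?z) + exp (\<i> * ?z) * ((4/3 * V ?z + A1 ?z) / ?z)) =
        1 * (exp (\<i> * ?z) * V ?z) - \<i> * (exp (\<i> * ?z) * ((4/3 * V ?z + A1 ?z) / ?z))"
      by (simp only: distrib_left) simp
    have "exp (- Im ?z) * cmod (V ?z) \<le> exp (- Im ?z) * n ?z" by (intro mult_left_mono n_ge) auto
    then show "cmod (exp (\<i> * ?z) * V ?z) \<le> m"
      unfolding norm_mult norm_exp_iU using n_m[OF z] by linarith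
    have "cmod (4/3 * V ?z + A1 ?z) \<le> 4/3 * n ?z + n ?z / 2"
      using n_ge(1)[of ?z] A1n[OF z] by (intro norm_triangle_mono) (auto simp: norm_mult)
    then have "cmod (4/3 * V ?z + A1 ?z) \<le> 2 * n ?z" using n_ge(4)[of ?z] by linarith
    then have "exp (- Im ?z) * cmod (4/3 * V ?z + A1 ?z) \<le> exp (- Im ?z) * (2 * n ?z)" by (intro mult_left_mono) auto
    then have 1: "exp (- Im ?z) * cmod (4/3 * V ?z + A1 ?z) \<le> 2 * m" using n_m[OF z] by linarith
    have "c0 * cmod U \<le> cmod ?z" using cone_c0[OF U] Im_le_norm[of ?z] s by simp
    then have "exp (- Im ?z) * cmod (4/3 * V ?z + A1 ?z) / cmod ?z \<le> 2 * m / (c0 * cmod U)"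
      using 1 m0 c0 U0[OF U] by (intro frac_le) auto
    then show "cmod (\<i> * (exp (\<i> * ?z) * ((4/3 * V ?z + A1 ?z) / ?z))) \<le> 2 * m / c0 / cmod U"
      unfolding norm_mult norm_divide norm_exp_iU by simp
  qed auto
  \<comment> \<open>The summand 1 keeps B positive when m = 0.\<close>
  define B where "B = 1 + 2 * (L * m) + L * m / c0^2 + 2 * m / c0"
  have parts: "0 \<le> 2 * (L * m)" "0 \<le> L * m / c0^2" "0 \<le> 2 * m / c0" using L(1) m0 c0 by auto
  show ?thesis
  proof (rule that[of B \<Theta>])
    show "0 < B" using parts unfolding B_def by linarith
  next
    fix U assume U: "U \<in> C"
    show "V U = 0 \<and> X U = 0 \<and> Y U = 0" if "\<Theta> = 0" using zero[OF that U] n_ge[of U] by simp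
    have le: "c / cmod U ^ j \<le> B / cmod U ^ j" if "c \<le> B" for c j using that by (simp add: divide_right_mono)
    show "cmod (exp (\<i> * U) * V U) \<le> B / cmod U"
      using Vd[OF U] le[of "2 * m / c0" 1] parts by (simp add: B_def)
    show "cmod (exp (\<i> * U) * X U) \<le> B / cmod U ^ 2"
      using Xd[OF U] le[of "L * m / c0^2" 2] parts by (simp add: B_def)
    show "cmod (exp (\<i> * U) * Y U - \<Theta>) \<le> B / cmod U"
      using \<Theta>[OF U] le[of "2 * (L * m)" 1] parts by (simp add: B_def f_def)
  qed
qed

end

subsection \<open>Solutions on the sectors\<close>

text \<open>The case distinction in \<open>ln_u\<close> disappears: the cut of
  \<open>Ln (- U)\<close> is the nonnegative axis, so the branch is analytic across the negative
  one.\<close>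

lemma ln_u_eq_Ln_minus: "ln_u U = Ln (- U) - of_real pi * \<i>" if "U \<notin> \<real>\<^sub>\<ge>\<^sub>0"
proof -
  have "U \<noteq> 0" using that by auto
  then show ?thesis
    using that by (auto simp: ln_u_def Ln_minus complex_nonneg_Reals_iff)
qed

lemma ln_u_derivative: "(ln_u has_field_derivative 1 / U) (at U)" if "U \<notin> \<real>\<^sub>\<ge>\<^sub>0"
proof (rule has_field_derivative_transform_within_open)
  have "- U \<notin> \<real>\<^sub>\<le>\<^sub>0" using that by (simp add: complex_nonneg_Reals_iff complex_nonpos_Reals_iff)
  then show "((\<lambda>U. Ln (- U) - of_real pi * \<i>) has_field_derivative 1 / U) (at U)"
    by (auto intro!: derivative_eq_intros simp: field_simps)
  show "open (- \<real>\<^sub>\<ge>\<^sub>0 :: complex set)" by (intro open_Compl closed_nonneg_Reals_complex)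
qed (use that in \<open>auto simp: ln_u_eq_Ln_minus\<close>)

lemma exp_ln_u: "exp (ln_u U) = U" if "U \<noteq> 0"
proof -
  have "exp (2 * of_real pi * \<i>) = 1" using exp_two_pi_i by simp
  then show ?thesis using that by (simp add: ln_u_def exp_diff)
qed

lemma norm_cpw_Ln: "cmod (cpw Ln a U) = cmod U powr a" if "U \<noteq> 0"
  using that by (simp add: cpw_def powr_def)

lemma cpw_add: "cpw lg (a + b) U = cpw lg a U * cpw lg b U"
  by (simp add: cpw_def distrib_right exp_add)

text \<open>\<eta> = 1 belongs to the unstable and \<eta> = -1 to the stable domain. The strict
  inequality makes the set open, as needed for holomorphy.\<close>

definition sector :: "real \<Rightarrow> real \<Rightarrow> real \<Rightarrow> complex set" where
  "sector \<eta> t \<kappa> = {U. \<eta> * t * Re U + \<kappa> < \<bar>Im U\<bar>}"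

lemma open_sector: "open (sector \<eta> t \<kappa>)"
  unfolding sector_def by (intro open_Collect_less continuous_intros)

lemma sector_norm:
  assumes "U \<in> sector \<eta> t \<kappa>" "\<bar>\<eta>\<bar> = 1" "0 \<le> t"
  shows "\<kappa> < (1 + t) * cmod U"
proof -
  have "- (\<eta> * t * Re U) \<le> \<bar>\<eta> * t * Re U\<bar>" by simp
  also have "\<dots> = t * \<bar>Re U\<bar>" using assms by (simp add: abs_mult)
  also have "\<dots> \<le> t * cmod U" using assms by (intro mult_left_mono abs_Re_le_cmod) auto
  finally show ?thesis using assms(1) abs_Im_le_cmod[of U] by (simp add: sector_def algebra_simps)
qed

text \<open>Of the two sides of the sector, the direction with imaginary part - sin \<beta> serves x
  and the one with + sin \<beta> serves y. Both give the rate sin \<beta>, the origin of the choice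
  of \<sigma>.\<close>

lemma (in rhs_estimates) sector_solution_exists:
  assumes \<beta>: "0 < \<beta>" "\<beta> < pi / 2" "\<sigma> = sin \<beta>" and \<eta>: "\<bar>\<eta>\<bar> = 1"
    and \<kappa>: "(1 + tan \<beta>) * R \<le> \<kappa>"
  obtains z where "\<And>j. z j holomorphic_on sector \<eta> (tan \<beta>) \<kappa>"
    and "\<And>j U. U \<in> sector \<eta> (tan \<beta>) \<kappa> \<Longrightarrow> cmod (z j U) \<le> r"
    and "\<And>j U. U \<in> sector \<eta> (tan \<beta>) \<kappa> \<Longrightarrow>
      (z j has_field_derivative rescaled_field M j U (\<lambda>i. z i U)) (at U)"
proof -
  have cos: "0 < cos \<beta>" using \<beta> by (intro cos_gt_zero) auto
  have t: "0 < tan \<beta>" using \<beta> by (intro tan_gt_zero) auto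
  have tc: "tan \<beta> * cos \<beta> = sin \<beta>" using cos by (simp add: tan_def)
  have \<eta>2: "\<eta> * \<eta> = 1" using \<eta> by (metis abs_mult_self_eq mult_1)
  have \<kappa>0: "0 < \<kappa>" using \<kappa> t R_ge_1 by (smt (verit) mult_pos_pos)
  \<comment> \<open>Under this shift \<eta> t Re U drops by s sin \<beta> and |Im U| by at most the
    same amount.\<close>
  have shift: "U + of_real s * Complex (- \<eta> * cos \<beta>) (\<epsilon> * sin \<beta>) \<in> sector \<eta> (tan \<beta>) \<kappa>"
    if "U \<in> sector \<eta> (tan \<beta>) \<kappa>" "0 \<le> s" "\<bar>\<epsilon>\<bar> = 1" for U s \<epsilon>
  proof -
    have "\<bar>s * (\<epsilon> * sin \<beta>)\<bar> = s * sin \<beta>"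
      using that \<beta> sin_gt_zero[of \<beta>] by (simp add: abs_mult)
    then have "\<bar>Im U\<bar> - s * sin \<beta> \<le> \<bar>Im U + s * (\<epsilon> * sin \<beta>)\<bar>" by linarith
    moreover have "\<eta> * tan \<beta> * (Re U + s * (- \<eta> * cos \<beta>)) = \<eta> * tan \<beta> * Re U - (\<eta> * \<eta>) * s * (tan \<beta> * cos \<beta>)"
      by (simp add: algebra_simps)
    ultimately show ?thesis using that(1) unfolding \<eta>2 tc by (simp add: sector_def)
  qed
  have unit: "cmod (Complex (- \<eta> * cos \<beta>) (\<epsilon> * sin \<beta>)) = 1" if "\<bar>\<epsilon>\<bar> = 1" for \<epsilon>
  proof -
    have "\<epsilon>\<^sup>2 = 1" "\<eta>\<^sup>2 = 1" using that \<eta> by (metis power2_abs one_power2)+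
    then show ?thesis by (simp add: cmod_def power_mult_distrib)
  qed
  show ?thesis
  proof (rule rescaled_solution_exists[OF open_sector _ _ _ shift[of _ _ "-1"] shift[of _ _ 1] unit[of "-1"] unit[of 1]])
    fix U assume "U \<in> sector \<eta> (tan \<beta>) \<kappa>"
    then have "\<kappa> < (1 + tan \<beta>) * cmod U" using \<eta> t by (intro sector_norm) auto
    then have "(1 + tan \<beta>) * R < (1 + tan \<beta>) * cmod U" using \<kappa> by linarith
    then show "R \<le> cmod U" using t by (simp add: mult_less_cancel_left_pos)
  next
    fix U and s :: real assume U: "U \<in> sector \<eta> (tan \<beta>) \<kappa>" and s: "1 \<le> s"
    then have "s * (\<eta> * tan \<beta> * Re U + \<kappa>) < s * \<bar>Im U\<bar>" by (simp add: sector_def)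
    moreover have "\<kappa> \<le> s * \<kappa>" using s \<kappa>0 by simp
    ultimately show "of_real s * U \<in> sector \<eta> (tan \<beta>) \<kappa>"
      using s by (simp add: sector_def abs_mult algebra_simps)
  next
    fix z
    assume "\<And>j. z j holomorphic_on sector \<eta> (tan \<beta>) \<kappa>"
      and "\<And>j U. U \<in> sector \<eta> (tan \<beta>) \<kappa> \<Longrightarrow> cmod (z j U) \<le> r"
      and "\<And>j U. U \<in> sector \<eta> (tan \<beta>) \<kappa> \<Longrightarrow> (z j has_field_derivative rescaled_field M j U (\<lambda>i. z i U)) (at U)"
    then show thesis by (rule that)
  qed (use \<beta> in simp_all)
qed

text \<open>The quotient rule contributes - a f/U. For a = 8/3 and a = 4/3 this cancels the terms
  that the rescaling had added.\<close>

lemma DERIV_quotient_cpw: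
  fixes f p :: "complex \<Rightarrow> complex"
  assumes "(f has_field_derivative f') (at U)" "(p has_field_derivative a * p U / U) (at U)" "p U \<noteq> 0"
  shows "((\<lambda>U. f U / p U) has_field_derivative (f' - a * f U / U) / p U) (at U)"
proof (rule DERIV_cong[OF DERIV_divide[OF assms]])
  have "f' * c - y * (a * c / U) = (f' - a * y / U) * c" for c y :: complex
    by (simp add: left_diff_distrib)
  then show "(f' * p U - f U * (a * p U / U)) / (p U * p U) = (f' - a * f U / U) / p U"
    using assms(3) by (simp only: nonzero_mult_divide_mult_cancel_right not_False_eq_True)
qed

section \<open>Return to the original variables\<close>

lemma invariant_solution_of_rescaled:
  assumes D: "open D" "D' \<subseteq> D" "0 \<notin> D" and M: "0 < M"
    and lg: "\<And>U. U \<in> D \<Longrightarrow> exp (lg U) = U" "\<And>U. U \<in> D \<Longrightarrow> (lg has_field_derivative 1 / U) (at U)"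
    and z: "\<And>j. z j holomorphic_on D"
      "\<And>j U. U \<in> D \<Longrightarrow> (z j has_field_derivative rescaled_field M j U (\<lambda>i. z i U)) (at U)"
    and reg: "\<And>U. U \<in> D \<Longrightarrow> regular_at M U (\<lambda>i. z i U)"
  shows "invariant_solution lg D' (\<lambda>U. of_real M * z CW U / cpw lg (8/3) U)
    (\<lambda>U. z CX U / cpw lg (4/3) U) (\<lambda>U. z CY U / cpw lg (4/3) U)"
proof -
  have cpw_der: "(cpw lg a has_field_derivative of_real a * cpw lg a U / U) (at U)" if "U \<in> D" for a U
    using cpw_has_field_derivative[OF lg(2)[OF that]] .
  have quot: "((\<lambda>U. f U / cpw lg a U) has_field_derivative (f' - of_real a * f U / U) / cpw lg a U) (at U)"
    if "U \<in> D" "(f has_field_derivative f') (at U)" for f f' a U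
    by (rule DERIV_quotient_cpw[OF that(2) cpw_der[OF that(1)] cpw_nonzero])
  have hol: "(\<lambda>U. f U / cpw lg a U) analytic_on D'" if "f holomorphic_on D" for f a
  proof -
    have "(\<lambda>U. f U / cpw lg a U) holomorphic_on D"
      unfolding holomorphic_on_open[OF D(1)] using quot[OF _ holomorphic_derivI[OF that D(1)]] by blast
    then show ?thesis using analytic_on_subset[OF _ D(2)] by (simp add: analytic_on_open[OF D(1)])
  qed
  show ?thesis
    unfolding invariant_solution_def
  proof (intro conjI ballI)
    show "(\<lambda>U. of_real M * z CW U / cpw lg (8/3) U) analytic_on D'"
      "(\<lambda>U. z CX U / cpw lg (4/3) U) analytic_on D'" "(\<lambda>U. z CY U / cpw lg (4/3) U) analytic_on D'"
      by (intro hol holomorphic_intros z)+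
    fix U assume "U \<in> D'"
    then have U: "U \<in> D" using D by blast
    then have U0: "U \<noteq> 0" using D by auto
    interpret rescaled_point lg U "of_real M * z CW U" "z CX U" "z CY U" "cpw lg (1/3) U" "inverse (cpw lg (1/3) U)"
      by unfold_locales (use lg[OF U] reg[OF U] in \<open>auto simp: regular_at_def complex_nonpos_Reals_iff\<close>)
    show "1 + inner_g lg U (of_real M * z CW U / cpw lg (8/3) U) (z CX U / cpw lg (4/3) U) (z CY U / cpw lg (4/3) U) \<noteq> 0"
      unfolding inner_g_eq using reg[OF U] by (simp add: regular_at_def)
    \<comment> \<open>The weight 11/3 of the first component against 8/3 for W accounts for the
      factor 1/U in the w-equation.\<close>
    have c11: "cpw lg (11/3) U = cpw lg (8/3) U * U"
      using cpw_add[of lg "8/3" 1 U] lg(1)[OF U] by (simp add: cpw_def)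
    show "((\<lambda>U. of_real M * z CW U / cpw lg (8/3) U) has_field_derivative
       0 * (of_real M * z CW U / cpw lg (8/3) U) + inner_R1 lg U (of_real M * z CW U / cpw lg (8/3) U)
         (z CX U / cpw lg (4/3) U) (z CY U / cpw lg (4/3) U)) (at U)"
      unfolding inner_R1_eq c11
      by (rule DERIV_cong[OF quot[OF U DERIV_cmult[OF z(2)[OF U]]]])
        (use M U0 in \<open>simp add: field_simps\<close>)
    show "((\<lambda>U. z CX U / cpw lg (4/3) U) has_field_derivative
       \<i> * (z CX U / cpw lg (4/3) U) + inner_R2 lg U (of_real M * z CW U / cpw lg (8/3) U)
         (z CX U / cpw lg (4/3) U) (z CY U / cpw lg (4/3) U)) (at U)"
      unfolding inner_R2_eq
      by (rule DERIV_cong[OF quot[OF U z(2)[OF U]]]) (simp add: add_divide_distrib)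
    show "((\<lambda>U. z CY U / cpw lg (4/3) U) has_field_derivative
       - \<i> * (z CY U / cpw lg (4/3) U) + inner_R3 lg U (of_real M * z CW U / cpw lg (8/3) U)
         (z CX U / cpw lg (4/3) U) (z CY U / cpw lg (4/3) U)) (at U)"
      unfolding inner_R3_eq
      by (rule DERIV_cong[OF quot[OF U z(2)[OF U]]]) (simp add: add_divide_distrib diff_divide_distrib)
  qed
qed

theorem theorem2p7:
  fixes \<beta>0 :: real
  assumes "0 < \<beta>0" and "\<beta>0 < pi / 2"
  shows "\<exists>\<kappa>0 b1 b2 (\<Theta>::complex). \<kappa>0 > 0 \<and> b1 > 0 \<and> b2 > 0 \<and>
    (\<forall>\<kappa>\<ge>\<kappa>0. \<exists>Wu Xu Yu Ws Xs Ys \<chi>1 \<chi>2 \<chi>3.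
       invariant_solution ln_u (Du \<beta>0 \<kappa>) Wu Xu Yu \<and>
       invariant_solution Ln (Ds \<beta>0 \<kappa>) Ws Xs Ys \<and>
       (\<forall>U\<in>Du \<beta>0 \<kappa>. cmod (cpw ln_u (8/3) U * Wu U) \<le> b1 \<and>
                       cmod (cpw ln_u (4/3) U * Xu U) \<le> b1 \<and>
                       cmod (cpw ln_u (4/3) U * Yu U) \<le> b1) \<and>
       (\<forall>U\<in>Ds \<beta>0 \<kappa>. cmod (cpw Ln (8/3) U * Ws U) \<le> b1 \<and>
                       cmod (cpw Ln (4/3) U * Xs U) \<le> b1 \<and>
                       cmod (cpw Ln (4/3) U * Ys U) \<le> b1) \<and>
       (\<forall>U\<in>Ek \<beta>0 \<kappa>.
          Wu U - Ws U = \<Theta> * exp (- \<i> * U) * (0 + \<chi>1 U) \<and>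
          Xu U - Xs U = \<Theta> * exp (- \<i> * U) * (0 + \<chi>2 U) \<and>
          Yu U - Ys U = \<Theta> * exp (- \<i> * U) * (1 + \<chi>3 U)) \<and>
       (\<forall>U\<in>Ek \<beta>0 \<kappa>. cmod (cpw Ln (7/3) U * \<chi>1 U) \<le> b2 \<and>
                       cmod (U^2 * \<chi>2 U) \<le> b2 \<and>
                       cmod (U * \<chi>3 U) \<le> b2))"
proof -
  define t where "t = tan \<beta>0"
  define \<sigma> where "\<sigma> = sin \<beta>0"
  have t: "0 < t" unfolding t_def using assms by (intro tan_gt_zero) auto
  have \<sigma>: "0 < \<sigma>" "\<sigma> \<le> 1" using assms sin_gt_zero[of \<beta>0] by (auto simp: \<sigma>_def)
  obtain R M r L where est: "rhs_estimates \<sigma> R M r L" by (rule rhs_estimates_exist[OF \<sigma>(1)])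
  interpret rhs_estimates \<sigma> R M r L by (rule est)
  define \<kappa>1 where "\<kappa>1 = (1 + t) * R"
  have \<kappa>1: "0 < \<kappa>1" using t R_ge_1 by (simp add: \<kappa>1_def)
  \<comment> \<open>Solutions are built once, on these open sectors, and restricted for every larger
    \<kappa>. This makes \<Theta> and the bounds independent of \<kappa>.\<close>
  define Du' where "Du' = sector 1 t \<kappa>1"
  define Ds' where "Ds' = sector (-1) t \<kappa>1"
  note D_defs = Du'_def Ds'_def
  obtain zu where zu: "\<And>j. zu j holomorphic_on Du'" "\<And>j U. U \<in> Du' \<Longrightarrow> cmod (zu j U) \<le> r"
    "\<And>j U. U \<in> Du' \<Longrightarrow> (zu j has_field_derivative rescaled_field M j U (\<lambda>i. zu i U)) (at U)"
    unfolding D_defs t_def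
    by (rule sector_solution_exists[of \<beta>0 1 \<kappa>1]) (use assms in \<open>auto simp: \<sigma>_def \<kappa>1_def t_def\<close>)
  obtain zs where zs: "\<And>j. zs j holomorphic_on Ds'" "\<And>j U. U \<in> Ds' \<Longrightarrow> cmod (zs j U) \<le> r"
    "\<And>j U. U \<in> Ds' \<Longrightarrow> (zs j has_field_derivative rescaled_field M j U (\<lambda>i. zs i U)) (at U)"
    unfolding D_defs t_def
    by (rule sector_solution_exists[of \<beta>0 "-1" \<kappa>1]) (use assms in \<open>auto simp: \<sigma>_def \<kappa>1_def t_def\<close>)
  have far: "R \<le> cmod U" if "U \<in> Du' \<or> U \<in> Ds'" for U
  proof -
    have "\<kappa>1 < (1 + t) * cmod U" using that t sector_norm unfolding D_defs by fastforce
    then show ?thesis using t by (simp add: \<kappa>1_def mult_less_cancel_left_pos)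
  qed
  \<comment> \<open>\<open>\<kappa>1\<close> and the final 1 put the closed domains inside the open
    sectors and give |U| \<ge> 1 on the cone; the other two summands provide the smallness of L/k^2
    and L (1 + 1/t)/k.\<close>
  define k where "k = \<kappa>1 + 2 * L + 8 * L * (1 + 1/t) + 1"
  have pos: "0 < 2 * L" "0 < 8 * L * (1 + 1/t)" using L_pos t by (auto intro!: mult_pos_pos add_pos_pos)
  have kb: "1 \<le> k" "\<kappa>1 < k" "2 * L \<le> k" "8 * L * (1 + 1/t) \<le> k"
    unfolding k_def using \<kappa>1 pos by linarith+
  have Lk: "L / k^2 \<le> 1/2"
  proof -
    have "k * 1 \<le> k * k" using kb(1) by (intro mult_left_mono) auto
    then have "2 * L \<le> k^2" using kb(3) by (simp add: power2_eq_square)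
    then show ?thesis using kb(1) by (simp add: field_simps)
  qed
  have Lk': "L * (1 + 1/t) / k \<le> 1/8"
  proof -
    have "L * (1 + 1/t) * 8 \<le> 1 * k" using kb(4) by (simp add: mult_ac)
    then show ?thesis using kb(1) by (simp add: divide_le_eq)
  qed
  interpret lower_cone t k by unfold_locales (use t kb in auto)
  have C_sub: "U \<in> Du'" "U \<in> Ds'" if "U \<in> down_cone t k" for U
  proof -
    have "t * Re U \<le> t * \<bar>Re U\<bar>" "- (t * Re U) \<le> t * \<bar>Re U\<bar>"
      using t mult_left_mono[of "- Re U" "\<bar>Re U\<bar>" t] by auto
    then show "U \<in> Du'" "U \<in> Ds'" using that kb(2) by (auto simp: D_defs sector_def down_cone_def)
  qed
  define p where "p = cpw Ln (4/3)"
  have pnz: "p U \<noteq> 0" for U by (simp add: p_def)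
  \<comment> \<open>Division by U^(4/3) deletes the terms 4/3 z/U for x and y and lowers the
    coefficient of w from 8/3 to 8/3 - 4/3 = 4/3.\<close>
  define V where "V = (\<lambda>j U. (zu j U - zs j U) / p U)"
  define A where "A = (\<lambda>j U. (rhs M j U (\<lambda>i. zu i U) - rhs M j U (\<lambda>i. zs i U)) / p U)"
  have C0: "U \<noteq> 0" "1 \<le> cmod U" if "U \<in> down_cone t k" for U
    using cone_norm[OF that] kb(1) by auto
  have normp: "cmod (p U) = cmod U powr (4/3)" if "U \<in> down_cone t k" for U
    unfolding p_def by (rule norm_cpw_Ln[OF C0(1)[OF that]])
  have dV: "(V j has_field_derivative
      ((rescaled_field M j U (\<lambda>i. zu i U) - rescaled_field M j U (\<lambda>i. zs i U)) - 4/3 * (zu j U - zs j U) / U) / p U) (at U)"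
    if U: "U \<in> down_cone t k" for j U
  proof -
    have "U \<notin> \<real>\<^sub>\<le>\<^sub>0" using cone_Im[OF U] kb(1) by (auto simp: complex_nonpos_Reals_iff)
    then have "(Ln has_field_derivative 1 / U) (at U)" using has_field_derivative_Ln by (simp add: divide_inverse)
    note dp = cpw_has_field_derivative[OF this, of "4/3", folded p_def]
    show ?thesis
      unfolding V_def
      by (rule DERIV_cong[OF DERIV_quotient_cpw[OF DERIV_diff[OF zu(3)[OF C_sub(1)[OF U]] zs(3)[OF C_sub(2)[OF U]]] dp pnz]]) simp
  qed
  obtain \<Theta> B where B: "0 < B"
    and zero: "\<And>U. U \<in> down_cone t k \<Longrightarrow> \<Theta> = 0 \<Longrightarrow> V CW U = 0 \<and> V CX U = 0 \<and> V CY U = 0"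
    and bW: "\<And>U. U \<in> down_cone t k \<Longrightarrow> cmod (exp (\<i> * U) * V CW U) \<le> B / cmod U"
    and bX: "\<And>U. U \<in> down_cone t k \<Longrightarrow> cmod (exp (\<i> * U) * V CX U) \<le> B / cmod U ^ 2"
    and bY: "\<And>U. U \<in> down_cone t k \<Longrightarrow> cmod (exp (\<i> * U) * V CY U - \<Theta>) \<le> B / cmod U"
  proof (rule exponentially_small_difference[of "V CW" "A CW" "V CX" "A CX" "V CY" "A CY" "2 * r" L, OF _ _ _ _ _ _ _ L_pos Lk Lk'])
    fix U assume U: "U \<in> down_cone t k"
    note nz = pnz[of U] C0(1)[OF U]
    show "(V CW has_field_derivative (4/3 * V CW U + A CW U) / U) (at U)"
      by (rule DERIV_cong[OF dV[OF U]]) (use nz in \<open>simp add: V_def A_def field_simps del: rhs.simps\<close>)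
    show "(V CX has_field_derivative \<i> * V CX U + A CX U) (at U)"
      by (rule DERIV_cong[OF dV[OF U]]) (simp add: V_def A_def algebra_simps add_divide_distrib diff_divide_distrib del: rhs.simps)
    show "(V CY has_field_derivative - \<i> * V CY U + A CY U) (at U)"
      by (rule DERIV_cong[OF dV[OF U]]) (simp add: V_def A_def algebra_simps add_divide_distrib diff_divide_distrib del: rhs.simps)
    have p1: "1 \<le> cmod (p U)" unfolding normp[OF U] using C0(2)[OF U] by (simp add: ge_one_powr_ge_zero)
    have "cmod (V j U) \<le> 2 * r" for j
    proof -
      have "cmod (zu j U - zs j U) \<le> 2 * r"
        using norm_triangle_ineq4[of "zu j U" "zs j U"] zu(2)[OF C_sub(1)[OF U], of j] zs(2)[OF C_sub(2)[OF U], of j] by linarith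
      moreover have "cmod (zu j U - zs j U) / cmod (p U) \<le> cmod (zu j U - zs j U) / 1"
        using p1 by (intro divide_left_mono) auto
      ultimately show ?thesis by (simp add: V_def norm_divide)
    qed
    then show "cmod (V CW U) \<le> 2 * r \<and> cmod (V CX U) \<le> 2 * r \<and> cmod (V CY U) \<le> 2 * r" by blast
    fix n assume n: "cmod (V CW U) \<le> n" "cmod (V CX U) \<le> n" "cmod (V CY U) \<le> n"
    have n0: "0 \<le> n" using n(1) norm_ge_zero order_trans by blast
    \<comment> \<open>A bound n on the quotients bounds the numerators by
      \<open>n * cmod (p U)\<close>; the factor cancels again after the Lipschitz estimate.\<close>
    have dz: "cmod (zu i U - zs i U) \<le> n * cmod (p U)" for i
    proof -
      have "cmod (V i U) \<le> n" using n by (cases i) auto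
      then show ?thesis using pnz[of U] by (simp add: V_def norm_divide divide_le_eq)
    qed
    note args = far[OF disjI1[OF C_sub(1)[OF U]]] zu(2)[OF C_sub(1)[OF U]] zs(2)[OF C_sub(2)[OF U]] dz
    have "cmod (A CW U) \<le> \<sigma> / 2 * (n * cmod (p U)) / cmod (p U)"
      unfolding A_def norm_divide
      using rhs_W_lipschitz[of U "\<lambda>i. zu i U" "\<lambda>i. zs i U" "n * cmod (p U)", OF args] by (intro divide_right_mono) auto
    also have "\<dots> \<le> n / 2" using p1 \<sigma> n0 by (simp add: mult_left_le_one_le)
    finally show "cmod (A CW U) \<le> n / 2" .
    have "cmod (A j U) \<le> L / cmod U ^ 2 * n" if "j \<noteq> CW" for j
    proof -
      have "cmod (A j U) \<le> L / cmod U ^ 2 * (n * cmod (p U)) / cmod (p U)"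
        unfolding A_def norm_divide
        using rhs_XY_decay[of U "\<lambda>i. zu i U" "\<lambda>i. zs i U" "n * cmod (p U)", OF args that] by (intro divide_right_mono) auto
      then show ?thesis using pnz[of U] by simp
    qed
    then show "cmod (A CX U) \<le> L / cmod U ^ 2 * n" "cmod (A CY U) \<le> L / cmod U ^ 2 * n" by simp_all
  qed blast
  define b1 where "b1 = (M + 1) * r"
  have b1: "0 < b1" "M * r \<le> b1" "r \<le> b1" using M_pos r_pos by (auto simp: b1_def distrib_right add_pos_pos)
  \<comment> \<open>For \<Theta> = 0 the quotient is 0 by convention, and the summand 1 keeps b2
    positive.\<close>
  define b2 where "b2 = (M + 1) * B / cmod \<Theta> + 1"
  have b2: "0 < b2" using M_pos B by (auto simp: b2_def intro!: add_nonneg_pos)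
  define Wu where "Wu = (\<lambda>U. of_real M * zu CW U / cpw ln_u (8/3) U)"
  define Xu where "Xu = (\<lambda>U. zu CX U / cpw ln_u (4/3) U)"
  define Yu where "Yu = (\<lambda>U. zu CY U / cpw ln_u (4/3) U)"
  define Ws where "Ws = (\<lambda>U. of_real M * zs CW U / cpw Ln (8/3) U)"
  define Xs where "Xs = (\<lambda>U. zs CX U / cpw Ln (4/3) U)"
  define Ys where "Ys = (\<lambda>U. zs CY U / cpw Ln (4/3) U)"
  note sol_defs = Wu_def Xu_def Yu_def Ws_def Xs_def Ys_def
  \<comment> \<open>For \<Theta> = 0 the two solutions coincide on the cone, and the value 0 makes
    all three \<chi> vanish.\<close>
  define e where "e = (\<lambda>U. if \<Theta> = 0 then 0 else exp (\<i> * U) / \<Theta>)"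
  \<comment> \<open>W carries the weight 8/3, while V has used up only 4/3 of it; the extra
    \<open>1 / p\<close> turns the decay 1/|U| into |U|^(-7/3).\<close>
  define \<chi>1 where "\<chi>1 = (\<lambda>U. e U * (of_real M * V CW U / p U))"
  define \<chi>2 where "\<chi>2 = (\<lambda>U. e U * V CX U)"
  define \<chi>3 where "\<chi>3 = (\<lambda>U. e U * (V CY U - \<Theta> * exp (- \<i> * U)))"
  have Ds_eq: "U \<in> Ds \<beta>0 \<kappa> \<longleftrightarrow> - (t * Re U) + \<kappa> \<le> \<bar>Im U\<bar>" for U \<kappa>
    unfolding Ds_def Du_def t_def by (force intro: image_eqI[of _ _ "- U"])
  have Du_eq: "U \<in> Du \<beta>0 \<kappa> \<longleftrightarrow> t * Re U + \<kappa> \<le> \<bar>Im U\<bar>" for U \<kappa>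
    by (simp add: Du_def t_def)
  have Ek_sub: "U \<in> down_cone t k" if "U \<in> Ek \<beta>0 \<kappa>" "k \<le> \<kappa>" for U \<kappa>
  proof -
    have "t * Re U + \<kappa> \<le> \<bar>Im U\<bar>" "- (t * Re U) + \<kappa> \<le> \<bar>Im U\<bar>" "Im U < 0"
      using that(1) unfolding Ek_def by (auto simp: Du_eq Ds_eq)
    moreover have "t * \<bar>Re U\<bar> = t * Re U \<or> t * \<bar>Re U\<bar> = - (t * Re U)" by (auto simp: abs_if)
    ultimately show ?thesis using that(2) unfolding down_cone_def by auto
  qed
  have Du_sub: "Du \<beta>0 \<kappa> \<subseteq> Du'" and Ds_sub: "Ds \<beta>0 \<kappa> \<subseteq> Ds'" if "k \<le> \<kappa>" for \<kappa>
    using that kb(2) by (auto simp: Du_eq Ds_eq D_defs sector_def)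
  have Du_slit: "U \<notin> \<real>\<^sub>\<ge>\<^sub>0" if "U \<in> Du'" for U
  proof
    assume "U \<in> \<real>\<^sub>\<ge>\<^sub>0"
    then have "0 \<le> t * Re U" "Im U = 0" using t by (auto simp: complex_nonneg_Reals_iff)
    then show False using that \<kappa>1 by (simp add: D_defs sector_def)
  qed
  have Ds_slit: "U \<notin> \<real>\<^sub>\<le>\<^sub>0" if "U \<in> Ds'" for U
  proof
    assume "U \<in> \<real>\<^sub>\<le>\<^sub>0"
    then have "t * Re U \<le> 0" "Im U = 0" using t by (auto simp: complex_nonpos_Reals_iff mult_le_0_iff)
    then show False using that \<kappa>1 by (simp add: D_defs sector_def)
  qed
  have nz: "0 \<notin> Du'" "0 \<notin> Ds'" using \<kappa>1 by (auto simp: D_defs sector_def)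
  have sol_u: "invariant_solution ln_u (Du \<beta>0 \<kappa>) Wu Xu Yu" if "k \<le> \<kappa>" for \<kappa>
    unfolding sol_defs
  proof (rule invariant_solution_of_rescaled[OF _ Du_sub[OF that] nz(1) M_pos _ _ zu(1) zu(3)])
    show "open Du'" unfolding D_defs by (rule open_sector)
    show "regular_at M U (\<lambda>i. zu i U)" if "U \<in> Du'" for U
      using far zu(2) that by (intro regular) auto
  qed (use nz Du_slit exp_ln_u ln_u_derivative in \<open>auto intro!: exp_ln_u ln_u_derivative\<close>)
  have sol_s: "invariant_solution Ln (Ds \<beta>0 \<kappa>) Ws Xs Ys" if "k \<le> \<kappa>" for \<kappa>
    unfolding sol_defs
  proof (rule invariant_solution_of_rescaled[OF _ Ds_sub[OF that] nz(2) M_pos _ _ zs(1) zs(3)])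
    show "open Ds'" unfolding D_defs by (rule open_sector)
    show "regular_at M U (\<lambda>i. zs i U)" if "U \<in> Ds'" for U
      using far zs(2) that by (intro regular) auto
    show "exp (Ln U) = U" if "U \<in> Ds'" for U using nz that by (intro exp_Ln) auto
    show "(Ln has_field_derivative 1 / U) (at U)" if "U \<in> Ds'" for U
      using has_field_derivative_Ln[OF Ds_slit[OF that]] by (simp add: divide_inverse)
  qed
  have bound_u: "cmod (cpw ln_u (8/3) U * Wu U) \<le> b1 \<and> cmod (cpw ln_u (4/3) U * Xu U) \<le> b1 \<and> cmod (cpw ln_u (4/3) U * Yu U) \<le> b1"
    if "U \<in> Du'" for U
  proof -
    have "M * cmod (zu CW U) \<le> M * r" using zu(2)[OF that] M_pos by (intro mult_left_mono) auto
    then have "M * cmod (zu CW U) \<le> b1" using b1(2) by linarith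
    then show ?thesis using order_trans[OF zu(2)[OF that] b1(3)] M_pos
      by (simp add: sol_defs norm_mult)
  qed
  have bound_s: "cmod (cpw Ln (8/3) U * Ws U) \<le> b1 \<and> cmod (cpw Ln (4/3) U * Xs U) \<le> b1 \<and> cmod (cpw Ln (4/3) U * Ys U) \<le> b1"
    if "U \<in> Ds'" for U
  proof -
    have "M * cmod (zs CW U) \<le> M * r" using zs(2)[OF that] M_pos by (intro mult_left_mono) auto
    then have "M * cmod (zs CW U) \<le> b1" using b1(2) by linarith
    then show ?thesis using order_trans[OF zs(2)[OF that] b1(3)] M_pos
      by (simp add: sol_defs norm_mult)
  qed
  have diffs: "Wu U - Ws U = \<Theta> * exp (- \<i> * U) * (0 + \<chi>1 U) \<and> Xu U - Xs U = \<Theta> * exp (- \<i> * U) * (0 + \<chi>2 U) \<and>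
      Yu U - Ys U = \<Theta> * exp (- \<i> * U) * (1 + \<chi>3 U)" if U: "U \<in> down_cone t k" for U
  proof -
    have "Im U < 0" using cone_Im[OF U] kb(1) by linarith
    then have lg: "cpw ln_u a U = cpw Ln a U" for a by (simp add: cpw_def ln_u_def)
    have p2: "cpw Ln (8/3) U = p U * p U" using cpw_add[of Ln "4/3" "4/3" U] by (simp add: p_def)
    have d: "Wu U - Ws U = of_real M * V CW U / p U" "Xu U - Xs U = V CX U" "Yu U - Ys U = V CY U"
      unfolding sol_defs lg p2 V_def p_def[symmetric] by (simp_all add: diff_divide_distrib right_diff_distrib)
    have ee: "\<Theta> * exp (- \<i> * U) * (e U * y) = y" if "\<Theta> \<noteq> 0" for y
    proof -
      have "exp (- \<i> * U) * exp (\<i> * U) = 1" by (simp flip: exp_add)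
      then show ?thesis using that by (simp add: e_def mult_ac)
    qed
    show ?thesis
    proof (cases "\<Theta> = 0")
      case True
      then show ?thesis using zero[OF U] d by simp
    next
      case False
      then show ?thesis unfolding d \<chi>1_def \<chi>2_def \<chi>3_def add_0 distrib_left ee[OF False] by simp
    qed
  qed
  have chi: "cmod (cpw Ln (7/3) U * \<chi>1 U) \<le> b2 \<and> cmod (U^2 * \<chi>2 U) \<le> b2 \<and> cmod (U * \<chi>3 U) \<le> b2"
    if U: "U \<in> down_cone t k" for U
  proof (cases "\<Theta> = 0")
    case True
    then show ?thesis using b2 by (simp add: \<chi>1_def \<chi>2_def \<chi>3_def e_def)
  next
    case False
    have U0: "0 < cmod U" using C0[OF U] by simp
    have BT: "B / cmod \<Theta> \<le> b2" "M * B / cmod \<Theta> \<le> b2"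
      using B M_pos by (auto simp: b2_def distrib_right add_divide_distrib)
    have "cmod (cpw Ln (7/3) U) = cmod U * cmod (p U)"
      using cpw_add[of Ln 1 "4/3" U] C0(1)[OF U] by (simp add: p_def norm_mult) (simp add: cpw_def)
    then have "cmod (cpw Ln (7/3) U * \<chi>1 U) = cmod U * (M * cmod (exp (\<i> * U) * V CW U)) / cmod \<Theta>"
      using False M_pos pnz[of U] by (simp add: \<chi>1_def e_def norm_mult norm_divide)
    also have "\<dots> \<le> cmod U * (M * (B / cmod U)) / cmod \<Theta>"
      using bW[OF U] M_pos by (intro divide_right_mono mult_left_mono) auto
    also have "\<dots> = M * B / cmod \<Theta>" using U0 by simp
    finally have 1: "cmod (cpw Ln (7/3) U * \<chi>1 U) \<le> b2" using BT by linarith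
    have "cmod (U^2 * \<chi>2 U) = cmod U ^ 2 * cmod (exp (\<i> * U) * V CX U) / cmod \<Theta>"
      using False by (simp add: \<chi>2_def e_def norm_mult norm_divide norm_power)
    also have "\<dots> \<le> cmod U ^ 2 * (B / cmod U ^ 2) / cmod \<Theta>"
      using bX[OF U] by (intro divide_right_mono mult_left_mono) auto
    also have "\<dots> = B / cmod \<Theta>" using U0 by simp
    finally have 2: "cmod (U^2 * \<chi>2 U) \<le> b2" using BT by linarith
    have "exp (\<i> * U) * exp (- \<i> * U) = 1" by (simp flip: exp_add)
    then have "exp (\<i> * U) * (V CY U - \<Theta> * exp (- \<i> * U)) = exp (\<i> * U) * V CY U - \<Theta>"
      by (simp only: right_diff_distrib mult.left_commute[of "exp (\<i> * U)" \<Theta>] mult_1_right)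
    then have "U * \<chi>3 U = U * (exp (\<i> * U) * V CY U - \<Theta>) / \<Theta>"
      using False by (simp only: \<chi>3_def e_def if_False times_divide_eq_left times_divide_eq_right)
    then have "cmod (U * \<chi>3 U) = cmod U * cmod (exp (\<i> * U) * V CY U - \<Theta>) / cmod \<Theta>"
      by (simp only: norm_mult norm_divide)
    also have "\<dots> \<le> cmod U * (B / cmod U) / cmod \<Theta>"
      using bY[OF U] by (intro divide_right_mono mult_left_mono) auto
    also have "\<dots> = B / cmod \<Theta>" using U0 by simp
    finally have 3: "cmod (U * \<chi>3 U) \<le> b2" using BT by linarith
    show ?thesis using 1 2 3 by blast
  qed
  show ?thesis
  proof (rule exI[of _ k], rule exI[of _ b1], rule exI[of _ b2], rule exI[of _ \<Theta>], intro conjI allI impI)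
    fix \<kappa> assume \<kappa>: "k \<le> \<kappa>"
    show "\<exists>Wu Xu Yu Ws Xs Ys \<chi>1 \<chi>2 \<chi>3.
       invariant_solution ln_u (Du \<beta>0 \<kappa>) Wu Xu Yu \<and>
       invariant_solution Ln (Ds \<beta>0 \<kappa>) Ws Xs Ys \<and>
       (\<forall>U\<in>Du \<beta>0 \<kappa>. cmod (cpw ln_u (8/3) U * Wu U) \<le> b1 \<and>
                       cmod (cpw ln_u (4/3) U * Xu U) \<le> b1 \<and>
                       cmod (cpw ln_u (4/3) U * Yu U) \<le> b1) \<and>
       (\<forall>U\<in>Ds \<beta>0 \<kappa>. cmod (cpw Ln (8/3) U * Ws U) \<le> b1 \<and>
                       cmod (cpw Ln (4/3) U * Xs U) \<le> b1 \<and>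
                       cmod (cpw Ln (4/3) U * Ys U) \<le> b1) \<and>
       (\<forall>U\<in>Ek \<beta>0 \<kappa>.
          Wu U - Ws U = \<Theta> * exp (- \<i> * U) * (0 + \<chi>1 U) \<and>
          Xu U - Xs U = \<Theta> * exp (- \<i> * U) * (0 + \<chi>2 U) \<and>
          Yu U - Ys U = \<Theta> * exp (- \<i> * U) * (1 + \<chi>3 U)) \<and>
       (\<forall>U\<in>Ek \<beta>0 \<kappa>. cmod (cpw Ln (7/3) U * \<chi>1 U) \<le> b2 \<and>
                       cmod (U^2 * \<chi>2 U) \<le> b2 \<and>
                       cmod (U * \<chi>3 U) \<le> b2)"
    proof (rule exI[of _ Wu], rule exI[of _ Xu], rule exI[of _ Yu], rule exI[of _ Ws], rule exI[of _ Xs], rule exI[of _ Ys],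
        rule exI[of _ \<chi>1], rule exI[of _ \<chi>2], rule exI[of _ \<chi>3], intro conjI)
      show "invariant_solution ln_u (Du \<beta>0 \<kappa>) Wu Xu Yu" by (rule sol_u[OF \<kappa>])
      show "invariant_solution Ln (Ds \<beta>0 \<kappa>) Ws Xs Ys" by (rule sol_s[OF \<kappa>])
    qed (intro ballI bound_u bound_s diffs chi Ek_sub[OF _ \<kappa>] subsetD[OF Du_sub[OF \<kappa>]] subsetD[OF Ds_sub[OF \<kappa>]]; assumption)+
  qed (use kb b1 b2 in auto)
qed

end
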